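(* Let $\mathcal{G}=(G,(J_v)_{v\in V},(O_v)_{v\in V},(T_e)_{e\in E})$ be a simple GIFS with limit set $K$, and for each $\epsilon\in(0,1)$ let $\mathcal{G}(\epsilon)=(\hat G,(J_v(\epsilon))_{v\in\hat V},(O_v(\epsilon))_{v\in\hat V},(T_e(\epsilon,\cdot))_{e\in\hat E})$ be a system with limit set $K(\epsilon)$. Assume: (a) $\mathcal{G}$ is such that $G$ has at least one strongly connected component; $\mathcal{G}$ is conformal and satisfies bounded distortion, $V$-summability, contractibility of the sets $J_v$, and either the strong separation condition or the open set condition. (b) $(\mathcal{G}(\epsilon))_{\epsilon\in(0,1)}$ is a degenerate perturbation of $\mathcal{G}$ with uniform inverse distortion. Moreover, for each $\epsilon\in(0,1)$, $\mathcal{G}(\epsilon)$ satisfies $V$-summability, contractibility of its sets $J_v(\epsilon)$, and either the strong separation condition, or both conformality and the open set condition. Let $\varphi:=\varphi^V$ be the potential of the unperturbed system $\mathcal{G}$. Then: (1) If there exists $s_0\in\mathbb{R}$ with $P(s_0\varphi)=0$ and $s_0\in I_P^{\hat V}$, then $\limsup_{\epsilon\to0}\dim_H K(\epsilon)\le\dim_H K$. (2) If there exists $s\in\mathbb{R}$ with $0<P(s\varphi)<+\infty$ and $s\in\underline{I}_P^{\hat V}$, then $\liminf_{\epsilon\to0}\dim_H K(\epsilon)\ge\dim_H K$. Consequently, if the hypotheses of both (1) and (2) hold, then $\lim_{\epsilon\to0}\dim_H K(\epsilon)=\dim_H K$.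
   Context: Fix an integer $D\ge 1$; $|\cdot|$ is the Euclidean norm on $\mathbb{R}^D$, $\|\cdot\|$ the operator norm, $\|M\|_i:=\|M^{-1}\|^{-1}$ for an invertible matrix $M$, $\dim_H$ the Hausdorff dimension, and $B(J,\rho)$ the open $\rho$-neighbourhood of a set $J$. Conventions: suprema of nonnegative quantities over empty sets are $0$, $\log 0=-\infty$. A GIFS is a system $(G,(J_v)_{v\in V},(O_v)_{v\in V},(T_e)_{e\in E})$ such that: (1) $G=(V,E,i,t)$ is a directed multigraph with countable (finite or infinite) vertex set $V$ and countable edge set $E$, where $i(e),t(e)\in V$ are the initial and terminal vertices of $e\in E$; (2) each $J_v\subset\mathbb{R}^D$ is compact and connected, equals the closure of its interior, and $\sup_v\operatorname{diam}(J_v)<\infty$; (3) each $O_v\subset\mathbb{R}^D$ is bounded, open and connected, and $c_{JO}:=\inf_v\operatorname{dist}(J_v,\mathbb{R}^D\setminus O_v)>0$; (4) each $T_e$ is a $C^1$-diffeomorphism from $O_{t(e)}$ onto an open subset of $O_{i(e)}$ with $T_e(J_{t(e)})\subset J_{i(e)}$, and there is $r\in(0,1)$ with $\sup_{e\in E}\sup_{x\in O_{t(e)}}\|T_e'(x)\|\le r$. The GIFS is simple if for all $v,u\in V$ there is at most one edge from $v$ to $u$; then $E\subset V\times V$, and the edge from $v$ to $u$ is written $vu$, with map $T_{vu}:O_u\to O_v$. A subgraph $G_0=(V_0,E_0)$ of $G$ is strongly connected if for any $v,u\in V_0$ there is a path of positive length in $G_0$ from $v$ to $u$. A strongly connected component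 is a strongly connected subgraph $G_0$ such that every strongly connected subgraph containing $G_0$ as a subgraph equals $G_0$. For a simple GIFS let $X^V=\{\omega\in V^{\mathbb{Z}_{\ge0}}:\omega_n\omega_{n+1}\in E\ \forall n\ge 0\}$, let $\sigma$ be the shift, define $\pi:X^V\to\mathbb{R}^D$ by $\{\pi\omega\}=\bigcap_{k\ge0}T_{\omega_0\omega_1}\circ\cdots\circ T_{\omega_k\omega_{k+1}}(J_{\omega_{k+1}})$; the limit set is $K=\pi(X^V)$. Put $\varphi^V(\omega)=\log\|T_{\omega_0\omega_1}'(\pi\sigma\omega)\|$, $\underline{\varphi}^V(\omega)=\log\|T_{\omega_0\omega_1}'(\pi\sigma\omega)\|_i$. For a real function $f$ on $X^V$, $P(f)=\lim_{n\to\infty}\frac1n\log\sum_{w\in V^n:[w]\ne\emptyset}\exp(\sup_{\omega\in[w]}\sum_{i=0}^{n-1}f(\sigma^i\omega))$, where $[w]=\{\omega\in X^V:\omega_0\cdots\omega_{n-1}=w\}$. Properties of a simple GIFS. Conformal: each $T_e$ is conformal. Strong separation condition: $T_e(J_{t(e)}\cap K)\cap T_{e'}(J_{t(e')}\cap K)=\emptyset$ for $e\ne e'$. Open set condition: $T_e(\operatorname{int}J_{t(e)})\cap T_{e'}(\operatorname{int}J_{t(e')})=\emptyset$ for $e\ne e'$. Bounded distortion: there exist $c_1>0$ and $0<\beta\le1$ with $\big|\|T_e'(x)\|-\|T_e'(y)\|\big|\le c_1\|T_e'(x)\|\,|x-y|^\beta$ for all $e\in E$, $x,y\in O_{t(e)}$.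 $V$-summability: there exists $s\ge0$ with $P(s\underline{\varphi}^V)=0$ and $\sum_{v\in V}\sup_{u:\,vu\in E}\sup_{x\in K\cap J_u}\|T_{vu}'(x)\|_i^s<\infty$. Contractibility of the sets $J_v$: there exists $c_2>0$ with $\operatorname{diam}J_v\le c_2\sup_{e:\,i(e)=v}\sup_{z\in J_{t(e)}}\|T_e'(z)\|$ for every $v\in V$. For $\mathcal{G}(\epsilon)$ these properties are meant with $\hat G$, $J_v(\epsilon)$, $O_v(\epsilon)$, $T_e(\epsilon,\cdot)$, $K(\epsilon)$ in place of $G,J_v,O_v,T_e,K$. Degenerate perturbation of $\mathcal{G}$: for each $\epsilon\in(0,1)$, $\mathcal{G}(\epsilon)$ is a simple GIFS with graph $\hat G=(\hat V,\hat E)$ not depending on $\epsilon$ and containing $G$ as a subgraph, and the following hold, where $T_e'(\epsilon,x)$ is the derivative of $T_e(\epsilon,\cdot)$ at $x$. (i) There is $\epsilon_0>0$ with $\inf_{0<\epsilon<\epsilon_0}\inf_{v\in\hat V}\operatorname{dist}(J_v(\epsilon),\mathbb{R}^D\setminus O_v(\epsilon))>0$. (ii) There are $c_3\in(0,c_{JO})$ (with $c_{JO}$ that of $\mathcal{G}$), $\epsilon_0>0$, and compact connected sets $J_v\subset\mathbb{R}^D$ for $v\in\hat V\setminus V$ with $\sup_v\operatorname{diam}J_v<\infty$, such that $J_v(\epsilon)\subset B(J_v,c_3)$ for all $0<\epsilon<\epsilon_0$, $v\in\hat V$. (iii) There are points $a_v\in J_v$ ($v\in\hat V$) such that, letting $T_e(x):\equiv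 a_{i(e)}$ (constant map) for $e\in\hat E\setminus E$, one has $\sup_{e\in\hat E}\sup_{x\in J_{t(e)}(\epsilon)}|T_e(\epsilon,x)-T_e(x)|\to0$ as $\epsilon\to0$. (iv) For each $v\in\hat V$, $\sup_{e\in\hat E:\,i(e)=v}\sup_{x\in J_{t(e)}(\epsilon)}\|T_e'(\epsilon,x)-T_e'(x)\|\to0$ as $\epsilon\to0$. (v) There is $\epsilon_0>0$ with $\sup_{0<\epsilon<\epsilon_0}\sup_{e\in\hat E}\sup_{x\in J_{t(e)}(\epsilon)}\|T_e'(\epsilon,x)\|<1$. (vi) There is $c_4>0$ with $\big|\|T_e'(\epsilon,x)\|-\|T_e'(\epsilon,y)\|\big|\le c_4\|T_e'(\epsilon,x)\|\,|x-y|^\beta$ for all $\epsilon\in(0,1)$, $e\in\hat E$, $x,y\in O_{t(e)}(\epsilon)$ (with $\beta\in(0,1]$ as in bounded distortion). Uniform inverse distortion: there is $c_5>0$ with $\big|\|T_e'(\epsilon,x)\|_i-\|T_e'(\epsilon,y)\|_i\big|\le c_5\|T_e'(\epsilon,x)\|_i\,|x-y|^\beta$ for all $\epsilon\in(0,1)$, $e\in\hat E$, $x,y\in O_{t(e)}(\epsilon)$. Finally, $$I_P^{\hat V}=\Big\{s\ge0:\sum_{v\in\hat V}\sup_{0<\epsilon<\epsilon_0}\sup_{u:\,vu\in\hat E}\sup_{x\in J_u(\epsilon)}\|T_{vu}'(\epsilon,x)\|^s<\infty\text{ for some }\epsilon_0>0\Big\},$$ and $\underline{I}_P^{\hat V}$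 is defined in the same way with $\|\cdot\|_i$ in place of $\|\cdot\|$. *)

theory Defs
  imports "HOL-Analysis.Analysis"
begin

section \<open>Extended exponential and logarithm\<close>

definition exp_ereal :: "ereal \<Rightarrow> ennreal" where
  "exp_ereal x = (if x = -\<infinity> then 0 else if x = \<infinity> then \<infinity> else ennreal (exp (real_of_ereal x)))"

definition ln_ennreal :: "ennreal \<Rightarrow> ereal" where
  "ln_ennreal x = (if x = 0 then -\<infinity> else if x = \<infinity> then \<infinity> else ereal (ln (enn2real x)))"


section \<open>Hausdorff dimension\<close>

text \<open>The case distinctions fix the conventions that the empty set contributes nothing and that
  \<open>0 ^ 0 = 1\<close> for non-empty sets (whereas \<open>0 powr 0 = 0\<close>).\<close>

definition diam_pow :: "real \<Rightarrow> 'a::metric_space set \<Rightarrow> ennreal" where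
  "diam_pow s U = (if U = {} then 0 else if s = 0 then 1 else ennreal (diameter U powr s))"

text \<open>Covers consist of bounded sets because \<^const>\<open>diameter\<close> is meaningless on unbounded ones.\<close>

definition hausdorff_premeasure :: "real \<Rightarrow> real \<Rightarrow> 'a::metric_space set \<Rightarrow> ennreal" where
  "hausdorff_premeasure s \<delta> A =
     (INF U \<in> {U :: nat \<Rightarrow> 'a set. A \<subseteq> (\<Union>i. U i) \<and> (\<forall>i. bounded (U i) \<and> diameter (U i) \<le> \<delta>)}.
        \<Sum>i. diam_pow s (U i))"

definition hausdorff_measure :: "real \<Rightarrow> 'a::metric_space set \<Rightarrow> ennreal" where
  "hausdorff_measure s A = (SUP \<delta>\<in>{0<..}. hausdorff_premeasure s \<delta> A)"

definition hausdorff_dim :: "'a::metric_space set \<Rightarrow> ereal" where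
  "hausdorff_dim A = (INF s \<in> {s. 0 \<le> s \<and> hausdorff_measure s A = 0}. ereal s)"


section \<open>Derivatives\<close>

text \<open>As a bounded linear function, so that \<^const>\<open>norm\<close> is the operator norm.\<close>

definition Der :: "('a::euclidean_space \<Rightarrow> 'a) \<Rightarrow> 'a \<Rightarrow> 'a \<Rightarrow>\<^sub>L 'a" where
  "Der f x = Blinfun (frechet_derivative f (at x))"

definition inorm :: "('a::euclidean_space \<Rightarrow>\<^sub>L 'a) \<Rightarrow> real" where
  "inorm M = inverse (norm (Blinfun (inv (blinfun_apply M))))"

definition C1_on :: "('a::euclidean_space \<Rightarrow> 'a) \<Rightarrow> 'a set \<Rightarrow> bool" where
  "C1_on f S \<longleftrightarrow> (\<forall>x\<in>S. f differentiable (at x)) \<and> continuous_on S (Der f)"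

text \<open>A \<open>C\<^sup>1\<close>-diffeomorphism of the open set \<open>S\<close> onto an open set.\<close>

definition C1_diffeo_on :: "('a::euclidean_space \<Rightarrow> 'a) \<Rightarrow> 'a set \<Rightarrow> bool" where
  "C1_diffeo_on f S \<longleftrightarrow> open S \<and> C1_on f S \<and> inj_on f S \<and> open (f ` S) \<and>
     C1_on (inv_into S f) (f ` S)"

definition conformal_on :: "('a::euclidean_space \<Rightarrow> 'a) \<Rightarrow> 'a set \<Rightarrow> bool" where
  "conformal_on f S \<longleftrightarrow> (\<forall>x\<in>S. \<exists>c>0. \<exists>Q. orthogonal_transformation Q \<and>
     blinfun_apply (Der f x) = (\<lambda>h. c *\<^sub>R Q h))"


section \<open>Strongly connected components\<close>

text \<open>Graphs are simple, so edges are ordered pairs. Paths have positive length (hence the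
  transitive, not the reflexive-transitive closure), and the empty graph is not counted as
  strongly connected.\<close>

definition strongly_connected_subgraph ::
  "'v set \<Rightarrow> ('v \<times> 'v) set \<Rightarrow> 'v set \<Rightarrow> ('v \<times> 'v) set \<Rightarrow> bool" where
  "strongly_connected_subgraph V E V0 E0 \<longleftrightarrow>
     V0 \<noteq> {} \<and> V0 \<subseteq> V \<and> E0 \<subseteq> E \<and> E0 \<subseteq> V0 \<times> V0 \<and> (\<forall>v\<in>V0. \<forall>u\<in>V0. (v, u) \<in> E0\<^sup>+)"

definition strongly_connected_component ::
  "'v set \<Rightarrow> ('v \<times> 'v) set \<Rightarrow> 'v set \<Rightarrow> ('v \<times> 'v) set \<Rightarrow> bool" where
  "strongly_connected_component V E V0 E0 \<longleftrightarrow> strongly_connected_subgraph V E V0 E0 \<and>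
     (\<forall>V1 E1. strongly_connected_subgraph V E V1 E1 \<and> V0 \<subseteq> V1 \<and> E0 \<subseteq> E1 \<longrightarrow> V1 = V0 \<and> E1 = E0)"


section \<open>Simple graph iterated function systems\<close>

text \<open>For a vertex \<open>v\<close>, \<open>cell v\<close> is \<open>J\<^sub>v\<close> and \<open>nbhd v\<close> is \<open>O\<^sub>v\<close>. An edge \<open>e\<close> has
  \<open>i(e) = fst e\<close> and \<open>t(e) = snd e\<close>, and \<open>emap e\<close> is \<open>T\<^sub>e\<close>.\<close>

record ('v, 'a) gsys =
  verts :: "'v set"
  edges :: "('v \<times> 'v) set"
  cell :: "'v \<Rightarrow> 'a set"
  nbhd :: "'v \<Rightarrow> 'a set"
  emap :: "'v \<times> 'v \<Rightarrow> 'a \<Rightarrow> 'a"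

definition gap :: "('v, 'a::euclidean_space) gsys \<Rightarrow> ennreal" where
  "gap G = (INF v\<in>verts G. ennreal (setdist (cell G v) (- nbhd G v)))"

text \<open>The sets \<open>J\<^sub>v\<close> are non-empty: this is implicit in the existence of the coding map.\<close>

definition simple_gifs :: "('v, 'a::euclidean_space) gsys \<Rightarrow> bool" where
  "simple_gifs G \<longleftrightarrow>
     countable (verts G) \<and> edges G \<subseteq> verts G \<times> verts G \<and>
     (\<forall>v\<in>verts G. cell G v \<noteq> {} \<and> compact (cell G v) \<and> connected (cell G v) \<and>
        cell G v = closure (interior (cell G v))) \<and>
     (SUP v\<in>verts G. ennreal (diameter (cell G v))) < \<infinity> \<and>
     (\<forall>v\<in>verts G. bounded (nbhd G v) \<and> open (nbhd G v) \<and> connected (nbhd G v)) \<and>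
     gap G > 0 \<and>
     (\<forall>e\<in>edges G. C1_diffeo_on (emap G e) (nbhd G (snd e)) \<and>
        emap G e ` nbhd G (snd e) \<subseteq> nbhd G (fst e) \<and>
        emap G e ` cell G (snd e) \<subseteq> cell G (fst e)) \<and>
     (\<exists>r. 0 < r \<and> r < 1 \<and> (\<forall>e\<in>edges G. \<forall>x\<in>nbhd G (snd e). norm (Der (emap G e) x) \<le> r))"


subsection \<open>Coding, limit set, potentials and pressure\<close>

definition paths :: "('v, 'a) gsys \<Rightarrow> (nat \<Rightarrow> 'v) set" where
  "paths G = {\<omega>. (\<forall>n. \<omega> n \<in> verts G) \<and> (\<forall>n. (\<omega> n, \<omega> (Suc n)) \<in> edges G)}"

definition shift :: "(nat \<Rightarrow> 'v) \<Rightarrow> nat \<Rightarrow> 'v" where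
  "shift \<omega> = (\<lambda>n. \<omega> (Suc n))"

primrec path_map :: "('v, 'a) gsys \<Rightarrow> (nat \<Rightarrow> 'v) \<Rightarrow> nat \<Rightarrow> 'a \<Rightarrow> 'a" where
  "path_map G \<omega> 0 = emap G (\<omega> 0, \<omega> 1)"
| "path_map G \<omega> (Suc k) = path_map G \<omega> k \<circ> emap G (\<omega> (Suc k), \<omega> (Suc (Suc k)))"

definition coding :: "('v, 'a) gsys \<Rightarrow> (nat \<Rightarrow> 'v) \<Rightarrow> 'a" where
  "coding G \<omega> = the_elem (\<Inter>k. path_map G \<omega> k ` cell G (\<omega> (Suc k)))"

definition limit_set :: "('v, 'a) gsys \<Rightarrow> 'a set" where
  "limit_set G = coding G ` paths G"

definition pot :: "('v, 'a::euclidean_space) gsys \<Rightarrow> (nat \<Rightarrow> 'v) \<Rightarrow> real" where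
  "pot G \<omega> = ln (norm (Der (emap G (\<omega> 0, \<omega> 1)) (coding G (shift \<omega>))))"

definition pot_low :: "('v, 'a::euclidean_space) gsys \<Rightarrow> (nat \<Rightarrow> 'v) \<Rightarrow> real" where
  "pot_low G \<omega> = ln (inorm (Der (emap G (\<omega> 0, \<omega> 1)) (coding G (shift \<omega>))))"

definition cylinder :: "('v, 'a) gsys \<Rightarrow> 'v list \<Rightarrow> (nat \<Rightarrow> 'v) set" where
  "cylinder G w = {\<omega> \<in> paths G. map \<omega> [0..<length w] = w}"

definition partition_sum :: "('v, 'a) gsys \<Rightarrow> ((nat \<Rightarrow> 'v) \<Rightarrow> real) \<Rightarrow> nat \<Rightarrow> ennreal" where
  "partition_sum G f n =
     (\<Sum>\<^sub>\<infinity>w\<in>{w. length w = n \<and> set w \<subseteq> verts G \<and> cylinder G w \<noteq> {}}.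
        exp_ereal (SUP \<omega>\<in>cylinder G w. ereal (\<Sum>i<n. f ((shift ^^ i) \<omega>))))"

text \<open>\<open>P(f) = p\<close>, including the existence of the limit that defines \<open>P(f)\<close>.\<close>

definition has_pressure :: "('v, 'a) gsys \<Rightarrow> ((nat \<Rightarrow> 'v) \<Rightarrow> real) \<Rightarrow> ereal \<Rightarrow> bool" where
  "has_pressure G f p \<longleftrightarrow>
     (\<lambda>n. ln_ennreal (partition_sum G f n) / ereal (real n)) \<longlonglongrightarrow> p"


subsection \<open>Properties of a simple system\<close>

text \<open>Suprema of non-negative quantities are taken in \<^typ>\<open>ennreal\<close>, where the supremum of the
  empty set is \<open>0\<close>.\<close>

definition conformal :: "('v, 'a::euclidean_space) gsys \<Rightarrow> bool" where
  "conformal G \<longleftrightarrow> (\<forall>e\<in>edges G. conformal_on (emap G e) (nbhd G (snd e)))"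

definition strong_separation :: "('v, 'a) gsys \<Rightarrow> bool" where
  "strong_separation G \<longleftrightarrow> (\<forall>e\<in>edges G. \<forall>e'\<in>edges G. e \<noteq> e' \<longrightarrow>
     emap G e ` (cell G (snd e) \<inter> limit_set G) \<inter> emap G e' ` (cell G (snd e') \<inter> limit_set G) = {})"

definition open_set_condition :: "('v, 'a::euclidean_space) gsys \<Rightarrow> bool" where
  "open_set_condition G \<longleftrightarrow> (\<forall>e\<in>edges G. \<forall>e'\<in>edges G. e \<noteq> e' \<longrightarrow>
     emap G e ` interior (cell G (snd e)) \<inter> emap G e' ` interior (cell G (snd e')) = {})"

definition bounded_distortion :: "real \<Rightarrow> ('v, 'a::euclidean_space) gsys \<Rightarrow> bool" where
  "bounded_distortion \<beta> G \<longleftrightarrow>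
     (\<exists>c1>0. \<forall>e\<in>edges G. \<forall>x\<in>nbhd G (snd e). \<forall>y\<in>nbhd G (snd e).
        \<bar>norm (Der (emap G e) x) - norm (Der (emap G e) y)\<bar>
          \<le> c1 * norm (Der (emap G e) x) * norm (x - y) powr \<beta>)"

definition V_summable :: "('v, 'a::euclidean_space) gsys \<Rightarrow> bool" where
  "V_summable G \<longleftrightarrow>
     (\<exists>s\<ge>0. has_pressure G (\<lambda>\<omega>. s * pot_low G \<omega>) 0 \<and>
        (\<Sum>\<^sub>\<infinity>v\<in>verts G. SUP u\<in>{u. (v, u) \<in> edges G}. SUP x\<in>limit_set G \<inter> cell G u.
           ennreal (inorm (Der (emap G (v, u)) x) powr s)) < \<infinity>)"

definition contractible_cells :: "('v, 'a::euclidean_space) gsys \<Rightarrow> bool" where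
  "contractible_cells G \<longleftrightarrow>
     (\<exists>c2>0. \<forall>v\<in>verts G. ennreal (diameter (cell G v)) \<le>
        ennreal c2 * (SUP e\<in>{e\<in>edges G. fst e = v}. SUP z\<in>cell G (snd e).
          ennreal (norm (Der (emap G e) z))))"


subsection \<open>Degenerate perturbations\<close>

text \<open>\<open>Gp \<epsilon>\<close> is the perturbed system for \<open>0 < \<epsilon> < 1\<close>, with graph \<open>(Vh, Eh)\<close>. The family \<open>Jh\<close>
  extends the cells of \<open>G\<close> to \<open>Vh\<close>, and \<open>T\<close> extends its edge maps to \<open>Eh\<close> by constants.\<close>

definition degenerate_perturbation ::
  "real \<Rightarrow> ('v, 'a::euclidean_space) gsys \<Rightarrow> 'v set \<Rightarrow> ('v \<times> 'v) set \<Rightarrow>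
   (real \<Rightarrow> ('v, 'a) gsys) \<Rightarrow> bool" where
  "degenerate_perturbation \<beta> G Vh Eh Gp \<longleftrightarrow>
     verts G \<subseteq> Vh \<and> edges G \<subseteq> Eh \<and>
     (\<forall>\<epsilon>\<in>{0<..<1}. simple_gifs (Gp \<epsilon>) \<and> verts (Gp \<epsilon>) = Vh \<and> edges (Gp \<epsilon>) = Eh) \<and>
     (\<exists>\<epsilon>0>0. (INF \<epsilon>\<in>{0<..<\<epsilon>0}. gap (Gp \<epsilon>)) > 0) \<and>
     (\<exists>Jh a T.
        (\<forall>v\<in>verts G. Jh v = cell G v) \<and>
        (\<forall>v\<in>Vh - verts G. compact (Jh v) \<and> connected (Jh v)) \<and>
        (SUP v\<in>Vh. ennreal (diameter (Jh v))) < \<infinity> \<and>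
        (\<exists>c3>0. ennreal c3 < gap G \<and>
           (\<exists>\<epsilon>0>0. \<forall>\<epsilon>\<in>{0<..<\<epsilon>0}. \<forall>v\<in>Vh. cell (Gp \<epsilon>) v \<subseteq> (\<Union>y\<in>Jh v. ball y c3))) \<and>
        (\<forall>v\<in>Vh. a v \<in> Jh v) \<and>
        (\<forall>e\<in>Eh. T e = (if e \<in> edges G then emap G e else (\<lambda>x. a (fst e)))) \<and>
        ((\<lambda>\<epsilon>. SUP e\<in>Eh. SUP x\<in>cell (Gp \<epsilon>) (snd e).
            ennreal (norm (emap (Gp \<epsilon>) e x - T e x))) \<longlongrightarrow> 0) (at_right 0) \<and>
        (\<forall>v\<in>Vh. ((\<lambda>\<epsilon>. SUP e\<in>{e\<in>Eh. fst e = v}. SUP x\<in>cell (Gp \<epsilon>) (snd e).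
            ennreal (norm (Der (emap (Gp \<epsilon>) e) x - Der (T e) x))) \<longlongrightarrow> 0) (at_right 0))) \<and>
     (\<exists>\<epsilon>0>0. (SUP \<epsilon>\<in>{0<..<\<epsilon>0}. SUP e\<in>Eh. SUP x\<in>cell (Gp \<epsilon>) (snd e).
         ennreal (norm (Der (emap (Gp \<epsilon>) e) x))) < 1) \<and>
     (\<exists>c4>0. \<forall>\<epsilon>\<in>{0<..<1}. \<forall>e\<in>Eh. \<forall>x\<in>nbhd (Gp \<epsilon>) (snd e). \<forall>y\<in>nbhd (Gp \<epsilon>) (snd e).
        \<bar>norm (Der (emap (Gp \<epsilon>) e) x) - norm (Der (emap (Gp \<epsilon>) e) y)\<bar>
          \<le> c4 * norm (Der (emap (Gp \<epsilon>) e) x) * norm (x - y) powr \<beta>)"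

definition uniform_inverse_distortion ::
  "real \<Rightarrow> ('v \<times> 'v) set \<Rightarrow> (real \<Rightarrow> ('v, 'a::euclidean_space) gsys) \<Rightarrow> bool" where
  "uniform_inverse_distortion \<beta> Eh Gp \<longleftrightarrow>
     (\<exists>c5>0. \<forall>\<epsilon>\<in>{0<..<1}. \<forall>e\<in>Eh. \<forall>x\<in>nbhd (Gp \<epsilon>) (snd e). \<forall>y\<in>nbhd (Gp \<epsilon>) (snd e).
        \<bar>inorm (Der (emap (Gp \<epsilon>) e) x) - inorm (Der (emap (Gp \<epsilon>) e) y)\<bar>
          \<le> c5 * inorm (Der (emap (Gp \<epsilon>) e) x) * norm (x - y) powr \<beta>)"

definition I_P ::
  "'v set \<Rightarrow> ('v \<times> 'v) set \<Rightarrow> (real \<Rightarrow> ('v, 'a::euclidean_space) gsys) \<Rightarrow> real set" where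
  "I_P Vh Eh Gp = {s. 0 \<le> s \<and> (\<exists>\<epsilon>0>0.
     (\<Sum>\<^sub>\<infinity>v\<in>Vh. SUP \<epsilon>\<in>{0<..<\<epsilon>0}. SUP u\<in>{u. (v, u) \<in> Eh}. SUP x\<in>cell (Gp \<epsilon>) u.
        ennreal (norm (Der (emap (Gp \<epsilon>) (v, u)) x) powr s)) < \<infinity>)}"

definition I_P_low ::
  "'v set \<Rightarrow> ('v \<times> 'v) set \<Rightarrow> (real \<Rightarrow> ('v, 'a::euclidean_space) gsys) \<Rightarrow> real set" where
  "I_P_low Vh Eh Gp = {s. 0 \<le> s \<and> (\<exists>\<epsilon>0>0.
     (\<Sum>\<^sub>\<infinity>v\<in>Vh. SUP \<epsilon>\<in>{0<..<\<epsilon>0}. SUP u\<in>{u. (v, u) \<in> Eh}. SUP x\<in>cell (Gp \<epsilon>) u.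
        ennreal (inorm (Der (emap (Gp \<epsilon>) (v, u)) x) powr s)) < \<infinity>)}"

end

theory Submission
  imports Defs "HOL-Library.Sublist"
begin

text \<open>By \<open>V\<close>-summability the pressure has a zero \<open>s\<close>, and the dimensions of \<open>K\<close> and of
  \<open>K(\<epsilon>)\<close> are compared with \<open>s\<close>.

  For \<open>t > s\<close> the sum over all words of length \<open>n\<close> of the \<open>t\<close>-th powers of their contraction
  rates decays exponentially in \<open>n\<close>. It is submultiplicative in \<open>n\<close>, so it yields the upper bound
  \<open>t\<close> as soon as it is less than \<open>1\<close> for one \<open>n\<close>, and for fixed \<open>n\<close> it passes to small \<open>\<epsilon>\<close>
  up to a constant by dominated convergence; the dominating series is the one in \<open>I_P\<close>.

  For \<open>t < s\<close> there are, at some vertex, finitely many loops of equal length whose contraction rates have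
  an arbitrarily large sum of \<open>t\<close>-th powers: otherwise, splitting words at the first and last visits to
  finitely many vertices, the partition function at \<open>s\<close> would decay. Such a finite family of loops
  persists for small \<open>\<epsilon>\<close>, and distributing mass over its codes gives the lower bound \<open>t\<close>. Working
  with loops at one vertex avoids Gibbs measures and any irreducibility assumption, and distortion
  constants are harmless because the sums can be made as large as needed.\<close>


section \<open>Sums of extended non-negative reals\<close>

text \<open>Derivatives of the perturbed maps converge only for one initial vertex at a time, so
  they are under control along finitely many words only. This is why the upper bound stays at one
  fixed length and needs a summable majorant for the remaining words, and why the lower bound has to
  come from a finite family. The maps on new edges tend to constants, so their derivatives tend to
  0: there the comparison with \<open>G\<close> is additive, and only on words of \<open>G\<close>
  is it multiplicative.

  Unperturbed distortion is used at points of perturbed orbits. This is possible because perturbed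
  cells stay closer to the cells of \<open>G\<close> than the gap between those cells and the
  complements of their neighbourhoods.

  Under strong separation the perturbed maps need not be conformal. Norms bound them from above and
  smallest stretching factors from below; near a conformal limit the two almost agree.

  The zero in \<open>I_P\<close> and the zero \<open>s\<close> are given separately. The former is
  at most \<open>s\<close>, since the sums over words decay at every exponent above
  \<open>s\<close>.\<close>

text \<open>In \<open>ennreal\<close> a sum is the supremum of its finite partial sums, so upper
  bounds only have to be checked on finite subsets. The inequalities for infinite sums below all
  reduce to this.\<close>

lemma infsum_ennreal_leI:
  fixes f :: "'i \<Rightarrow> ennreal"
  assumes "\<And>F. finite F \<Longrightarrow> F \<subseteq> A \<Longrightarrow> sum f F \<le> c"
  shows "infsum f A \<le> c"
  by (subst nonneg_infsum_complete) (auto intro!: SUP_least assms)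

lemma sum_le_infsum_ennreal:
  fixes f :: "'i \<Rightarrow> ennreal"
  assumes "finite F" "F \<subseteq> A"
  shows "sum f F \<le> infsum f A"
  by (subst nonneg_infsum_complete) (auto intro!: SUP_upper2[where i = F] assms)

lemma le_infsum_ennreal:
  fixes f :: "'i \<Rightarrow> ennreal"
  assumes "x \<in> A"
  shows "f x \<le> infsum f A"
  using sum_le_infsum_ennreal[of "{x}" A f] assms by simp

lemma infsum_ennreal_mono:
  fixes f g :: "'i \<Rightarrow> ennreal"
  assumes "A \<subseteq> B" "\<And>x. x \<in> A \<Longrightarrow> f x \<le> g x"
  shows "infsum f A \<le> infsum g B"
proof (rule infsum_ennreal_leI)
  fix F assume F: "finite F" "F \<subseteq> A"
  have "sum f F \<le> sum g F" using F assms by (intro sum_mono) auto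
  also have "\<dots> \<le> infsum g B" using F assms by (intro sum_le_infsum_ennreal) auto
  finally show "sum f F \<le> infsum g B" .
qed

lemma infsum_ennreal_cmult_le:
  fixes f :: "'i \<Rightarrow> ennreal"
  shows "(\<Sum>\<^sub>\<infinity>x\<in>A. c * f x) \<le> c * infsum f A"
proof (rule infsum_ennreal_leI)
  fix F assume F: "finite F" "F \<subseteq> A"
  have "(\<Sum>x\<in>F. c * f x) = c * sum f F" by (simp add: sum_distrib_left)
  also have "\<dots> \<le> c * infsum f A" using F by (intro mult_left_mono sum_le_infsum_ennreal) auto
  finally show "(\<Sum>x\<in>F. c * f x) \<le> c * infsum f A" .
qed

lemma infsum_ennreal_prod_le:
  fixes f :: "'i \<Rightarrow> ennreal" and g :: "'j \<Rightarrow> ennreal"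
  shows "(\<Sum>\<^sub>\<infinity>z\<in>A \<times> B. f (fst z) * g (snd z)) \<le> infsum f A * infsum g B"
proof (rule infsum_ennreal_leI)
  fix F assume F: "finite F" "F \<subseteq> A \<times> B"
  have "(\<Sum>z\<in>F. f (fst z) * g (snd z)) \<le> (\<Sum>z\<in>fst ` F \<times> snd ` F. f (fst z) * g (snd z))"
    using F by (intro sum_mono2) (auto intro: rev_image_eqI)
  also have "\<dots> = sum f (fst ` F) * sum g (snd ` F)"
    by (simp add: sum_product sum.cartesian_product case_prod_unfold)
  also have "\<dots> \<le> infsum f A * infsum g B"
    using F by (intro mult_mono sum_le_infsum_ennreal) auto
  finally show "(\<Sum>z\<in>F. f (fst z) * g (snd z)) \<le> infsum f A * infsum g B" .
qed

text \<open>Only an inequality, since \<open>h\<close> may identify indices: a finite part of the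
  image lifts to a finite set on which \<open>h\<close> is injective. Sums over words can thus be
  estimated by sums over decompositions without proving the decomposition unique.\<close>

lemma infsum_ennreal_image_le:
  fixes f :: "'i \<Rightarrow> ennreal"
  shows "infsum f (h ` A) \<le> (\<Sum>\<^sub>\<infinity>x\<in>A. f (h x))"
proof (rule infsum_ennreal_leI)
  fix F assume F: "finite F" "F \<subseteq> h ` A"
  then obtain F' where F': "F' \<subseteq> A" "inj_on h F'" "F = h ` F'" by (metis subset_image_inj)
  then have "finite F'" using F by (metis finite_imageD)
  have "sum f F = (\<Sum>x\<in>F'. f (h x))" using F' by (simp add: sum.reindex)
  also have "\<dots> \<le> (\<Sum>\<^sub>\<infinity>x\<in>A. f (h x))" using F' \<open>finite F'\<close> by (intro sum_le_infsum_ennreal)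
  finally show "sum f F \<le> (\<Sum>\<^sub>\<infinity>x\<in>A. f (h x))" .
qed

lemma infsum_ennreal_inj_le:
  fixes f :: "'i \<Rightarrow> ennreal"
  assumes "inj_on h A" "h ` A \<subseteq> B"
  shows "(\<Sum>\<^sub>\<infinity>x\<in>A. f (h x)) \<le> infsum f B"
proof (rule infsum_ennreal_leI)
  fix F assume F: "finite F" "F \<subseteq> A"
  have "(\<Sum>x\<in>F. f (h x)) = sum f (h ` F)"
    using F assms by (subst sum.reindex) (auto intro: inj_on_subset)
  also have "\<dots> \<le> infsum f B" using F assms by (intro sum_le_infsum_ennreal) auto
  finally show "(\<Sum>x\<in>F. f (h x)) \<le> infsum f B" .
qed

lemma infsum_ennreal_Un_le:
  fixes f :: "'i \<Rightarrow> ennreal"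
  shows "infsum f (A \<union> B) \<le> infsum f A + infsum f B"
proof (rule infsum_ennreal_leI)
  fix F assume F: "finite F" "F \<subseteq> A \<union> B"
  have "sum f F = sum f (F \<inter> A) + sum f (F - A)"
    by (rule sum.Int_Diff[OF F(1)])
  also have "\<dots> \<le> infsum f A + infsum f B"
    using F by (intro add_mono sum_le_infsum_ennreal) auto
  finally show "sum f F \<le> infsum f A + infsum f B" .
qed

lemma infsum_ennreal_layers_le:
  fixes f :: "'i \<Rightarrow> ennreal" and n :: "'i \<Rightarrow> nat"
  shows "infsum f A \<le> (\<Sum>k. infsum f {x\<in>A. n x = k})"
proof (rule infsum_ennreal_leI)
  fix F assume F: "finite F" "F \<subseteq> A"
  have "sum f F = (\<Sum>k\<in>n ` F. sum f {x\<in>F. n x = k})"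
    by (rule sum.image_gen[OF F(1)])
  also have "\<dots> \<le> (\<Sum>k\<in>n ` F. infsum f {x\<in>A. n x = k})"
    using F by (intro sum_mono sum_le_infsum_ennreal) auto
  also have "\<dots> \<le> (\<Sum>k. infsum f {x\<in>A. n x = k})"
    using F by (intro sum_le_suminf) auto
  finally show "sum f F \<le> (\<Sum>k. infsum f {x\<in>A. n x = k})" .
qed

lemma infsum_ennreal_tail:
  fixes f :: "'i \<Rightarrow> ennreal"
  assumes "infsum f A < \<infinity>" "0 < \<delta>"
  obtains F where "finite F" "F \<subseteq> A" "infsum f (A - F) \<le> \<delta>"
proof -
  have "\<exists>F. finite F \<and> F \<subseteq> A \<and> infsum f A \<le> sum f F + \<delta>"
  proof (cases "infsum f A = 0")
    case True
    then show ?thesis by (intro exI[of _ "{}"]) auto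
  next
    case False
    have "infsum f A - \<delta> < infsum f A"
      using assms False by (intro ennreal_between) (auto simp: zero_less_iff_neq_zero)
    then have "\<exists>F\<in>{F. finite F \<and> F \<subseteq> A}. infsum f A - \<delta> < sum f F"
      unfolding nonneg_infsum_complete[of A f, simplified] less_SUP_iff by auto
    then obtain F where "finite F" "F \<subseteq> A" "infsum f A - \<delta> < sum f F" by blast
    then show ?thesis
      by (intro exI[of _ F]) (auto simp: ennreal_minus_le_iff add.commute dest!: less_imp_le)
  qed
  then obtain F where F: "finite F" "F \<subseteq> A" "infsum f A \<le> sum f F + \<delta>" by blast
  have "infsum f (A - F) \<le> \<delta>"
  proof (rule infsum_ennreal_leI)
    fix F' assume F': "finite F'" "F' \<subseteq> A - F"
    have "sum f F + sum f F' = sum f (F \<union> F')"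
      using F F' by (subst sum.union_disjoint) auto
    also have "\<dots> \<le> infsum f A" using F F' by (intro sum_le_infsum_ennreal) auto
    also have "\<dots> \<le> sum f F + \<delta>" by (fact F)
    finally have "sum f F + sum f F' \<le> sum f F + \<delta>" .
    moreover have "sum f F < \<infinity>"
      using sum_le_infsum_ennreal[OF F(1,2), of f] assms by order
    ultimately show "sum f F' \<le> \<delta>" by (auto simp: ennreal_add_left_cancel_le)
  qed
  with F that show thesis by blast
qed

section \<open>Bounds for the Hausdorff dimension\<close>

lemma hausdorff_dim_leI:
  assumes "0 \<le> s" "hausdorff_measure s A = 0"
  shows "hausdorff_dim A \<le> ereal s"
  unfolding hausdorff_dim_def using assms by (auto intro!: INF_lower)

lemma hausdorff_dim_geI:
  assumes "\<And>s. 0 \<le> s \<Longrightarrow> s < t \<Longrightarrow> hausdorff_measure s A \<noteq> 0"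
  shows "ereal t \<le> hausdorff_dim A"
  unfolding hausdorff_dim_def
  by (rule INF_greatest) (use assms in \<open>force simp: not_less[symmetric]\<close>)

lemma hausdorff_dim_nonneg: "0 \<le> hausdorff_dim A"
  unfolding hausdorff_dim_def by (rule INF_greatest) auto

lemma hausdorff_premeasure_mono:
  assumes "A \<subseteq> B"
  shows "hausdorff_premeasure s \<delta> A \<le> hausdorff_premeasure s \<delta> B"
  unfolding hausdorff_premeasure_def by (rule INF_superset_mono) (use assms in auto)

lemma hausdorff_measure_mono:
  assumes "A \<subseteq> B"
  shows "hausdorff_measure s A \<le> hausdorff_measure s B"
  unfolding hausdorff_measure_def by (intro SUP_mono') (rule hausdorff_premeasure_mono[OF assms])

lemma hausdorff_dim_mono:
  assumes "A \<subseteq> B"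
  shows "hausdorff_dim A \<le> hausdorff_dim B"
proof -
  have "hausdorff_measure s A = 0" if "hausdorff_measure s B = 0" for s
    using hausdorff_measure_mono[OF assms, of s] that by simp
  then show ?thesis unfolding hausdorff_dim_def by (intro INF_superset_mono) auto
qed

lemma hausdorff_measure_zeroI:
  fixes A :: "'a::metric_space set"
  assumes t: "0 < t"
    and cov: "\<And>\<eta>. 0 < \<eta> \<Longrightarrow> \<exists>(I :: 'i set) V. countable I \<and> A \<subseteq> (\<Union>i\<in>I. V i) \<and> (\<forall>i\<in>I. bounded (V i)) \<and>
           (\<Sum>\<^sub>\<infinity>i\<in>I. ennreal (diameter (V i) powr t)) \<le> ennreal \<eta>"
  shows "hausdorff_measure t A = 0"
proof -
  have "hausdorff_premeasure t \<delta> A \<le> ennreal e" if "0 < \<delta>" "0 < e" for \<delta> e :: real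
  proof -
    define \<eta> where "\<eta> = min e (\<delta> powr t)"
    have "0 < \<eta>" using that by (simp add: \<eta>_def)
    from cov[OF this] obtain I :: "'i set" and V where
      IV: "countable I" "A \<subseteq> (\<Union>i\<in>I. V i)" "\<And>i. i \<in> I \<Longrightarrow> bounded (V i)"
      "(\<Sum>\<^sub>\<infinity>i\<in>I. ennreal (diameter (V i) powr t)) \<le> ennreal \<eta>" by blast
    have small: "diameter (V i) \<le> \<delta>" if "i \<in> I" for i
    proof -
      have "ennreal (diameter (V i) powr t) \<le> ennreal \<eta>"
        using le_infsum_ennreal[OF that, of "\<lambda>i. ennreal (diameter (V i) powr t)"] IV(4) by order
      then have "diameter (V i) powr t \<le> \<delta> powr t"
        using \<open>0 < \<eta>\<close> by (simp add: \<eta>_def)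
      then show ?thesis
        using t \<open>0 < \<delta>\<close> by (meson not_less powr_less_mono2 less_imp_le)
    qed
    \<comment> \<open>Transport along an injection of the index set into the naturals; all other
      sets are empty and contribute 0.\<close>
    define U where "U n = (if n \<in> to_nat_on I ` I then V (from_nat_into I n) else {})" for n
    have U: "U (to_nat_on I i) = V i" if "i \<in> I" for i
      using that IV(1) by (simp add: U_def)
    have "A \<subseteq> (\<Union>n. U n)"
    proof
      fix x assume "x \<in> A"
      then obtain i where "i \<in> I" "x \<in> V i" using IV(2) by blast
      then show "x \<in> (\<Union>n. U n)" using U by blast
    qed
    moreover have "bounded (U n) \<and> diameter (U n) \<le> \<delta>" for n
    proof (cases "n \<in> to_nat_on I ` I")
      case True
      then show ?thesis using U IV(3) small by auto
    next
      case False
      then show ?thesis using \<open>0 < \<delta>\<close> by (simp add: U_def)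
    qed
    ultimately have "hausdorff_premeasure t \<delta> A \<le> (\<Sum>n. diam_pow t (U n))"
      unfolding hausdorff_premeasure_def by (intro INF_lower) auto
    also have "\<dots> \<le> (\<Sum>\<^sub>\<infinity>i\<in>I. ennreal (diameter (V i) powr t))"
    proof (rule suminf_le_const)
      fix N
      define F where "F = {i\<in>I. to_nat_on I i < N}"
      have inj: "inj_on (to_nat_on I) F" using inj_on_to_nat_on[OF IV(1)] by (auto simp: F_def intro: inj_on_subset)
      have fin: "finite F" by (rule inj_on_finite[OF inj, of "{..<N}"]) (auto simp: F_def)
      have "(\<Sum>n<N. diam_pow t (U n)) = (\<Sum>n\<in>to_nat_on I ` F. diam_pow t (U n))"
        by (rule sum.mono_neutral_right) (auto simp: F_def U_def diam_pow_def)
      also have "\<dots> = (\<Sum>i\<in>F. diam_pow t (V i))"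
        using inj by (simp add: sum.reindex) (rule sum.cong, auto simp: F_def U)
      also have "\<dots> \<le> (\<Sum>i\<in>F. ennreal (diameter (V i) powr t))"
        by (intro sum_mono) (use t in \<open>auto simp: diam_pow_def\<close>)
      also have "\<dots> \<le> (\<Sum>\<^sub>\<infinity>i\<in>I. ennreal (diameter (V i) powr t))"
        by (intro sum_le_infsum_ennreal fin) (auto simp: F_def)
      finally show "(\<Sum>n<N. diam_pow t (U n)) \<le> (\<Sum>\<^sub>\<infinity>i\<in>I. ennreal (diameter (V i) powr t))" .
    qed auto
    also have "\<dots> \<le> ennreal e" using IV(4) by (rule order_trans) (simp add: \<eta>_def ennreal_leI)
    finally show ?thesis .
  qed
  then have "hausdorff_premeasure t \<delta> A \<le> 0" if "0 < \<delta>" for \<delta>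
    using that by - (rule ennreal_le_epsilon, simp)
  then have "hausdorff_measure t A \<le> 0" unfolding hausdorff_measure_def by (intro SUP_least) simp
  then show ?thesis by simp
qed

text \<open>Greedy selection of a branch: a family of cylinders of total weight less than \<open>1\<close> leaves,
  below every word, a letter whose cylinder is not yet exhausted.\<close>

lemma cylinder_cover_weight_ge_1:
  fixes p :: "'i \<Rightarrow> real" and W :: "nat \<Rightarrow> 'i list set"
  assumes L: "finite L" and p: "\<And>l. l \<in> L \<Longrightarrow> 0 \<le> p l" "1 \<le> (\<Sum>l\<in>L. p l)"
    and W: "\<And>i. finite (W i)"
    and cov: "\<And>\<xi>. (\<And>n. \<xi> n \<in> L) \<Longrightarrow> \<exists>i k. map \<xi> [0..<k] \<in> W i"
  shows "1 \<le> (\<Sum>i. \<Sum>u\<in>W i. ennreal (prod_list (map p u)))"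
proof (rule ccontr)
  define P where "P u = ennreal (prod_list (map p u))" for u
  \<comment> \<open>The weight of the given words that extend \<open>u\<close>, counted once for
    each index \<open>i\<close>. A word is exhausted when this reaches \<open>P u\<close>.\<close>
  define \<Phi> where "\<Phi> u = (\<Sum>i. \<Sum>w\<in>{w\<in>W i. take (length u) w = u}. P w)" for u
  assume "\<not> 1 \<le> (\<Sum>i. \<Sum>u\<in>W i. ennreal (prod_list (map p u)))"
  then have start: "\<Phi> [] < P []" by (simp add: \<Phi>_def P_def)
  \<comment> \<open>If all children of \<open>u\<close> were exhausted, then \<open>u\<close> would
    be too: the weights of the letters add up to at least 1, and words extending different children
    are different and all extend \<open>u\<close>.\<close>
  have ext: "\<exists>l\<in>L. \<Phi> (u @ [l]) < P (u @ [l])" if u: "\<Phi> u < P u" "set u \<subseteq> L" for u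
  proof (rule ccontr)
    assume "\<not> ?thesis"
    then have ge: "P (u @ [l]) \<le> \<Phi> (u @ [l])" if "l \<in> L" for l using that by (auto simp: not_less)
    have pu: "0 \<le> prod_list (map p u)" using u(2) p(1) by (induction u) auto
    have "P u = P u * 1" by simp
    also have "\<dots> \<le> P u * ennreal (\<Sum>l\<in>L. p l)"
      using p(2) by (intro mult_left_mono) auto
    also have "\<dots> = (\<Sum>l\<in>L. P (u @ [l]))"
      using p(1) pu by (simp add: P_def sum_ennreal[symmetric] sum_distrib_left ennreal_mult' del: sum_ennreal)
    also have "\<dots> \<le> (\<Sum>l\<in>L. \<Phi> (u @ [l]))" by (intro sum_mono ge)
    also have "\<dots> = (\<Sum>i. \<Sum>l\<in>L. \<Sum>w\<in>{w\<in>W i. take (length (u @ [l])) w = u @ [l]}. P w)"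
      unfolding \<Phi>_def by (subst suminf_sum) auto
    also have "\<dots> \<le> \<Phi> u" unfolding \<Phi>_def
    proof (rule suminf_le)
      fix i
      have "(\<Sum>l\<in>L. \<Sum>w\<in>{w\<in>W i. take (length (u @ [l])) w = u @ [l]}. P w) =
          (\<Sum>w\<in>(\<Union>l\<in>L. {w\<in>W i. take (length (u @ [l])) w = u @ [l]}). P w)"
        by (rule sum.UNION_disjoint[symmetric]) (use L W in auto)
      also have "\<dots> \<le> (\<Sum>w\<in>{w\<in>W i. take (length u) w = u}. P w)"
      proof (rule sum_mono2)
        have "take (length u) w = u" if "take (length (u @ [l])) w = u @ [l]" for l w
          using arg_cong[OF that, of "take (length u)"] by simp
        then show "(\<Union>l\<in>L. {w\<in>W i. take (length (u @ [l])) w = u @ [l]}) \<subseteq> {w\<in>W i. take (length u) w = u}"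
          by blast
      qed (use W in auto)
      finally show "(\<Sum>l\<in>L. \<Sum>w\<in>{w\<in>W i. take (length (u @ [l])) w = u @ [l]}. P w) \<le>
        (\<Sum>w\<in>{w\<in>W i. take (length u) w = u}. P w)" .
    qed auto
    finally show False using u(1) by simp
  qed
  define nxt where "nxt u = (SOME l. l \<in> L \<and> \<Phi> (u @ [l]) < P (u @ [l]))" for u
  define br where "br = rec_nat [] (\<lambda>_ u. u @ [nxt u])"
  have br: "br 0 = []" "\<And>n. br (Suc n) = br n @ [nxt (br n)]" by (simp_all add: br_def)
  have inv: "\<Phi> (br n) < P (br n) \<and> set (br n) \<subseteq> L" for n
  proof (induction n)
    case 0
    then show ?case using start by (simp add: br)
  next
    case (Suc n)
    then have "\<exists>l. l \<in> L \<and> \<Phi> (br n @ [l]) < P (br n @ [l])" using ext[of "br n"] by blast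
    from someI_ex[OF this] have "nxt (br n) \<in> L \<and> \<Phi> (br n @ [nxt (br n)]) < P (br n @ [nxt (br n)])"
      by (fold nxt_def)
    with Suc show ?case by (simp add: br)
  qed
  have br_map: "map (\<lambda>k. nxt (br k)) [0..<n] = br n" for n by (induction n) (simp_all add: br)
  have "nxt (br n) \<in> L" for n using inv[of "Suc n"] by (simp add: br)
  from cov[of "\<lambda>k. nxt (br k)", OF this] obtain i k where "map (\<lambda>k. nxt (br k)) [0..<k] \<in> W i" by blast
  then have mem: "br k \<in> W i" by (simp add: br_map)
  \<comment> \<open>The branch runs into one of the given words, and that word alone lifts \<Phi> to
    \<open>P\<close>.\<close>
  have "P (br k) \<le> (\<Sum>w\<in>{w\<in>W i. take (length (br k)) w = br k}. P w)"
    using mem W by (intro member_le_sum) auto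
  also have "\<dots> \<le> \<Phi> (br k)" unfolding \<Phi>_def
    using sum_le_suminf[of "\<lambda>i. \<Sum>w\<in>{w\<in>W i. take (length (br k)) w = br k}. P w" "{i}"] by simp
  finally show False using inv[of k] by (meson leD)
qed

text \<open>A mass distribution principle in which \<open>cylinder_cover_weight_ge_1\<close> takes
  the place of a measure on the codes. By \<open>cut\<close>, a set of diameter at most
  \<open>d\<close> is charged with at most \<open>N\<close> words of weight at most
  \<open>C * d\<close>; a cover with a small sum of s-th powers would leave its words with total
  weight below 1.\<close>

lemma hausdorff_dim_coded_ge:
  fixes X :: "(nat \<Rightarrow> 'i) \<Rightarrow> 'a::metric_space" and \<rho> :: "'i \<Rightarrow> real"
  assumes L: "finite L" "L \<noteq> {}" and \<rho>: "\<And>l. l \<in> L \<Longrightarrow> 0 < \<rho> l \<and> \<rho> l \<le> 1" and t: "0 < t" "1 \<le> (\<Sum>l\<in>L. \<rho> l powr t)"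
    and C: "0 < C"
    and cut: "\<And>d U. 0 < d \<Longrightarrow> (\<And>x y. x \<in> U \<Longrightarrow> y \<in> U \<Longrightarrow> dist x y \<le> d) \<Longrightarrow>
        \<exists>W. finite W \<and> card W \<le> N \<and> (\<forall>u\<in>W. set u \<subseteq> L \<and> prod_list (map \<rho> u) \<le> C * d) \<and>
          (\<forall>\<xi>. (\<forall>n. \<xi> n \<in> L) \<and> X \<xi> \<in> U \<longrightarrow> (\<exists>k. map \<xi> [0..<k] \<in> W))"
  shows "ereal t \<le> hausdorff_dim {X \<xi> | \<xi>. \<forall>n. \<xi> n \<in> L}" (is "_ \<le> hausdorff_dim ?A")
proof (rule hausdorff_dim_geI)
  fix s assume s: "0 \<le> s" "s < t"
  have "(\<Sum>l\<in>L. \<rho> l powr t) \<le> (\<Sum>l\<in>L. \<rho> l powr s)"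
    using \<rho> s by (intro sum_mono powr_mono') (auto simp: less_imp_le)
  then have ps: "1 \<le> (\<Sum>l\<in>L. \<rho> l powr s)" using t by simp
  \<comment> \<open>The summand 1 keeps \<open>K\<close> positive when \<open>N = 0\<close> and
    makes the bound \<open>1 / (2 * K)\<close> at most 1, as the exponent 0 requires.\<close>
  define K where "K = real N * C powr s + 1"
  have K: "0 < K" using C by (simp add: K_def add_nonneg_pos)
  have low: "ennreal (1 / (2 * K)) \<le> (\<Sum>i. diam_pow s (U i))"
    if U: "?A \<subseteq> (\<Union>i. U i)" "\<And>i. bounded (U i)" for U :: "nat \<Rightarrow> 'a set"
  proof (cases "s = 0")
    case True
    obtain l where "l \<in> L" using L by blast
    then have "X (\<lambda>_. l) \<in> ?A" by auto
    then obtain i where "U i \<noteq> {}" using U by blast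
    then have "1 \<le> diam_pow s (U i)" by (simp add: diam_pow_def True)
    also have "\<dots> \<le> (\<Sum>i. diam_pow s (U i))"
      using sum_le_suminf[of "\<lambda>i. diam_pow s (U i)" "{i}"] by simp
    finally have "1 \<le> (\<Sum>i. diam_pow s (U i))" .
    moreover have "ennreal (1 / (2 * K)) \<le> ennreal 1"
      using C by (intro ennreal_leI) (simp add: K_def divide_le_eq add_nonneg_pos)
    ultimately show ?thesis by (simp add: order.trans[of _ 1])
  next
    case False
    then have s0: "0 < s" using s by simp
    define \<delta> where "\<delta> = 1 / (4 * K)"
    have \<delta>: "0 < \<delta>" using K by (simp add: \<delta>_def)
    \<comment> \<open>\<open>cut\<close> demands a positive \<open>d\<close>, but a set may have
      diameter 0. The s-th power is therefore padded by \<delta> / 2^i. The paddings add up to 2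
      \<delta>, which after multiplication by \<open>K\<close> is only 1/2.\<close>
    define d where "d i = (diameter (U i) powr s + \<delta> * (1/2) ^ i) powr (1 / s)" for i
    have dp0: "0 < diameter (U i) powr s + \<delta> * (1/2) ^ i" for i
      using \<delta> by (intro add_nonneg_pos) auto
    have dp: "0 < d i" "d i powr s = diameter (U i) powr s + \<delta> * (1/2) ^ i" for i
      using dp0[of i] s0 by (auto simp: d_def powr_powr)
    have "diameter (U i) \<le> d i" for i
    proof -
      have "diameter (U i) powr s \<le> d i powr s" using dp(2)[of i] \<delta> by simp
      then show ?thesis using s0 dp(1)[of i] by (meson not_less powr_less_mono2 less_imp_le)
    qed
    then have "dist x y \<le> d i" if "x \<in> U i" "y \<in> U i" for x y i
      using diameter_bounded_bound[OF U(2) that] by (meson order_trans)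
    then have dU: "dist x y \<le> d i" if "x \<in> U i" "y \<in> U i" for x y i using that by blast
    define Q where "Q i W \<longleftrightarrow> finite W \<and> card W \<le> N \<and> (\<forall>u\<in>W. set u \<subseteq> L \<and> prod_list (map \<rho> u) \<le> C * d i) \<and>
          (\<forall>\<xi>. (\<forall>n. \<xi> n \<in> L) \<and> X \<xi> \<in> U i \<longrightarrow> (\<exists>k. map \<xi> [0..<k] \<in> W))" for i W
    have "\<exists>W. Q i W" for i unfolding Q_def by (rule cut[OF dp(1) dU])
    then obtain W where "\<And>i. Q i (W i)" using choice[of Q] by blast
    note WQ = this[unfolded Q_def]
    have W: "finite (W i)" "card (W i) \<le> N"
      "u \<in> W i \<Longrightarrow> set u \<subseteq> L \<and> prod_list (map \<rho> u) \<le> C * d i"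
      "(\<forall>n. \<xi> n \<in> L) \<Longrightarrow> X \<xi> \<in> U i \<Longrightarrow> \<exists>k. map \<xi> [0..<k] \<in> W i" for i u \<xi>
      using WQ[of i] by auto
    have "1 \<le> (\<Sum>i. \<Sum>u\<in>W i. ennreal (prod_list (map (\<lambda>l. \<rho> l powr s) u)))"
    proof (rule cylinder_cover_weight_ge_1[where L = L])
      fix \<xi> :: "nat \<Rightarrow> 'i" assume \<xi>: "\<And>n. \<xi> n \<in> L"
      then have "X \<xi> \<in> ?A" by auto
      then obtain i where "X \<xi> \<in> U i" using U(1) by blast
      then show "\<exists>i k. map \<xi> [0..<k] \<in> W i" using W(4) \<xi> by blast
    qed (use L W ps in auto)
    also have "\<dots> \<le> (\<Sum>i. ennreal K * (diam_pow s (U i) + ennreal (\<delta> * (1/2) ^ i)))"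
    proof (rule suminf_le)
      fix i
      have le: "ennreal (prod_list (map (\<lambda>l. \<rho> l powr s) u)) \<le> ennreal (C powr s * d i powr s)" if "u \<in> W i" for u
      proof -
        have u: "set u \<subseteq> L" "prod_list (map \<rho> u) \<le> C * d i" using W(3)[OF that] by auto
        have "prod_list (map (\<lambda>l. \<rho> l powr s) u) = prod_list (map \<rho> u) powr s \<and> 0 \<le> prod_list (map \<rho> u)"
          using u(1)
        proof (induction u)
          case (Cons a u)
          then show ?case using \<rho>[of a] by (auto simp: powr_mult)
        qed auto
        moreover have "prod_list (map \<rho> u) powr s \<le> (C * d i) powr s"
          using u(2) s calculation by (intro powr_mono2) auto
        ultimately show ?thesis using C dp(1)[of i] by (simp add: powr_mult ennreal_leI)
      qed
      have "(\<Sum>u\<in>W i. ennreal (prod_list (map (\<lambda>l. \<rho> l powr s) u))) \<le> (\<Sum>u\<in>W i. ennreal (C powr s * d i powr s))"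
        by (intro sum_mono le)
      also have "\<dots> = ennreal (real (card (W i)) * (C powr s * d i powr s))"
        by (simp add: ennreal_mult'' ennreal_of_nat_eq_real_of_nat)
      also have "\<dots> \<le> ennreal (K * (d i powr s))"
      proof (rule ennreal_leI)
        have "real (card (W i)) * (C powr s) \<le> K" using W(2)[of i] by (simp add: K_def add_increasing2 mult_right_mono)
        then show "real (card (W i)) * (C powr s * d i powr s) \<le> K * (d i powr s)"
          by (metis mult.assoc mult_right_mono powr_ge_zero)
      qed
      also have "\<dots> = ennreal K * (diam_pow s (U i) + ennreal (\<delta> * (1/2) ^ i))"
      proof -
        have "diam_pow s (U i) = ennreal (diameter (U i) powr s)" using s0 by (simp add: diam_pow_def)
        then have "ennreal (d i powr s) = diam_pow s (U i) + ennreal (\<delta> * (1/2) ^ i)"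
          using \<delta> unfolding dp(2) by (simp add: ennreal_plus)
        then show ?thesis using K by (simp add: ennreal_mult'')
      qed
      finally show "(\<Sum>u\<in>W i. ennreal (prod_list (map (\<lambda>l. \<rho> l powr s) u))) \<le>
          ennreal K * (diam_pow s (U i) + ennreal (\<delta> * (1/2) ^ i))" .
    qed auto
    also have "\<dots> = ennreal K * ((\<Sum>i. diam_pow s (U i)) + (\<Sum>i. ennreal (\<delta> * (1/2) ^ i)))"
      by (simp add: suminf_add)
    also have "(\<Sum>i. ennreal (\<delta> * (1/2) ^ i)) = ennreal (2 * \<delta>)"
    proof -
      have "(\<lambda>i. \<delta> * (1/2) ^ i) sums (\<delta> * (1 / (1 - 1/2)))"
        by (intro sums_mult geometric_sums) auto
      then show ?thesis using \<delta> by (subst suminf_ennreal_eq[of _ "2 * \<delta>"]) (auto simp: mult.commute)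
    qed
    finally have fin: "1 \<le> ennreal K * ((\<Sum>i. diam_pow s (U i)) + ennreal (2 * \<delta>))" .
    show ?thesis
    proof (rule ccontr)
      assume "\<not> ?thesis"
      then have lt: "(\<Sum>i. diam_pow s (U i)) < ennreal (1 / (2 * K))" by simp
      obtain q where q: "(\<Sum>i. diam_pow s (U i)) = ennreal q" "0 \<le> q" "q < 1 / (2 * K)"
        using lt by (cases "\<Sum>i. diam_pow s (U i)") (auto simp: ennreal_less_iff)
      have "ennreal K * (ennreal q + ennreal (2 * \<delta>)) = ennreal (K * (q + 2 * \<delta>))"
        using K q \<delta> ennreal_plus[of q "2 * \<delta>"] by (simp add: ennreal_mult'')
      then have "1 \<le> K * (q + 2 * \<delta>)" using fin q(1) by (simp add: ennreal_ge_1)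
      moreover have "K * q < 1/2" using q(3) K by (simp add: field_simps)
      moreover have "K * (2 * \<delta>) = 1/2" using K by (simp add: \<delta>_def)
      ultimately show False by (simp add: distrib_left)
    qed
  qed
  have "ennreal (1 / (2 * K)) \<le> hausdorff_premeasure s 1 ?A"
    unfolding hausdorff_premeasure_def by (intro INF_greatest low) auto
  also have "\<dots> \<le> hausdorff_measure s ?A" unfolding hausdorff_measure_def by (intro SUP_upper) auto
  finally show "hausdorff_measure s ?A \<noteq> 0" using K by auto
qed

section \<open>Derivatives\<close>

lemma has_derivative_Der:
  assumes "f differentiable (at x)"
  shows "(f has_derivative blinfun_apply (Der f x)) (at x)"
  using assms unfolding Der_def frechet_derivative_works
  by (metis bounded_linear_Blinfun_apply has_derivative_bounded_linear)

text \<open>The smallest singular value. For invertible \<open>M\<close> it equals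
  \<open>inorm M\<close>, but its defining lower bound is available for every \<open>M\<close> and
  involves no inverse.\<close>

definition lnorm :: "('a::euclidean_space \<Rightarrow>\<^sub>L 'a) \<Rightarrow> real" where
  "lnorm M = (INF h\<in>sphere 0 1. norm (blinfun_apply M h))"

lemma unit_vector_exists: obtains h :: "'a::euclidean_space" where "norm h = 1"
  using vector_choose_size[of 1] by (metis zero_le_one)

lemma lnorm_mult_le: "lnorm M * norm h \<le> norm (blinfun_apply M h)"
proof (cases "h = 0")
  case False
  have "lnorm M \<le> norm (blinfun_apply M (h /\<^sub>R norm h))"
    unfolding lnorm_def by (rule cINF_lower) (use False in \<open>auto intro!: bdd_belowI2[of _ 0]\<close>)
  also have "\<dots> = norm (blinfun_apply M h) / norm h"
    by (simp add: blinfun.scaleR_right divide_inverse mult.commute)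
  finally show ?thesis using False by (simp add: field_simps)
qed simp

lemma lnorm_geI:
  assumes "\<And>h. a * norm h \<le> norm (blinfun_apply M h)"
  shows "a \<le> lnorm M"
proof -
  obtain h :: 'a where "norm h = 1" by (rule unit_vector_exists)
  then have "sphere (0::'a) 1 \<noteq> {}" by (auto simp: dist_norm intro!: exI[of _ h])
  then show ?thesis unfolding lnorm_def
  proof (rule cINF_greatest)
    fix x :: 'a assume "x \<in> sphere 0 1"
    then show "a \<le> norm (blinfun_apply M x)" using assms[of x] by simp
  qed
qed

lemma lnorm_nonneg: "0 \<le> lnorm M"
  by (rule lnorm_geI) simp

lemma lnorm_le_norm: "lnorm M \<le> norm M"
proof -
  obtain h :: 'a where h: "norm h = 1" by (rule unit_vector_exists)
  show ?thesis using lnorm_mult_le[of M h] norm_blinfun[of M h] h by simp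
qed

text \<open>The lower bound passes from a similarity to every nearby linear map. In this way the
  conformality of the limit controls perturbed maps that are not conformal.\<close>

lemma lnorm_perturb:
  assumes "\<And>h. norm (blinfun_apply M h) = norm M * norm h" "norm (M' - M) \<le> \<eta>"
  shows "norm M - \<eta> \<le> lnorm M'"
proof (rule lnorm_geI)
  fix h
  have "norm (blinfun_apply (M' - M) h) \<le> \<eta> * norm h"
    using norm_blinfun[of "M' - M" h] mult_right_mono[OF assms(2), of "norm h"] by simp
  moreover have "norm (blinfun_apply M h) - norm (blinfun_apply M' h) \<le> norm (blinfun_apply (M' - M) h)"
    by (metis minus_blinfun.rep_eq norm_minus_commute norm_triangle_ineq2)
  ultimately show "(norm M - \<eta>) * norm h \<le> norm (blinfun_apply M' h)"
    using assms(1)[of h] by (simp add: algebra_simps)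
qed

lemma conformal_onD:
  fixes f :: "'a::euclidean_space \<Rightarrow> 'a"
  assumes "conformal_on f S" "x \<in> S"
  shows "norm (blinfun_apply (Der f x) h) = norm (Der f x) * norm h" "0 < norm (Der f x)"
    "inorm (Der f x) = norm (Der f x)"
proof -
  obtain c Q where c: "0 < c" and Q: "orthogonal_transformation Q"
    and D: "blinfun_apply (Der f x) = (\<lambda>h. c *\<^sub>R Q h)"
    using assms unfolding conformal_on_def by blast
  have n: "norm (blinfun_apply (Der f x) h) = c * norm h" for h
    using c Q by (simp add: D orthogonal_transformation)
  obtain h0 :: 'a where h0: "norm h0 = 1" by (rule unit_vector_exists)
  have "norm (Der f x) \<le> c" by (rule norm_blinfun_bound) (use c n in auto)
  moreover have "c \<le> norm (Der f x)" using norm_blinfun[of "Der f x" h0] n[of h0] h0 by simp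
  ultimately have nc: "norm (Der f x) = c" by simp
  then show "norm (blinfun_apply (Der f x) h) = norm (Der f x) * norm h" "0 < norm (Der f x)"
    using n c by auto
  have bij: "bij Q" by (rule orthogonal_transformation_bij[OF Q])
  have inv: "inv (blinfun_apply (Der f x)) = (\<lambda>h. (1 / c) *\<^sub>R inv Q h)"
  proof (rule inv_equality)
    fix h
    show "(1 / c) *\<^sub>R inv Q (blinfun_apply (Der f x) h) = h"
      using c bij Q by (metis (no_types, lifting) D bij_inv_eq_iff divide_inverse inverse_unique left_inverse less_irrefl
          linear_scale mult.commute orthogonal_transformation_linear scaleR_one scaleR_scaleR mult_1 nonzero_eq_divide_eq)
    show "blinfun_apply (Der f x) ((1 / c) *\<^sub>R inv Q h) = h"
      using c bij Q by (simp add: D orthogonal_transformation_linear linear_scale bij_is_surj surj_f_inv_f)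
  qed
  have Q': "orthogonal_transformation (inv Q)" by (rule orthogonal_transformation_inv[OF Q])
  have bl: "bounded_linear (\<lambda>h. (1 / c) *\<^sub>R inv Q h)"
    using orthogonal_transformation_linear[OF Q'] linear_conv_bounded_linear
    by (intro bounded_linear_const_scaleR) auto
  define M where "M = Blinfun (\<lambda>h. (1 / c) *\<^sub>R inv Q h)"
  have M: "blinfun_apply M h = (1 / c) *\<^sub>R inv Q h" for h
    unfolding M_def by (simp add: bounded_linear_Blinfun_apply[OF bl])
  have nM: "norm (blinfun_apply M h) = (1 / c) * norm h" for h
    using Q' c by (simp add: M orthogonal_transformation)
  have "norm M \<le> 1 / c" by (rule norm_blinfun_bound) (use c nM in auto)
  moreover have "1 / c \<le> norm M" using norm_blinfun[of M h0] nM[of h0] h0 by simp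
  ultimately have "norm M = 1 / c" by simp
  then show "inorm (Der f x) = norm (Der f x)"
    unfolding inorm_def inv M_def[symmetric] by (simp add: nc)
qed

section \<open>A mesh bound for images of connected sets\<close>

text \<open>Cells are connected but not convex, so a bound at scale \<open>g\<close> cannot be
  integrated along a segment. Translated to the origin, \<open>S\<close> lies in a ball of radius
  \<Delta>, which a fixed number of balls of radius \<open>g / 2\<close> covers; each of them
  contributes at most 2 M to the range of the distance from \<open>f x\<close>. Hence
  \<open>N\<close> depends only on \<Delta>, \<open>g\<close> and the space.\<close>

lemma connected_mesh_bound:
  fixes \<Delta> g :: real
  assumes "0 < g"
  obtains N :: real where "1 \<le> N"
    "\<And>(S :: 'a::euclidean_space set) (f :: 'a \<Rightarrow> 'a) M x y. connected S \<Longrightarrow> (\<And>x y. x \<in> S \<Longrightarrow> y \<in> S \<Longrightarrow> dist x y \<le> \<Delta>) \<Longrightarrow>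
        continuous_on S f \<Longrightarrow>
        (\<And>x y. x \<in> S \<Longrightarrow> y \<in> S \<Longrightarrow> dist x y \<le> g \<Longrightarrow> dist (f x) (f y) \<le> M) \<Longrightarrow>
        x \<in> S \<Longrightarrow> y \<in> S \<Longrightarrow> dist (f x) (f y) \<le> N * M"
proof -
  obtain k where k: "finite k" "cball (0::'a) \<Delta> \<subseteq> (\<Union>x\<in>k. ball x (g / 2))"
    using compact_cball[of "0::'a" \<Delta>] assms unfolding compact_eq_totally_bounded by (metis half_gt_zero)
  have "dist (f x) (f y) \<le> (2 * card k + 1) * M"
    if S: "connected S" "\<And>x y. x \<in> S \<Longrightarrow> y \<in> S \<Longrightarrow> dist x y \<le> \<Delta>" "continuous_on S f"
      and M: "\<And>x y. x \<in> S \<Longrightarrow> y \<in> S \<Longrightarrow> dist x y \<le> g \<Longrightarrow> dist (f x) (f y) \<le> M"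
      and x: "x \<in> S" and y: "y \<in> S" for S and f :: "'a \<Rightarrow> 'a" and M :: real and x y
  proof -
    have M0: "0 \<le> M" using M[OF x x] assms by simp
    define h where "h z = dist (f x) (f z)" for z
    define B where "B c = {z\<in>S. z - x \<in> ball c (g / 2)}" for c
    define p where "p c = (SOME z. z \<in> B c)" for c
    have p: "p c \<in> B c" if "z \<in> B c" for z c using that unfolding p_def by (rule someI)
    have "connected (h ` S)" unfolding h_def
      by (intro connected_continuous_image continuous_intros S)
    \<comment> \<open>A connected image contains the whole interval from \<open>h x = 0\<close> to
      \<open>h y\<close>; comparing lengths then replaces the construction of a chain of
      points.\<close>
    then have "{0..h y} \<subseteq> h ` S"
      using x y by (intro connected_contains_Icc) (auto simp: h_def intro!: image_eqI[of _ _ x])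
    also have "\<dots> \<subseteq> (\<Union>c\<in>k. {h (p c) - M..h (p c) + M})"
    proof
      fix t assume "t \<in> h ` S"
      then obtain z where z: "z \<in> S" "t = h z" by blast
      have "z - x \<in> cball 0 \<Delta>" using S(2)[OF z(1) x] by (simp add: dist_norm norm_minus_commute)
      then obtain c where c: "c \<in> k" "z \<in> B c" using k z by (auto simp: B_def)
      then have pc: "p c \<in> B c" using p by blast
      have "dist z (p c) = dist (z - x) (p c - x)" by (simp add: dist_norm)
      also have "\<dots> \<le> dist c (z - x) + dist c (p c - x)" by (metis dist_commute dist_triangle)
      also have "\<dots> \<le> g" using pc c(2) by (auto simp: B_def)
      finally have "dist (f z) (f (p c)) \<le> M" using M z pc by (auto simp: B_def)
      then have "\<bar>h z - h (p c)\<bar> \<le> M"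
        unfolding h_def by (smt (verit) dist_commute dist_triangle)
      then show "t \<in> (\<Union>c\<in>k. {h (p c) - M..h (p c) + M})" using c z by (auto intro!: bexI[of _ c])
    qed
    finally have sub: "{0..h y} \<subseteq> (\<Union>c\<in>k. {h (p c) - M..h (p c) + M})" .
    have "ennreal (h y) = emeasure lborel {0..h y}" by (simp add: h_def)
    also have "\<dots> \<le> emeasure lborel (\<Union>c\<in>k. {h (p c) - M..h (p c) + M})"
      by (intro emeasure_mono sub) (use k in auto)
    also have "\<dots> \<le> (\<Sum>c\<in>k. emeasure lborel {h (p c) - M..h (p c) + M})"
      by (intro emeasure_subadditive_finite) (use k in auto)
    also have "\<dots> = (\<Sum>c\<in>k. ennreal (2 * M))" by (intro sum.cong) (use M0 in auto)
    also have "\<dots> = ennreal (card k * (2 * M))" using M0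
      by (simp add: ennreal_mult'' ennreal_of_nat_eq_real_of_nat)
    finally have "h y \<le> card k * (2 * M)" using M0 by (simp add: ennreal_le_iff)
    then show ?thesis using M0 by (simp add: h_def algebra_simps)
  qed
  then show thesis by (intro that[of "2 * card k + 1"]) auto
qed

section \<open>Walks\<close>

fun walk :: "('v, 'a) gsys \<Rightarrow> 'v list \<Rightarrow> bool" where
  "walk G [] \<longleftrightarrow> True"
| "walk G [v] \<longleftrightarrow> v \<in> verts G"
| "walk G (v # u # p) \<longleftrightarrow> (v, u) \<in> edges G \<and> walk G (u # p)"

text \<open>A word of k + 1 vertices stands for k maps, and the argument lives in the cell or
  neighbourhood of its last vertex. Hence the recurring \<open>w @ [u]\<close> and
  \<open>length p - 1\<close>, and the doubled vertex whenever a word is cut in two.\<close>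

fun pmap :: "('v, 'a) gsys \<Rightarrow> 'v list \<Rightarrow> 'a \<Rightarrow> 'a" where
  "pmap G [] x = x"
| "pmap G [v] x = x"
| "pmap G (v # u # p) x = emap G (v, u) (pmap G (u # p) x)"

text \<open>The multiplicative cocycle over the orbit of \<open>x\<close> under the maps of \<open>G\<close>; keeping the weight \<open>N\<close>
  separate from \<open>G\<close> allows weights of one system along orbits of another.\<close>

fun coc :: "('v \<times> 'v \<Rightarrow> 'a \<Rightarrow> real) \<Rightarrow> ('v, 'a) gsys \<Rightarrow> 'v list \<Rightarrow> 'a \<Rightarrow> real" where
  "coc N G [] x = 1"
| "coc N G [v] x = 1"
| "coc N G (v # u # p) x = N (v, u) (pmap G (u # p) x) * coc N G (u # p) x"

definition dn :: "('v, 'a::euclidean_space) gsys \<Rightarrow> 'v \<times> 'v \<Rightarrow> 'a \<Rightarrow> real" where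
  "dn G e x = norm (Der (emap G e) x)"

definition dl :: "('v, 'a::euclidean_space) gsys \<Rightarrow> 'v \<times> 'v \<Rightarrow> 'a \<Rightarrow> real" where
  "dl G e x = lnorm (Der (emap G e) x)"

lemma dn_nonneg: "0 \<le> dn G e x" by (simp add: dn_def)

lemma walk_append: "walk G (p @ v # q) \<longleftrightarrow> walk G (p @ [v]) \<and> walk G (v # q)" if "edges G \<subseteq> verts G \<times> verts G"
  using that
proof (induction G p rule: walk.induct)
  case (1 G)
  then show ?case by (cases q) auto
next
  case (2 G u)
  then show ?case by (cases q) auto
next
  case (3 G v' u p)
  then show ?case by auto
qed

lemma pmap_append: "pmap G (p @ v # q) x = pmap G (p @ [v]) (pmap G (v # q) x)"
proof (induction p)
  case (Cons a p)
  then show ?case by (cases p) auto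
qed auto

lemma coc_append: "coc N G (p @ v # q) x = coc N G (p @ [v]) (pmap G (v # q) x) * coc N G (v # q) x"
proof (induction p)
  case (Cons a p)
  then show ?case using pmap_append[of G p v q x] by (cases p) auto
qed auto

lemma coc_nonneg: "0 \<le> coc N G p x" if "\<And>e y. 0 \<le> N e y"
  using that by (induction N G p x rule: coc.induct) auto

lemma coc_dn_nonneg: "0 \<le> coc (dn G) H p x"
  by (rule coc_nonneg) (rule dn_nonneg)

lemma walk_verts: "walk G p \<Longrightarrow> edges G \<subseteq> verts G \<times> verts G \<Longrightarrow> set p \<subseteq> verts G"
  by (induction G p rule: walk.induct) auto

text \<open>The constants are parameters. \<open>g\<close> is a radius by which cells can be
  enlarged inside their neighbourhoods; any positive number below the gap is allowed, and the
  comparison with perturbed cells will need a particular choice. The balls \<open>cball z g\<close>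
  are convex, which cells and neighbourhoods need not be.\<close>

locale gifs =
  fixes G :: "('v, 'a::euclidean_space) gsys" and g r \<Delta> :: real
  assumes countable_verts: "countable (verts G)" and edges: "edges G \<subseteq> verts G \<times> verts G"
    and cell: "\<And>v. v \<in> verts G \<Longrightarrow> compact (cell G v)" "\<And>v. v \<in> verts G \<Longrightarrow> connected (cell G v)"
      "\<And>v. v \<in> verts G \<Longrightarrow> cell G v \<noteq> {}" "\<And>v. v \<in> verts G \<Longrightarrow> cell G v = closure (interior (cell G v))"
    and cell_diam: "\<And>v x y. v \<in> verts G \<Longrightarrow> x \<in> cell G v \<Longrightarrow> y \<in> cell G v \<Longrightarrow> dist x y \<le> \<Delta>"
    and g: "0 < g" and r: "0 < r" "r < 1"
    and nbhd: "\<And>v. v \<in> verts G \<Longrightarrow> open (nbhd G v)"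
      "\<And>v z. v \<in> verts G \<Longrightarrow> z \<in> cell G v \<Longrightarrow> cball z g \<subseteq> nbhd G v"
    and emap_nbhd: "\<And>v u x. (v, u) \<in> edges G \<Longrightarrow> x \<in> nbhd G u \<Longrightarrow> emap G (v, u) x \<in> nbhd G v"
    and emap_cell: "\<And>v u x. (v, u) \<in> edges G \<Longrightarrow> x \<in> cell G u \<Longrightarrow> emap G (v, u) x \<in> cell G v"
    and emap_inj: "\<And>v u. (v, u) \<in> edges G \<Longrightarrow> inj_on (emap G (v, u)) (nbhd G u)"
    and emap_diff: "\<And>v u x. (v, u) \<in> edges G \<Longrightarrow> x \<in> nbhd G u \<Longrightarrow> emap G (v, u) differentiable (at x)"
    and Der_cont: "\<And>v u. (v, u) \<in> edges G \<Longrightarrow> continuous_on (nbhd G u) (Der (emap G (v, u)))"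
    and dn_le: "\<And>v u x. (v, u) \<in> edges G \<Longrightarrow> x \<in> nbhd G u \<Longrightarrow> dn G (v, u) x \<le> r"

lemma simple_gifs_imp_gifs:
  assumes G: "simple_gifs G" and g: "0 < g" "ennreal g < gap G"
  obtains r \<Delta> where "gifs G g r \<Delta>"
proof -
  obtain r where r: "0 < r" "r < 1" "\<forall>e\<in>edges G. \<forall>x\<in>nbhd G (snd e). norm (Der (emap G e) x) \<le> r"
    using G unfolding simple_gifs_def by blast
  obtain \<Delta> where \<Delta>: "0 \<le> \<Delta>" "(SUP v\<in>verts G. ennreal (diameter (cell G v))) = ennreal \<Delta>"
    using G unfolding simple_gifs_def by (metis ennreal_cases infinity_ennreal_def less_irrefl)
  have cpt: "compact (cell G v)" if "v \<in> verts G" for v using G that unfolding simple_gifs_def by blast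
  have dd: "dist x y \<le> \<Delta>" if "v \<in> verts G" "x \<in> cell G v" "y \<in> cell G v" for v x y
  proof -
    have "ennreal (diameter (cell G v)) \<le> ennreal \<Delta>" unfolding \<Delta>(2)[symmetric] by (rule SUP_upper[OF that(1)])
    then have "diameter (cell G v) \<le> \<Delta>" using \<Delta>(1) by (simp add: ennreal_le_iff)
    then show ?thesis
      using diameter_bounded_bound[OF compact_imp_bounded[OF cpt[OF that(1)]] that(2,3)] by simp
  qed
  have nb: "cball z g \<subseteq> nbhd G v" if "v \<in> verts G" "z \<in> cell G v" for v z
  proof
    fix y assume y: "y \<in> cball z g"
    have "gap G \<le> ennreal (setdist (cell G v) (- nbhd G v))" unfolding gap_def by (rule INF_lower[OF that(1)])
    with g have "ennreal g < ennreal (setdist (cell G v) (- nbhd G v))" by order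
    then have lt: "g < setdist (cell G v) (- nbhd G v)" using g(1) by (simp add: ennreal_less_iff)
    show "y \<in> nbhd G v"
    proof (rule ccontr)
      assume "y \<notin> nbhd G v"
      then have "setdist (cell G v) (- nbhd G v) \<le> dist z y" using that by (intro setdist_le_dist) auto
      with lt y show False by simp
    qed
  qed
  have e: "C1_diffeo_on (emap G (v, u)) (nbhd G u) \<and> emap G (v, u) ` nbhd G u \<subseteq> nbhd G v \<and>
      emap G (v, u) ` cell G u \<subseteq> cell G v" if "(v, u) \<in> edges G" for v u
    using G that unfolding simple_gifs_def by fastforce
  have "gifs G g r \<Delta>"
  proof
    show "countable (verts G)" "edges G \<subseteq> verts G \<times> verts G" using G unfolding simple_gifs_def by blast+
    show "0 < g" "0 < r" "r < 1" by fact+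
    fix v u x y
    show "v \<in> verts G \<Longrightarrow> compact (cell G v)" "v \<in> verts G \<Longrightarrow> connected (cell G v)"
      "v \<in> verts G \<Longrightarrow> cell G v \<noteq> {}" "v \<in> verts G \<Longrightarrow> open (nbhd G v)"
      using G unfolding simple_gifs_def by blast+
    show "v \<in> verts G \<Longrightarrow> cell G v = closure (interior (cell G v))"
      using G unfolding simple_gifs_def by fast
    show "v \<in> verts G \<Longrightarrow> x \<in> cell G v \<Longrightarrow> y \<in> cell G v \<Longrightarrow> dist x y \<le> \<Delta>" by (rule dd)
    show "v \<in> verts G \<Longrightarrow> x \<in> cell G v \<Longrightarrow> cball x g \<subseteq> nbhd G v" by (rule nb)
    assume vu: "(v, u) \<in> edges G"
    show "x \<in> nbhd G u \<Longrightarrow> emap G (v, u) x \<in> nbhd G v" "x \<in> cell G u \<Longrightarrow> emap G (v, u) x \<in> cell G v"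
      using e[OF vu] by blast+
    show "inj_on (emap G (v, u)) (nbhd G u)" "x \<in> nbhd G u \<Longrightarrow> emap G (v, u) differentiable (at x)"
      "continuous_on (nbhd G u) (Der (emap G (v, u)))"
      using e[OF vu] unfolding C1_diffeo_on_def C1_on_def by blast+
    show "x \<in> nbhd G u \<Longrightarrow> dn G (v, u) x \<le> r" using r(3) vu unfolding dn_def by fastforce
  qed
  then show thesis by (rule that)
qed

context gifs
begin

lemma edge_verts: "(v, u) \<in> edges G \<Longrightarrow> v \<in> verts G" "(v, u) \<in> edges G \<Longrightarrow> u \<in> verts G"
  using edges by blast+

lemma cell_nbhd: "v \<in> verts G \<Longrightarrow> x \<in> cell G v \<Longrightarrow> x \<in> nbhd G v"
  using nbhd(2)[of v x] g by auto

lemma walk_verts': "walk G p \<Longrightarrow> set p \<subseteq> verts G"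
  using walk_verts edges by blast

lemma walk_last: "walk G p \<Longrightarrow> p \<noteq> [] \<Longrightarrow> last p \<in> verts G"
  using walk_verts' last_in_set by blast

lemma pmap_cell: "walk G p \<Longrightarrow> p \<noteq> [] \<Longrightarrow> x \<in> cell G (last p) \<Longrightarrow> pmap G p x \<in> cell G (hd p)"
  by (induction p rule: induct_list012) (auto intro: emap_cell)

lemma pmap_nbhd: "walk G p \<Longrightarrow> p \<noteq> [] \<Longrightarrow> x \<in> nbhd G (last p) \<Longrightarrow> pmap G p x \<in> nbhd G (hd p)"
  by (induction p rule: induct_list012) (auto intro: emap_nbhd)

lemma pmap_inj: "walk G p \<Longrightarrow> p \<noteq> [] \<Longrightarrow> inj_on (pmap G p) (nbhd G (last p))"
proof (induction p rule: induct_list012)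
  case (3 v u p)
  then have IH: "inj_on (pmap G (u # p)) (nbhd G (last (u # p)))" by simp
  show ?case
  proof (rule inj_onI)
    fix x y assume xy: "x \<in> nbhd G (last (v # u # p))" "y \<in> nbhd G (last (v # u # p))"
      "pmap G (v # u # p) x = pmap G (v # u # p) y"
    have "pmap G (u # p) x = pmap G (u # p) y"
      using emap_inj[of v u] 3 xy pmap_nbhd[of "u # p"] by (auto dest: inj_onD)
    then show "x = y" using IH xy by (auto dest: inj_onD)
  qed
qed (auto simp: inj_on_def)

lemma emap_has_derivative: "(v, u) \<in> edges G \<Longrightarrow> x \<in> nbhd G u \<Longrightarrow> (emap G (v, u) has_derivative blinfun_apply (Der (emap G (v, u)) x)) (at x)"
  using emap_diff has_derivative_Der by blast

lemma pmap_deriv: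
  assumes "walk G p" "p \<noteq> []" "x \<in> nbhd G (last p)"
  shows "\<exists>D. (pmap G p has_derivative D) (at x) \<and> (\<forall>h. norm (D h) \<le> coc (dn G) G p x * norm h) \<and>
      (\<forall>h. coc (dl G) G p x * norm h \<le> norm (D h))"
  using assms
proof (induction p rule: induct_list012)
  case (2 v)
  have "pmap G [v] = (\<lambda>x. x)" by auto
  then show ?case by (intro exI[of _ "\<lambda>h. h"]) auto
next
  case (3 v u p)
  then obtain D where D: "(pmap G (u # p) has_derivative D) (at x)"
    "\<And>h. norm (D h) \<le> coc (dn G) G (u # p) x * norm h" "\<And>h. coc (dl G) G (u # p) x * norm h \<le> norm (D h)" by auto
  let ?y = "pmap G (u # p) x"
  have y: "?y \<in> nbhd G u" using pmap_nbhd[of "u # p" x] 3 by simp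
  let ?E = "blinfun_apply (Der (emap G (v, u)) ?y)"
  have "(emap G (v, u) has_derivative ?E) (at ?y)" using emap_has_derivative 3 y by simp
  moreover have "pmap G (v # u # p) = emap G (v, u) \<circ> pmap G (u # p)" by (rule ext) simp
  ultimately have "(pmap G (v # u # p) has_derivative (?E \<circ> D)) (at x)"
    using diff_chain_at[OF D(1)] by simp
  moreover have "norm ((?E \<circ> D) h) \<le> coc (dn G) G (v # u # p) x * norm h" for h
  proof -
    have "norm (?E (D h)) \<le> dn G (v, u) ?y * norm (D h)" by (simp add: dn_def norm_blinfun)
    also have "\<dots> \<le> dn G (v, u) ?y * (coc (dn G) G (u # p) x * norm h)" by (intro mult_left_mono D) (simp add: dn_def)
    finally show ?thesis by (simp add: mult.assoc)
  qed
  moreover have "coc (dl G) G (v # u # p) x * norm h \<le> norm ((?E \<circ> D) h)" for h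
  proof -
    have "dl G (v, u) ?y * (coc (dl G) G (u # p) x * norm h) \<le> dl G (v, u) ?y * norm (D h)"
      by (intro mult_left_mono D) (simp add: dl_def lnorm_nonneg)
    also have "\<dots> \<le> norm (?E (D h))" by (simp add: dl_def lnorm_mult_le)
    finally show ?thesis by (simp add: mult.assoc)
  qed
  ultimately show ?case by blast
qed auto

lemma pmap_continuous: "walk G p \<Longrightarrow> p \<noteq> [] \<Longrightarrow> continuous_on (nbhd G (last p)) (pmap G p)"
  using pmap_deriv by (meson continuous_at_imp_continuous_on has_derivative_continuous)

text \<open>The mean value inequality, on a ball because convexity is needed.\<close>

lemma pmap_lip:
  assumes "walk G p" "p \<noteq> []" "z \<in> cell G (last p)" "y \<in> cball z g" "\<And>x. x \<in> cball z g \<Longrightarrow> coc (dn G) G p x \<le> M"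
  shows "dist (pmap G p y) (pmap G p z) \<le> M * dist y z"
proof -
  have sub: "cball z g \<subseteq> nbhd G (last p)" using nbhd(2) walk_last assms by blast
  have "\<forall>x\<in>cball z g. \<exists>D. (pmap G p has_derivative D) (at x) \<and> (\<forall>h. norm (D h) \<le> M * norm h)"
  proof
    fix x assume x: "x \<in> cball z g"
    obtain D where D: "(pmap G p has_derivative D) (at x)" "\<forall>h. norm (D h) \<le> coc (dn G) G p x * norm h"
      using pmap_deriv[OF assms(1,2)] sub x by blast
    have "norm (D h) \<le> M * norm h" for h
      using D(2)[rule_format, of h] mult_right_mono[OF assms(5)[OF x] norm_ge_zero, of h] by simp
    with D(1) show "\<exists>D. (pmap G p has_derivative D) (at x) \<and> (\<forall>h. norm (D h) \<le> M * norm h)" by blast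
  qed
  then obtain D where D: "\<And>x. x \<in> cball z g \<Longrightarrow> (pmap G p has_derivative D x) (at x)"
    "\<And>x h. x \<in> cball z g \<Longrightarrow> norm (D x h) \<le> M * norm h" by metis
  have "norm (pmap G p y - pmap G p z) \<le> M * norm (y - z)"
    by (rule differentiable_bound[OF convex_cball, of z g _ D])
      (use D assms g in \<open>auto intro: has_derivative_at_withinI onorm_le\<close>)
  then show ?thesis by (simp add: dist_norm)
qed

lemma coc_le_power:
  assumes "walk G p" "p \<noteq> []" "x \<in> nbhd G (last p)"
  shows "coc (dn G) G p x \<le> r ^ (length p - 1)"
  using assms
proof (induction p rule: induct_list012)
  case (3 v u p)
  have "dn G (v, u) (pmap G (u # p) x) * coc (dn G) G (u # p) x \<le> r * r ^ (length (u # p) - 1)"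
    using 3 pmap_nbhd[of "u # p" x] r by (intro mult_mono dn_le 3 coc_nonneg dn_nonneg) auto
  then show ?case by simp
qed auto

lemma emap_lip:
  assumes "(v, u) \<in> edges G" "z \<in> cell G u" "y \<in> cball z g"
  shows "dist (emap G (v, u) y) (emap G (v, u) z) \<le> r * dist y z"
proof -
  have "walk G [v, u]" using assms edge_verts by auto
  moreover have "coc (dn G) G [v, u] x \<le> r" if "x \<in> cball z g" for x
    using that assms nbhd(2)[of u z] edge_verts dn_le[of v u x] by auto
  ultimately show ?thesis using pmap_lip[of "[v, u]" z y r] assms by simp
qed

text \<open>One step turns an error e into at most r e + (1 - r) \<kappa>, and \<kappa> is the fixed
  point of this recursion; the bound is its solution with initial value \<open>c\<close>. The family
  \<open>X\<close> is any one preserved by the maps of \<open>H\<close>, such as neighbourhoods or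
  perturbed cells.\<close>

lemma shadow:
  assumes "walk G p" "p \<noteq> []" "z \<in> cell G (last p)" "x \<in> X (last p)" "dist x z \<le> c" "c \<le> g"
    and \<kappa>: "0 \<le> \<kappa>" "\<kappa> \<le> c"
    and H: "\<And>v u y. (v, u) \<in> edges G \<Longrightarrow> y \<in> X u \<Longrightarrow>
      emap H (v, u) y \<in> X v \<and> dist (emap H (v, u) y) (emap G (v, u) y) \<le> (1 - r) * \<kappa>"
  shows "pmap H p x \<in> X (hd p) \<and> dist (pmap H p x) (pmap G p z) \<le> c * r ^ (length p - 1) + \<kappa> * (1 - r ^ (length p - 1))"
  using assms(1-4)
proof (induction p rule: induct_list012)
  case (2 v)
  then show ?case using assms by simp
next
  case (3 v u p)
  let ?q = "u # p" and ?k = "length p"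
  let ?y = "pmap H (u # p) x" and ?w = "pmap G (u # p) z"
  have IH: "?y \<in> X u" "dist ?y ?w \<le> c * r ^ ?k + \<kappa> * (1 - r ^ ?k)" using 3 by auto
  have rk: "0 \<le> r ^ ?k" "r ^ ?k \<le> 1" using r by (auto simp: power_le_one)
  \<comment> \<open>A convex combination of \<open>c\<close> and \<kappa>, so the error never
    exceeds \<open>g\<close> and \<open>emap_lip\<close> remains applicable.\<close>
  have "c * r ^ ?k + \<kappa> * (1 - r ^ ?k) \<le> c * r ^ ?k + c * (1 - r ^ ?k)"
    using \<kappa> rk by (intro add_left_mono mult_right_mono) auto
  then have "dist ?y ?w \<le> g" using IH assms(6) by (simp add: algebra_simps)
  moreover have w: "?w \<in> cell G u" using pmap_cell[of ?q z] 3 by simp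
  ultimately have "dist (emap G (v, u) ?y) (emap G (v, u) ?w) \<le> r * dist ?y ?w"
    using 3 by (intro emap_lip) (auto simp: dist_commute)
  also have "\<dots> \<le> r * (c * r ^ ?k + \<kappa> * (1 - r ^ ?k))" using IH r by (intro mult_left_mono) auto
  finally have "dist (emap G (v, u) ?y) (emap G (v, u) ?w) \<le> r * (c * r ^ ?k + \<kappa> * (1 - r ^ ?k))" .
  moreover have "emap H (v, u) ?y \<in> X v" "dist (emap H (v, u) ?y) (emap G (v, u) ?y) \<le> (1 - r) * \<kappa>"
    using H[of v u ?y] 3 IH by auto
  ultimately show ?case
    using dist_triangle[of "emap H (v, u) ?y" "emap G (v, u) ?w" "emap G (v, u) ?y"]
    by (simp add: algebra_simps)
qed auto

section \<open>Diameters of images of cells\<close>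

definition mesh_bound :: "real \<Rightarrow> bool" where
  "mesh_bound N \<longleftrightarrow> 1 \<le> N \<and> (\<forall>(S :: 'a set) (f :: 'a \<Rightarrow> 'a) M x y. connected S \<longrightarrow>
      (\<forall>x\<in>S. \<forall>y\<in>S. dist x y \<le> \<Delta>) \<longrightarrow> continuous_on S f \<longrightarrow>
      (\<forall>x\<in>S. \<forall>y\<in>S. dist x y \<le> g \<longrightarrow> dist (f x) (f y) \<le> M) \<longrightarrow>
      x \<in> S \<longrightarrow> y \<in> S \<longrightarrow> dist (f x) (f y) \<le> N * M)"

text \<open>A term for the constant of \<open>connected_mesh_bound\<close>, so that it can occur in
  the distortion constants.\<close>

definition mesh :: real where
  "mesh = (SOME N. mesh_bound N)"

lemma mesh_bound_mesh: "mesh_bound mesh"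
proof -
  have "\<exists>N. mesh_bound N"
    by (rule connected_mesh_bound[OF g, where \<Delta> = \<Delta> and 'a = 'a]) (unfold mesh_bound_def, blast)
  then show ?thesis unfolding mesh_def by (rule someI_ex)
qed

lemma mesh_ge_1: "1 \<le> mesh"
  using mesh_bound_mesh by (simp add: mesh_bound_def)

lemma mesh:
  fixes f :: "'a \<Rightarrow> 'a"
  assumes "connected S" "\<And>x y. x \<in> S \<Longrightarrow> y \<in> S \<Longrightarrow> dist x y \<le> \<Delta>" "continuous_on S f"
    "\<And>x y. x \<in> S \<Longrightarrow> y \<in> S \<Longrightarrow> dist x y \<le> g \<Longrightarrow> dist (f x) (f y) \<le> M" "x \<in> S" "y \<in> S"
  shows "dist (f x) (f y) \<le> mesh * M"
  using mesh_bound_mesh assms unfolding mesh_bound_def by simp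

lemma pmap_cell_bound:
  assumes "walk G p" "p \<noteq> []" "x \<in> cell G (last p)" "y \<in> cell G (last p)"
    "\<And>z x. z \<in> cell G (last p) \<Longrightarrow> x \<in> cball z g \<Longrightarrow> coc (dn G) G p x \<le> M"
  shows "dist (pmap G p x) (pmap G p y) \<le> mesh * (M * g)"
proof (rule mesh[where S = "cell G (last p)" and f = "pmap G p"])
  have v: "last p \<in> verts G" using walk_last assms by blast
  show "connected (cell G (last p))" using cell v by blast
  show "\<And>x y. x \<in> cell G (last p) \<Longrightarrow> y \<in> cell G (last p) \<Longrightarrow> dist x y \<le> \<Delta>" using cell_diam v by blast
  show "continuous_on (cell G (last p)) (pmap G p)"
    using pmap_continuous[OF assms(1,2)] cell_nbhd[OF v] by (meson continuous_on_subset subsetI)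
  have M: "0 \<le> M" using assms(5)[OF assms(3), of x] coc_dn_nonneg[of G G p x] g by (simp add: order_trans)
  fix x y assume xy: "x \<in> cell G (last p)" "y \<in> cell G (last p)" "dist x y \<le> g"
  then have "dist (pmap G p x) (pmap G p y) \<le> M * dist x y"
    using assms by (intro pmap_lip) (auto simp: dist_commute)
  also have "\<dots> \<le> M * g" using xy M by (intro mult_left_mono)
  finally show "dist (pmap G p x) (pmap G p y) \<le> M * g" .
qed fact+

lemma pmap_cell_power:
  assumes "walk G p" "p \<noteq> []" "x \<in> cell G (last p)" "y \<in> cell G (last p)"
  shows "dist (pmap G p x) (pmap G p y) \<le> mesh * g * r ^ (length p - 1)"
proof -
  have "dist (pmap G p x) (pmap G p y) \<le> mesh * (r ^ (length p - 1) * g)"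
  proof (rule pmap_cell_bound[OF assms])
    fix z x assume "z \<in> cell G (last p)" "x \<in> cball z g"
    then have "x \<in> nbhd G (last p)" using nbhd(2)[OF walk_last[OF assms(1,2)]] by blast
    then show "coc (dn G) G p x \<le> r ^ (length p - 1)" by (rule coc_le_power[OF assms(1,2)])
  qed
  then show ?thesis by (simp add: mult_ac)
qed

end

section \<open>Coding\<close>

lemma shift_iterate: "(shift ^^ n) \<omega> = (\<lambda>i. \<omega> (i + n))"
  by (induction n arbitrary: \<omega>) (auto simp: shift_def funpow_swap1)

lemma shift_paths: "\<omega> \<in> paths G \<Longrightarrow> shift \<omega> \<in> paths G"
  by (auto simp: paths_def shift_def)

lemma shift_iterate_paths: "\<omega> \<in> paths G \<Longrightarrow> (shift ^^ n) \<omega> \<in> paths G"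
  by (induction n) (auto simp: shift_paths)

lemma upt_Suc_snoc2: "map \<omega> [0..<Suc (Suc k)] = map \<omega> [0..<k] @ \<omega> k # [\<omega> (Suc k)]"
  by simp

lemma path_map_eq: "path_map G \<omega> k = pmap G (map \<omega> [0..<Suc (Suc k)])"
proof (induction k)
  case 0
  show ?case by (rule ext) (simp add: upt_rec)
next
  case (Suc k)
  show ?case
  proof (rule ext)
    fix x
    have "pmap G (map \<omega> [0..<Suc (Suc (Suc k))]) x =
        pmap G (map \<omega> [0..<Suc k] @ [\<omega> (Suc k)]) (pmap G (\<omega> (Suc k) # [\<omega> (Suc (Suc k))]) x)"
      unfolding upt_Suc_snoc2[of \<omega> "Suc k"] by (rule pmap_append)
    then show "path_map G \<omega> (Suc k) x = pmap G (map \<omega> [0..<Suc (Suc (Suc k))]) x"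
      using Suc by simp
  qed
qed

primrec pre :: "'v list \<Rightarrow> (nat \<Rightarrow> 'v) \<Rightarrow> nat \<Rightarrow> 'v" where
  "pre [] \<omega> = \<omega>"
| "pre (v # p) \<omega> = case_nat v (pre p \<omega>)"

lemma pre_0: "pre p \<omega> 0 = hd (p @ [\<omega> 0])"
  by (cases p) auto

lemma shift_pre: "shift (pre (v # p) \<omega>) = pre p \<omega>"
  by (simp add: shift_def)

lemma map_pre: "map (pre p \<omega>) [0..<length p] = p"
  by (induction p) (simp_all add: map_upt_Suc del: upt_Suc)

lemma shift_iterate_pre: "(shift ^^ length p) (pre p \<omega>) = \<omega>"
proof (induction p)
  case (Cons v p)
  have "(shift ^^ length (v # p)) (pre (v # p) \<omega>) = (shift ^^ length p) (shift (pre (v # p) \<omega>))"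
    by (simp add: funpow_swap1 del: pre.simps)
  then show ?case using Cons by (simp only: shift_pre)
qed simp

section \<open>Existence and equivariance of the coding map\<close>

context gifs
begin

lemma walk_map: "\<omega> \<in> paths G \<Longrightarrow> walk G (map \<omega> [0..<n])"
proof (induction n)
  case (Suc n)
  show ?case
  proof (cases n)
    case 0
    then show ?thesis using Suc by (simp add: paths_def)
  next
    case (Suc m)
    have "walk G (map \<omega> [0..<m] @ [\<omega> m])" using Suc.IH[OF Suc.prems] Suc by simp
    moreover have "walk G (\<omega> m # [\<omega> (Suc m)])" using Suc.prems by (simp add: paths_def)
    ultimately show ?thesis
      using walk_append[OF edges, of "map \<omega> [0..<m]" "\<omega> m" "[\<omega> (Suc m)]"] unfolding Suc upt_Suc_snoc2 by simp
  qed
qed simp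

lemma pre_paths:
  assumes "\<omega> \<in> paths G" "walk G (p @ [\<omega> 0])"
  shows "pre p \<omega> \<in> paths G"
  using assms(2)
proof (induction p)
  case Nil
  then show ?case using assms(1) by simp
next
  case (Cons v p)
  have e: "(v, pre p \<omega> 0) \<in> edges G" using Cons by (cases p) auto
  have w: "walk G (p @ [\<omega> 0])" using Cons by (cases p) auto
  from Cons.IH[OF w] e edges show ?case
    by (auto simp: paths_def split: nat.split)
qed

text \<open>\<open>coding\<close> is defined by \<open>the_elem\<close>, so the intersection has to
  be a singleton. The sets are nonempty, compact and decreasing, and their diameters tend to 0 by
  \<open>pmap_cell_power\<close>.\<close>

lemma Inter_path_map_images:
  assumes \<omega>: "\<omega> \<in> paths G"
  shows "(\<Inter>k. path_map G \<omega> k ` cell G (\<omega> (Suc k))) = {coding G \<omega>}"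
proof -
  let ?F = "\<lambda>k. path_map G \<omega> k ` cell G (\<omega> (Suc k))"
  let ?p = "\<lambda>k. map \<omega> [0..<Suc (Suc k)]"
  have v: "\<omega> k \<in> verts G" "(\<omega> k, \<omega> (Suc k)) \<in> edges G" for k using \<omega> by (auto simp: paths_def)
  have w: "walk G (?p k)" for k by (rule walk_map[OF \<omega>])
  have last: "last (?p k) = \<omega> (Suc k)" "?p k \<noteq> []" for k by auto
  have "compact (?F k)" for k
    unfolding path_map_eq using pmap_continuous[OF w, of k] cell(1)[OF v(1)] cell_nbhd[OF v(1)]
    by (intro compact_continuous_image) (auto intro: continuous_on_subset simp del: upt_Suc simp: last)
  moreover have "?F k \<noteq> {}" for k using cell(3)[OF v(1)] by simp
  moreover have "?F (Suc k) \<subseteq> ?F k" for k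
    using emap_cell[OF v(2)] by auto
  then have "?F n \<subseteq> ?F m" if "m \<le> n" for m n using that by (rule lift_Suc_antimono_le[of ?F])
  ultimately have ne: "\<Inter>(range ?F) \<noteq> {}" by (intro compact_nest)
  have "x = y" if xy: "x \<in> \<Inter>(range ?F)" "y \<in> \<Inter>(range ?F)" for x y
  proof (rule ccontr)
    assume "x \<noteq> y"
    have b: "dist x y \<le> mesh * g * r ^ Suc k" for k
    proof -
      obtain a b where "x = pmap G (?p k) a" "y = pmap G (?p k) b" "a \<in> cell G (\<omega> (Suc k))" "b \<in> cell G (\<omega> (Suc k))"
        using INT_D[OF xy(1), of k] INT_D[OF xy(2), of k] unfolding path_map_eq by blast
      then show ?thesis using pmap_cell_power[OF w last(2), of a k b] by (simp del: upt_Suc add: last)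
    qed
    have "(\<lambda>k. mesh * g * r ^ Suc k) \<longlonglongrightarrow> mesh * g * 0"
      using r by (intro tendsto_intros LIMSEQ_Suc[OF LIMSEQ_power_zero]) auto
    then have "dist x y \<le> mesh * g * 0" by (rule LIMSEQ_le_const) (use b in auto)
    with \<open>x \<noteq> y\<close> show False by simp
  qed
  moreover obtain x where "x \<in> \<Inter>(range ?F)" using ne by (auto simp del: INT_iff INT_simps)
  ultimately have "\<Inter>(range ?F) = {x}" by (intro equalityI subsetI) (simp_all del: INT_iff INT_simps)
  then show ?thesis unfolding coding_def by simp
qed

lemma coding_cell: "\<omega> \<in> paths G \<Longrightarrow> coding G \<omega> \<in> cell G (\<omega> 0)"
proof -
  assume \<omega>: "\<omega> \<in> paths G"
  have "coding G \<omega> \<in> path_map G \<omega> 0 ` cell G (\<omega> (Suc 0))" using Inter_path_map_images[OF \<omega>] by blast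
  then show ?thesis using \<omega> emap_cell by (auto simp: paths_def)
qed

lemma coding_shift:
  assumes \<omega>: "\<omega> \<in> paths G"
  shows "coding G \<omega> = emap G (\<omega> 0, \<omega> 1) (coding G (shift \<omega>))"
proof -
  have "emap G (\<omega> 0, \<omega> 1) (coding G (shift \<omega>)) \<in> path_map G \<omega> k ` cell G (\<omega> (Suc k))" for k
  proof (cases k)
    case 0
    then show ?thesis using coding_cell[OF shift_paths[OF \<omega>]] by (auto simp: shift_def)
  next
    case (Suc m)
    have "coding G (shift \<omega>) \<in> path_map G (shift \<omega>) m ` cell G (shift \<omega> (Suc m))"
      using Inter_path_map_images[OF shift_paths[OF \<omega>]] by blast
    then obtain a where a: "a \<in> cell G (\<omega> (Suc k))" "coding G (shift \<omega>) = path_map G (shift \<omega>) m a"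
      unfolding Suc shift_def by blast
    have "path_map G \<omega> (Suc m) x = emap G (\<omega> 0, \<omega> 1) (path_map G (shift \<omega>) m x)" for x
      by (induction m arbitrary: x) (auto simp: shift_def)
    then show ?thesis using Suc a by (intro image_eqI[of _ _ a]) simp_all
  qed
  then have "emap G (\<omega> 0, \<omega> 1) (coding G (shift \<omega>)) \<in> (\<Inter>k. path_map G \<omega> k ` cell G (\<omega> (Suc k)))"
    by (rule INT_I)
  then show ?thesis unfolding Inter_path_map_images[OF \<omega>] by simp
qed

lemma coding_pre:
  assumes "\<omega> \<in> paths G" "walk G (p @ [\<omega> 0])"
  shows "coding G (pre p \<omega>) = pmap G (p @ [\<omega> 0]) (coding G \<omega>)"
  using assms(2)
proof (induction p)
  case (Cons v p)
  have w: "walk G (p @ [\<omega> 0])" using Cons by (cases p) auto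
  have "coding G (pre (v # p) \<omega>) = emap G (v, pre p \<omega> 0) (coding G (pre p \<omega>))"
    using coding_shift[OF pre_paths[OF assms(1) Cons.prems]] shift_pre[of v p \<omega>] by simp
  then show ?case using Cons.IH[OF w] pre_0[of p \<omega>] by (cases p) auto
qed simp

lemma coding_shift_iterate:
  "\<omega> \<in> paths G \<Longrightarrow> coding G \<omega> = pmap G (map \<omega> [0..<Suc n]) (coding G ((shift ^^ n) \<omega>))"
proof (induction n arbitrary: \<omega>)
  case (Suc n)
  let ?p = "map (shift \<omega>) [0..<Suc n]"
  have p: "map \<omega> [0..<Suc (Suc n)] = \<omega> 0 # ?p"
    by (subst map_upt_Suc) (simp add: shift_def)
  have q: "?p = \<omega> 1 # map (\<lambda>i. shift \<omega> (Suc i)) [0..<n]"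
    by (subst map_upt_Suc) (simp add: shift_def)
  have "coding G (shift \<omega>) = pmap G ?p (coding G ((shift ^^ n) (shift \<omega>)))"
    by (rule Suc.IH[OF shift_paths[OF Suc.prems]])
  moreover have "(shift ^^ Suc n) \<omega> = (shift ^^ n) (shift \<omega>)" by (simp add: funpow_swap1)
  moreover have "pmap G (\<omega> 0 # ?p) y = emap G (\<omega> 0, \<omega> 1) (pmap G ?p y)" for y
    unfolding q by simp
  ultimately show ?case using coding_shift[OF Suc.prems] unfolding p by simp
qed simp

lemma path_from:
  assumes live: "\<And>v. v \<in> verts G \<Longrightarrow> \<exists>u. (v, u) \<in> edges G" and v: "v \<in> verts G"
  obtains \<omega> where "\<omega> \<in> paths G" "\<omega> 0 = v"
proof -
  obtain nx where nx: "\<And>v. v \<in> verts G \<Longrightarrow> (v, nx v) \<in> edges G" using live by metis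
  define \<omega> where "\<omega> n = (nx ^^ n) v" for n
  have "\<omega> n \<in> verts G" for n
  proof (induction n)
    case (Suc n)
    then show ?case using nx edges by (auto simp: \<omega>_def)
  qed (simp add: \<omega>_def v)
  then have "\<omega> \<in> paths G" using nx by (auto simp: paths_def \<omega>_def)
  then show thesis by (rule that) (simp add: \<omega>_def)
qed

text \<open>Without an outgoing edge the supremum in the contractibility condition is empty, hence
  0, and the cell would be a single point; but it is nonempty and the closure of its interior.
  Consequently every walk can be prolonged to an infinite path.\<close>

lemma contractible_live:
  assumes "contractible_cells G" "v \<in> verts G"
  shows "\<exists>u. (v, u) \<in> edges G"
proof (rule ccontr)
  assume "\<not> ?thesis"
  then have e: "{e \<in> edges G. fst e = v} = {}" by force
  obtain c2 where "ennreal (diameter (cell G v)) \<le> ennreal c2 * (SUP e\<in>{e\<in>edges G. fst e = v}. SUP z\<in>cell G (snd e).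
          ennreal (norm (Der (emap G e) z)))"
    using assms unfolding contractible_cells_def by blast
  then have "diameter (cell G v) \<le> 0" unfolding e by (simp add: bot_ennreal ennreal_eq_0_iff)
  moreover have "bounded (cell G v)" using cell(1)[OF assms(2)] by (rule compact_imp_bounded)
  ultimately have eq: "x = y" if "x \<in> cell G v" "y \<in> cell G v" for x y
    using diameter_bounded_bound[of "cell G v" x y] that zero_le_dist[of x y] by (simp add: dist_le_zero_iff[symmetric] del: dist_le_zero_iff zero_le_dist)
  have "interior (cell G v) \<noteq> {}" using cell(3,4)[OF assms(2)] by force
  then obtain x where x: "x \<in> interior (cell G v)" by blast
  then have "interior (cell G v) = {x}" using eq interior_subset by blast
  then show False by (metis open_interior not_open_singleton)
qed

end

section \<open>Distortion\<close>

locale gifs_dist = gifs G g r \<Delta> for G :: "('v, 'a::euclidean_space) gsys" and g r \<Delta> :: real +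
  fixes c1 \<beta> :: real
  assumes c1: "0 < c1" and \<beta>: "0 < \<beta>"
    and distortion: "\<And>v u x y. (v, u) \<in> edges G \<Longrightarrow> x \<in> nbhd G u \<Longrightarrow> y \<in> nbhd G u \<Longrightarrow>
      \<bar>dn G (v, u) x - dn G (v, u) y\<bar> \<le> c1 * dn G (v, u) x * norm (x - y) powr \<beta>"
begin

text \<open>The exponential of the geometric series of the errors c1 (B r^k)^\<beta> in the
  logarithms of the derivatives.\<close>

definition dist_const :: "real \<Rightarrow> real" where
  "dist_const B = exp (c1 * B powr \<beta> / (1 - r powr \<beta>))"

lemma r_powr_bounds: "0 < r powr \<beta>" "r powr \<beta> < 1"
  using r \<beta> powr_less_mono2[of \<beta> r 1] by auto

lemma dist_const_ge_1: "1 \<le> dist_const B"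
  using r_powr_bounds c1 by (simp add: dist_const_def)

text \<open>After k maps the two orbits are at most B r^k apart, so the next factors have ratio at
  most 1 + c1 (B r^k)^\<beta>, and the product of these bounds is at most
  \<open>dist_const B\<close>. The orbits may belong to different systems \<open>H1\<close> and
  \<open>H2\<close>, but the weights are those of \<open>G\<close> in both. A suffix
  \<open>q\<close> describes the point reached after \<open>length q - 1\<close> maps.\<close>

lemma coc_ratio:
  assumes "walk G p" "p \<noteq> []" "0 \<le> B"
    and "\<And>a q. p = a @ q \<Longrightarrow> q \<noteq> [] \<Longrightarrow> pmap H1 q x \<in> nbhd G (hd q) \<and> pmap H2 q z \<in> nbhd G (hd q) \<and>
      dist (pmap H1 q x) (pmap H2 q z) \<le> B * r ^ (length q - 1)"
  shows "coc (dn G) H1 p x \<le> dist_const B * coc (dn G) H2 p z"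
proof -
  let ?b = "c1 * B powr \<beta>" and ?q = "r powr \<beta>"
  have "coc (dn G) H1 p x \<le> exp (?b * (\<Sum>k<length p - 1. ?q ^ k)) * coc (dn G) H2 p z"
    using assms(1,2,4)
  proof (induction p rule: induct_list012)
    case (3 v u p)
    let ?k = "length p"
    let ?y = "pmap H1 (u # p) x" and ?w = "pmap H2 (u # p) z"
    have IH: "coc (dn G) H1 (u # p) x \<le> exp (?b * (\<Sum>k<?k. ?q ^ k)) * coc (dn G) H2 (u # p) z"
    proof -
      have "pmap H1 q x \<in> nbhd G (hd q) \<and> pmap H2 q z \<in> nbhd G (hd q) \<and>
        dist (pmap H1 q x) (pmap H2 q z) \<le> B * r ^ (length q - 1)" if "u # p = a @ q" "q \<noteq> []" for a q
        using 3(5)[of "v # a" q] that by simp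
      then show ?thesis using 3(2,3) by simp
    qed
    have n: "?y \<in> nbhd G u" "?w \<in> nbhd G u" "dist ?y ?w \<le> B * r ^ ?k" using 3(5)[of "[v]" "u # p"] by auto
    have "dn G (v, u) ?y - dn G (v, u) ?w \<le> c1 * dn G (v, u) ?w * norm (?w - ?y) powr \<beta>"
      using distortion[of v u ?w ?y] n 3(3) by simp
    also have "\<dots> \<le> c1 * dn G (v, u) ?w * (B * r ^ ?k) powr \<beta>"
      using n(3) c1 \<beta> by (intro mult_left_mono powr_mono2) (auto simp: dist_norm norm_minus_commute dn_nonneg)
    also have "(B * r ^ ?k) powr \<beta> = B powr \<beta> * ?q ^ ?k"
      using assms(3) r by (simp add: powr_mult powr_power powr_realpow[symmetric] powr_powr mult.commute)
    finally have "dn G (v, u) ?y \<le> (1 + ?b * ?q ^ ?k) * dn G (v, u) ?w" by (simp add: algebra_simps)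
    also have "\<dots> \<le> exp (?b * ?q ^ ?k) * dn G (v, u) ?w"
      by (intro mult_right_mono exp_ge_add_one_self) (simp add: dn_nonneg)
    finally have d: "dn G (v, u) ?y \<le> exp (?b * ?q ^ ?k) * dn G (v, u) ?w" .
    have "dn G (v, u) ?y * coc (dn G) H1 (u # p) x \<le>
        (exp (?b * ?q ^ ?k) * dn G (v, u) ?w) * (exp (?b * (\<Sum>k<?k. ?q ^ k)) * coc (dn G) H2 (u # p) z)"
      by (intro mult_mono d IH) (auto simp: dn_nonneg coc_dn_nonneg)
    also have "\<dots> = exp (?b * (\<Sum>k<Suc ?k. ?q ^ k)) * (dn G (v, u) ?w * coc (dn G) H2 (u # p) z)"
      by (simp add: exp_add distrib_left)
    finally show ?case by simp
  qed auto
  also have "\<dots> \<le> dist_const B * coc (dn G) H2 p z"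
  proof (intro mult_right_mono coc_dn_nonneg)
    have "(\<Sum>k<length p - 1. ?q ^ k) \<le> (\<Sum>k. ?q ^ k)"
      using r_powr_bounds by (intro sum_le_suminf summable_geometric) auto
    also have "\<dots> = 1 / (1 - ?q)" using r_powr_bounds by (intro suminf_geometric) auto
    finally have "?b * (\<Sum>k<length p - 1. ?q ^ k) \<le> ?b * (1 / (1 - ?q))"
      using c1 by (intro mult_left_mono) auto
    then show "exp (?b * (\<Sum>k<length p - 1. ?q ^ k)) \<le> dist_const B" by (simp add: dist_const_def)
  qed
  finally show ?thesis .
qed

lemma walk_suffix: "walk G (a @ q) \<Longrightarrow> q \<noteq> [] \<Longrightarrow> walk G q"
  by (metis neq_Nil_conv walk_append[OF edges])

lemma coc_near:
  assumes "walk G p" "p \<noteq> []" "z \<in> cell G (last p)" "x \<in> cball z g"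
  shows "coc (dn G) G p x \<le> dist_const g * coc (dn G) G p z" "coc (dn G) G p z \<le> dist_const g * coc (dn G) G p x"
proof -
  have *: "pmap G q x \<in> nbhd G (hd q) \<and> pmap G q z \<in> nbhd G (hd q) \<and>
      dist (pmap G q x) (pmap G q z) \<le> g * r ^ (length q - 1)" if "p = a @ q" "q \<noteq> []" for a q
  proof -
    have w: "walk G q" "last q = last p" using walk_suffix[of a q] that assms by auto
    have "z \<in> cell G (last q)" "x \<in> nbhd G (last q)" "z \<in> nbhd G (last q)"
      using assms w nbhd(2)[OF walk_last[OF assms(1,2)] assms(3)] cell_nbhd[OF walk_last[OF assms(1,2)]] by auto
    moreover have "dist (pmap G q x) (pmap G q z) \<le> g * r ^ (length q - 1) + 0 * (1 - r ^ (length q - 1))"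
    \<comment> \<open>\<open>G\<close> shadows itself, with \<kappa> = 0 and the neighbourhoods as
      the preserved family.\<close>
    proof (rule conjunct2[OF shadow[where X = "nbhd G"]])
      show "walk G q" "q \<noteq> []" "z \<in> cell G (last q)" "x \<in> nbhd G (last q)" by fact+
      show "dist x z \<le> g" using assms(4) by (simp add: dist_commute)
      show "0 \<le> g" using g by simp
      show "emap G (v, u) y \<in> nbhd G v \<and> dist (emap G (v, u) y) (emap G (v, u) y) \<le> (1 - r) * 0"
        if "(v, u) \<in> edges G" "y \<in> nbhd G u" for v u y
        using emap_nbhd[OF that] by simp
    qed simp_all
    ultimately show ?thesis using pmap_nbhd[OF w(1) that(2)] by simp
  qed
  show "coc (dn G) G p x \<le> dist_const g * coc (dn G) G p z"
    by (rule coc_ratio[OF assms(1,2)]) (use * g in auto)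
  show "coc (dn G) G p z \<le> dist_const g * coc (dn G) G p x"
    by (rule coc_ratio[OF assms(1,2)]) (use * g in \<open>auto simp: dist_commute\<close>)
qed

lemma coc_cell:
  assumes "walk G p" "p \<noteq> []" "z \<in> cell G (last p)" "x \<in> cell G (last p)"
  shows "coc (dn G) G p x \<le> dist_const (mesh * g) * coc (dn G) G p z"
proof (rule coc_ratio[OF assms(1,2)])
  show "0 \<le> mesh * g" using mesh_ge_1 g by simp
  fix a q assume q: "p = a @ q" "q \<noteq> []"
  have w: "walk G q" "last q = last p" using walk_suffix[of a q] q assms by auto
  then show "pmap G q x \<in> nbhd G (hd q) \<and> pmap G q z \<in> nbhd G (hd q) \<and>
      dist (pmap G q x) (pmap G q z) \<le> mesh * g * r ^ (length q - 1)"
    using pmap_nbhd[OF w(1) q(2)] pmap_cell_power[OF w(1) q(2), of x z] assms cell_nbhd[OF walk_last[OF assms(1,2)]] by simp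
qed

text \<open>Unlike \<open>pmap_cell_bound\<close> this keeps the diameter of the last cell as a
  factor, which makes covers summable over infinitely many last vertices. Points closer than
  \<open>g\<close> are handled by the mean value inequality; otherwise the diameter exceeds
  \<open>g\<close> and the former bound suffices.\<close>

lemma pmap_cell_diam:
  assumes "walk G p" "p \<noteq> []" "x \<in> cell G (last p)" "y \<in> cell G (last p)"
    and M: "\<And>z. z \<in> cell G (last p) \<Longrightarrow> coc (dn G) G p z \<le> M"
  shows "dist (pmap G p x) (pmap G p y) \<le> mesh * dist_const g * M * diameter (cell G (last p))"
proof -
  let ?J = "cell G (last p)"
  have v: "last p \<in> verts G" using walk_last assms by blast
  have M0: "0 \<le> M" using M[OF assms(3)] coc_dn_nonneg[of G G p x] by linarith
  have d: "dist x y \<le> diameter ?J"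
    using diameter_bounded_bound[OF compact_imp_bounded[OF cell(1)[OF v]]] assms by blast
  have near: "coc (dn G) G p x \<le> dist_const g * M" if "z \<in> ?J" "x \<in> cball z g" for z x
    using coc_near(1)[OF assms(1,2) that] mult_left_mono[OF M[OF that(1)], of "dist_const g"] dist_const_ge_1[of g] by linarith
  show ?thesis
  proof (cases "dist x y \<le> g")
    case True
    have "dist (pmap G p x) (pmap G p y) \<le> dist_const g * M * dist x y"
      by (rule pmap_lip[OF assms(1,2,4)]) (use True near[OF assms(4)] in \<open>auto simp: dist_commute\<close>)
    also have "\<dots> \<le> dist_const g * M * diameter ?J" using d M0 dist_const_ge_1[of g] by (intro mult_left_mono) auto
    also have "\<dots> \<le> mesh * (dist_const g * M * diameter ?J)"
      using mesh_ge_1 M0 dist_const_ge_1[of g] order_trans[OF zero_le_dist d] mult_right_mono[of 1 mesh "dist_const g * M * diameter ?J"] by simp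
    finally show ?thesis by (simp add: mult.assoc)
  next
    case False
    have "dist (pmap G p x) (pmap G p y) \<le> mesh * (dist_const g * M * g)"
      by (rule pmap_cell_bound[OF assms(1-4)]) (use near in auto)
    also have "\<dots> \<le> mesh * (dist_const g * M * diameter ?J)"
      using False d M0 dist_const_ge_1[of g] mesh_ge_1 by (intro mult_left_mono) auto
    finally show ?thesis by (simp add: mult.assoc)
  qed
qed

end

section \<open>Weights of words and the upper bound for the dimension\<close>

text \<open>The last letter of a word may be followed by any admissible vertex, as in the partition function.\<close>

definition Wt :: "real \<Rightarrow> ('v, 'a::euclidean_space) gsys \<Rightarrow> 'v list \<Rightarrow> ennreal" where
  "Wt t G w = (if walk G w then if w = [] then 1 else
      SUP u\<in>{u. (last w, u) \<in> edges G}. SUP x\<in>cell G u. ennreal (coc (dn G) G (w @ [u]) x powr t) else 0)"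

definition Zsum :: "real \<Rightarrow> ('v, 'a::euclidean_space) gsys \<Rightarrow> nat \<Rightarrow> ennreal" where
  "Zsum t G n = (\<Sum>\<^sub>\<infinity>w\<in>{w. length w = n \<and> set w \<subseteq> verts G}. Wt t G w)"

lemma Wt_upper:
  assumes "walk G w" "w \<noteq> []" "(last w, u) \<in> edges G" "x \<in> cell G u"
  shows "ennreal (coc (dn G) G (w @ [u]) x powr t) \<le> Wt t G w"
  unfolding Wt_def using assms by (auto intro!: SUP_upper2[where i = u] SUP_upper2[where i = x])

context gifs
begin

text \<open>By the chain rule the cocycle of the first part is evaluated at an image point, which
  lies in the cell of the first letter of \<open>w'\<close> and so takes part in the supremum for
  \<open>w\<close>.\<close>

lemma Wt_append: "Wt t G (w @ w') \<le> Wt t G w * Wt t G w'"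
proof (cases "w = [] \<or> w' = [] \<or> \<not> walk G (w @ w')")
  case True
  then show ?thesis by (auto simp: Wt_def)
next
  case False
  then obtain a p b q where wq: "w = p @ [a]" "w' = b # q" by (metis neq_Nil_conv rev_exhaust)
  have wk: "walk G (p @ a # b # q)" using False wq by simp
  then have wp: "walk G (p @ [a])" "walk G (a # b # q)" using walk_append[OF edges, of p a "b # q"] by auto
  have "Wt t G (w @ w') = (SUP u\<in>{u. (last w', u) \<in> edges G}. SUP x\<in>cell G u. ennreal (coc (dn G) G ((w @ w') @ [u]) x powr t))"
    using False wq by (simp add: Wt_def)
  also have "\<dots> \<le> Wt t G w * Wt t G w'"
  proof (intro SUP_least)
    fix u x assume u: "u \<in> {u. (last w', u) \<in> edges G}" and x: "x \<in> cell G u"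
    have w': "walk G (w' @ [u])"
    proof -
      obtain q' c where "w' = q' @ [c]" using wq(2) by (metis rev_exhaust list.discI)
      moreover have "walk G w'" using wp(2) wq by simp
      ultimately show ?thesis using u edge_verts walk_append[OF edges, of q' c "[u]"] by auto
    qed
    let ?y = "pmap G (w' @ [u]) x"
    have y: "?y \<in> cell G b" using pmap_cell[OF w', of x] x wq by simp
    have "coc (dn G) G ((w @ w') @ [u]) x = coc (dn G) G (w @ [b]) ?y * coc (dn G) G (w' @ [u]) x"
      using coc_append[of "dn G" G w b "q @ [u]" x] wq by simp
    then have "ennreal (coc (dn G) G ((w @ w') @ [u]) x powr t) =
        ennreal (coc (dn G) G (w @ [b]) ?y powr t) * ennreal (coc (dn G) G (w' @ [u]) x powr t)"
      by (simp add: powr_mult coc_dn_nonneg ennreal_mult'')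
    also have "\<dots> \<le> Wt t G w * Wt t G w'"
      using wp wq u x y by (intro mult_mono Wt_upper) auto
    finally show "ennreal (coc (dn G) G ((w @ w') @ [u]) x powr t) \<le> Wt t G w * Wt t G w'" .
  qed
  finally show ?thesis .
qed

lemma Zsum_add: "Zsum t G (m + n) \<le> Zsum t G m * Zsum t G n"
proof -
  let ?L = "\<lambda>n. {w. length w = n \<and> set w \<subseteq> verts G}"
  have "?L (m + n) \<subseteq> (\<lambda>z. fst z @ snd z) ` (?L m \<times> ?L n)"
  proof
    fix w assume w: "w \<in> ?L (m + n)"
    then show "w \<in> (\<lambda>z. fst z @ snd z) ` (?L m \<times> ?L n)"
      by (intro image_eqI[of _ _ "(take m w, drop m w)"]) (auto dest: in_set_takeD in_set_dropD)
  qed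
  then have "Zsum t G (m + n) \<le> infsum (Wt t G) ((\<lambda>z. fst z @ snd z) ` (?L m \<times> ?L n))"
    unfolding Zsum_def by (rule infsum_ennreal_mono) simp
  also have "\<dots> \<le> (\<Sum>\<^sub>\<infinity>z\<in>?L m \<times> ?L n. Wt t G (fst z @ snd z))" by (rule infsum_ennreal_image_le)
  also have "\<dots> \<le> (\<Sum>\<^sub>\<infinity>z\<in>?L m \<times> ?L n. Wt t G (fst z) * Wt t G (snd z))"
    by (rule infsum_ennreal_mono) (auto simp: Wt_append)
  also have "\<dots> \<le> Zsum t G m * Zsum t G n" unfolding Zsum_def by (rule infsum_ennreal_prod_le)
  finally show ?thesis .
qed

lemma Zsum_power: "0 < k \<Longrightarrow> Zsum t G (k * n) \<le> Zsum t G n ^ k"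
proof (induction k)
  case (Suc k)
  show ?case
  proof (cases "k = 0")
    case False
    have "Zsum t G (Suc k * n) \<le> Zsum t G n * Zsum t G (k * n)" using Zsum_add[of t n "k * n"] by simp
    also have "\<dots> \<le> Zsum t G n * Zsum t G n ^ k" using Suc False by (intro mult_left_mono) auto
    finally show ?thesis by simp
  qed simp
qed simp

lemma walk_snoc: "walk G (w @ [u]) \<longleftrightarrow> walk G w \<and> (last w, u) \<in> edges G" if "w \<noteq> []"
proof -
  obtain p a where "w = p @ [a]" using \<open>w \<noteq> []\<close> by (cases w rule: rev_cases) auto
  then show ?thesis using walk_append[OF edges, of p a "[u]"] edge_verts[of a u] by (simp, blast)
qed

lemma coc_snoc_le:
  assumes "walk G w" "w \<noteq> []" "(last w, u) \<in> edges G" "x \<in> cell G u"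
  shows "coc (dn G) G (w @ [u]) x \<le> r ^ length w"
  using coc_le_power[of "w @ [u]" x] walk_snoc[OF assms(2)] assms cell_nbhd[of u x] edge_verts by simp

lemma Wt_le_1: "0 \<le> t \<Longrightarrow> Wt t G w \<le> 1"
proof -
  assume t: "0 \<le> t"
  have "ennreal (coc (dn G) G (w @ [u]) x powr t) \<le> 1"
    if "walk G w" "w \<noteq> []" "(last w, u) \<in> edges G" "x \<in> cell G u" for u x
  proof -
    have "coc (dn G) G (w @ [u]) x \<le> 1"
      using coc_snoc_le[OF that] power_le_one[of r "length w"] r by simp
    then show ?thesis using t by (simp add: powr_le1 coc_dn_nonneg)
  qed
  then show ?thesis unfolding Wt_def by (auto intro!: SUP_least)
qed

text \<open>The supremum of t-th powers is itself the t-th power of a real bound \<open>M\<close>;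
  this carries estimates between derivatives and their powers.\<close>

lemma Wt_root:
  assumes "0 < t"
  obtains M where "0 \<le> M" "Wt t G w = ennreal (M powr t)"
    "\<And>u x. walk G w \<Longrightarrow> w \<noteq> [] \<Longrightarrow> (last w, u) \<in> edges G \<Longrightarrow> x \<in> cell G u \<Longrightarrow> coc (dn G) G (w @ [u]) x \<le> M"
proof -
  obtain m where m: "Wt t G w = ennreal m" "0 \<le> m"
    using Wt_le_1[of t w] assms by (cases "Wt t G w") (auto simp: top_unique)
  have eq: "(m powr (1 / t)) powr t = m" using m assms by (simp add: powr_powr)
  show thesis
  proof (rule that[of "m powr (1 / t)"])
    fix u x assume "walk G w" "w \<noteq> []" "(last w, u) \<in> edges G" "x \<in> cell G u"
    from Wt_upper[OF this, of t] have "coc (dn G) G (w @ [u]) x powr t \<le> (m powr (1 / t)) powr t"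
      using m eq by simp
    then show "coc (dn G) G (w @ [u]) x \<le> m powr (1 / t)"
      using assms by (meson not_less powr_less_mono2 powr_ge_zero)
  qed (use m eq in auto)
qed

end

section \<open>Covers by images of cells\<close>

context gifs_dist
begin

text \<open>The cover consists of the images of cells under all words of length k n. Its sum is at
  most a constant times the k-th power of \<open>Zsum t G n\<close> times \<open>S\<close>, the sum
  of the t-th powers of the diameters of the last cells. Contractibility bounds \<open>S\<close> by
  a multiple of \<open>Zsum t G 1\<close>.\<close>

theorem hausdorff_dim_le:
  assumes con: "contractible_cells G" and t: "0 < t" and Z1: "Zsum t G 1 < \<infinity>"
    and n: "0 < n" "Zsum t G n < 1"
  shows "hausdorff_dim (limit_set G) \<le> ereal t"
proof (rule hausdorff_dim_leI)
  show "0 \<le> t" using t by simp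
  let ?L = "\<lambda>n. {w. length w = n \<and> set w \<subseteq> verts G}"
  obtain c2 where c2: "0 < c2" "\<And>v. v \<in> verts G \<Longrightarrow> ennreal (diameter (cell G v)) \<le>
        ennreal c2 * (SUP e\<in>{e\<in>edges G. fst e = v}. SUP z\<in>cell G (snd e). ennreal (norm (Der (emap G e) z)))"
    using con unfolding contractible_cells_def by blast
  have bd: "bounded (cell G v)" if "v \<in> verts G" for v using cell(1)[OF that] by (rule compact_imp_bounded)
  have diam: "ennreal (diameter (cell G v) powr t) \<le> ennreal (c2 powr t) * Wt t G [v]" if v: "v \<in> verts G" for v
  proof -
    obtain M where M: "0 \<le> M" "Wt t G [v] = ennreal (M powr t)"
      "\<And>u x. (v, u) \<in> edges G \<Longrightarrow> x \<in> cell G u \<Longrightarrow> coc (dn G) G [v, u] x \<le> M"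
      using Wt_root[OF t, of "[v]"] v by auto
    have "(SUP e\<in>{e\<in>edges G. fst e = v}. SUP z\<in>cell G (snd e). ennreal (norm (Der (emap G e) z))) \<le> ennreal M"
      using M(3) by (intro SUP_least ennreal_leI) (force simp: dn_def)
    then have "ennreal (diameter (cell G v)) \<le> ennreal c2 * ennreal M"
      using c2(2)[OF v] by (meson mult_left_mono order_trans zero_le)
    then have "diameter (cell G v) \<le> c2 * M" using c2(1) M(1) by (simp add: ennreal_mult''[symmetric])
    then have "diameter (cell G v) powr t \<le> (c2 * M) powr t"
      using t diameter_ge_0[OF bd[OF v]] by (intro powr_mono2) auto
    then show ?thesis using c2(1) M(1,2) by (simp add: powr_mult ennreal_mult''[symmetric])
  qed
  define S where "S = (\<Sum>\<^sub>\<infinity>v\<in>verts G. ennreal (diameter (cell G v) powr t))"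
  have "S \<le> (\<Sum>\<^sub>\<infinity>v\<in>verts G. ennreal (c2 powr t) * Wt t G [v])"
    unfolding S_def by (rule infsum_ennreal_mono) (auto simp: diam)
  also have "\<dots> \<le> ennreal (c2 powr t) * (\<Sum>\<^sub>\<infinity>v\<in>verts G. Wt t G [v])" by (rule infsum_ennreal_cmult_le)
  also have "\<dots> \<le> ennreal (c2 powr t) * Zsum t G 1"
    unfolding Zsum_def by (intro mult_left_mono infsum_ennreal_inj_le) (auto simp: inj_on_def)
  finally have "S < \<infinity>" using Z1 by (simp add: ennreal_mult_less_top order_le_less_trans)
  define Kd where "Kd = mesh * dist_const g"
  have Kd: "0 < Kd" using mesh_ge_1 dist_const_ge_1[of g] unfolding Kd_def by (intro mult_pos_pos) auto
  show "hausdorff_measure t (limit_set G) = 0"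
  proof (rule hausdorff_measure_zeroI[OF t, where 'i = "'v list \<times> 'v"])
    fix \<eta> :: real assume \<eta>: "0 < \<eta>"
    obtain q where q: "Zsum t G n = ennreal q" "0 \<le> q" "q < 1"
      using n(2) by (cases "Zsum t G n") (auto simp: ennreal_less_one_iff)
    obtain C where C: "ennreal (Kd powr t) * S = ennreal C" "0 \<le> C"
      using \<open>S < \<infinity>\<close> by (metis ennreal_cases ennreal_less_top ennreal_mult_less_top infinity_ennreal_def order_less_irrefl)
    have "(\<lambda>k. C * q ^ k) \<longlonglongrightarrow> C * 0" using q by (intro tendsto_intros LIMSEQ_power_zero) auto
    then have "eventually (\<lambda>k. C * q ^ k < \<eta>) sequentially" using \<eta> by (intro order_tendstoD(2)) auto
    then have "eventually (\<lambda>k. C * q ^ k < \<eta> \<and> 0 < k) sequentially"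
      using eventually_gt_at_top[of 0] by eventually_elim auto
    then obtain k where k: "C * q ^ k < \<eta>" "0 < k" by (auto simp: eventually_sequentially)
    let ?N = "k * n"
    have N: "0 < ?N" using k n by simp
    define V where "V z = (if walk G (fst z @ [snd z]) then pmap G (fst z @ [snd z]) ` cell G (snd z) else {})" for z
    have Vb: "x \<in> V (w, v) \<Longrightarrow> y \<in> V (w, v) \<Longrightarrow> dist x y \<le> mesh * g * r ^ length w" for x y w v
      using pmap_cell_power[of "w @ [v]"] by (auto simp: V_def split: if_splits)
    have Vd: "ennreal (diameter (V (w, v)) powr t) \<le> ennreal (Kd powr t) * (Wt t G w * ennreal (diameter (cell G v) powr t))"
      if w: "w \<in> ?L ?N" and v: "v \<in> verts G" for w v
    proof (cases "walk G (w @ [v])")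
      case True
      have ne: "w \<noteq> []" using w N by auto
      then have wk: "walk G w" "(last w, v) \<in> edges G" using True walk_snoc by auto
      obtain M where M: "0 \<le> M" "Wt t G w = ennreal (M powr t)"
        "\<And>u x. (last w, u) \<in> edges G \<Longrightarrow> x \<in> cell G u \<Longrightarrow> coc (dn G) G (w @ [u]) x \<le> M"
        using Wt_root[OF t, of w] wk ne by metis
      have "diameter (V (w, v)) \<le> Kd * M * diameter (cell G v)"
      proof (rule diameter_le)
        show "V (w, v) \<noteq> {} \<or> 0 \<le> Kd * M * diameter (cell G v)" using True cell(3)[OF v] by (simp add: V_def)
        fix x y assume "x \<in> V (w, v)" "y \<in> V (w, v)"
        then obtain a b where ab: "a \<in> cell G v" "b \<in> cell G v" "x = pmap G (w @ [v]) a" "y = pmap G (w @ [v]) b"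
          using True by (auto simp: V_def)
        show "norm (x - y) \<le> Kd * M * diameter (cell G v)"
          using pmap_cell_diam[OF True, of a b M] ab M(3)[OF wk(2)] by (simp add: Kd_def dist_norm)
      qed
      moreover have "bounded (V (w, v))" unfolding bounded_def by (metis Vb)
      ultimately have "diameter (V (w, v)) powr t \<le> (Kd * M * diameter (cell G v)) powr t"
        using t by (intro powr_mono2 diameter_ge_0) auto
      also have "\<dots> = Kd powr t * (M powr t * diameter (cell G v) powr t)"
        using Kd M(1) diameter_ge_0[OF bd[OF v]] by (simp add: powr_mult mult.assoc)
      finally show ?thesis using M(2) by (simp add: ennreal_mult''[symmetric] ennreal_leI)
    next
      case False
      then show ?thesis using t by (simp add: V_def)
    qed
    have "limit_set G \<subseteq> (\<Union>z\<in>?L ?N \<times> verts G. V z)"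
    proof
      fix x assume "x \<in> limit_set G"
      then obtain \<omega> where \<omega>: "\<omega> \<in> paths G" "x = coding G \<omega>" by (auto simp: limit_set_def)
      let ?w = "map \<omega> [0..<?N]"
      have vs: "\<omega> i \<in> verts G" for i using \<omega> by (auto simp: paths_def)
      have "x = pmap G (?w @ [\<omega> ?N]) (coding G ((shift ^^ ?N) \<omega>))"
        using coding_shift_iterate[OF \<omega>(1), of ?N] \<omega>(2) by simp
      moreover have "coding G ((shift ^^ ?N) \<omega>) \<in> cell G (\<omega> ?N)"
        using coding_cell[OF shift_iterate_paths[OF \<omega>(1)], of ?N] by (simp add: shift_iterate)
      moreover have "walk G (?w @ [\<omega> ?N])" using walk_map[OF \<omega>(1), of "Suc ?N"] by simp
      ultimately have "x \<in> V (?w, \<omega> ?N)" by (auto simp: V_def)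
      moreover have "(?w, \<omega> ?N) \<in> ?L ?N \<times> verts G" using vs by auto
      ultimately show "x \<in> (\<Union>z\<in>?L ?N \<times> verts G. V z)" by blast
    qed
    moreover have "countable (?L ?N \<times> verts G)"
    proof -
      have "?L ?N \<subseteq> lists (verts G)" by auto
      then show ?thesis using countable_verts by (meson countable_SIGMA countable_lists countable_subset)
    qed
    moreover have "bounded (V z)" for z
      unfolding bounded_def by (metis Vb prod.collapse)
    moreover have "(\<Sum>\<^sub>\<infinity>z\<in>?L ?N \<times> verts G. ennreal (diameter (V z) powr t)) \<le> ennreal \<eta>"
    proof -
      have "(\<Sum>\<^sub>\<infinity>z\<in>?L ?N \<times> verts G. ennreal (diameter (V z) powr t)) \<le>
          (\<Sum>\<^sub>\<infinity>z\<in>?L ?N \<times> verts G. ennreal (Kd powr t) * (Wt t G (fst z) * ennreal (diameter (cell G (snd z)) powr t)))"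
        by (rule infsum_ennreal_mono) (auto intro: Vd)
      also have "\<dots> \<le> ennreal (Kd powr t) * (\<Sum>\<^sub>\<infinity>z\<in>?L ?N \<times> verts G. Wt t G (fst z) * ennreal (diameter (cell G (snd z)) powr t))"
        by (rule infsum_ennreal_cmult_le)
      also have "\<dots> \<le> ennreal (Kd powr t) * (Zsum t G ?N * S)"
        unfolding Zsum_def S_def by (intro mult_left_mono infsum_ennreal_prod_le) auto
      also have "\<dots> \<le> ennreal (Kd powr t) * (ennreal q ^ k * S)"
        using Zsum_power[OF k(2), of t n] q by (intro mult_left_mono mult_right_mono) auto
      also have "\<dots> = ennreal (C * q ^ k)" using C q
        by (simp add: ennreal_mult' ennreal_power mult_ac) (metis mult.commute mult.left_commute)
      also have "\<dots> \<le> ennreal \<eta>" using k by (intro ennreal_leI) simp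
      finally show ?thesis .
    qed
    ultimately have fin: "countable (?L ?N \<times> verts G) \<and> limit_set G \<subseteq> (\<Union>i\<in>?L ?N \<times> verts G. V i) \<and>
        (\<forall>i\<in>?L ?N \<times> verts G. bounded (V i)) \<and>
        (\<Sum>\<^sub>\<infinity>i\<in>?L ?N \<times> verts G. ennreal (diameter (V i) powr t)) \<le> ennreal \<eta>"
      by simp
    show "\<exists>(I :: ('v list \<times> 'v) set) V. countable I \<and> limit_set G \<subseteq> (\<Union>i\<in>I. V i) \<and> (\<forall>i\<in>I. bounded (V i)) \<and>
        (\<Sum>\<^sub>\<infinity>i\<in>I. ennreal (diameter (V i) powr t)) \<le> ennreal \<eta>"
      by (rule exI[of _ "?L ?N \<times> verts G"], rule exI[of _ V], rule fin)
  qed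
qed

end

section \<open>Pressure\<close>

lemma exp_ereal_mono: "x \<le> y \<Longrightarrow> exp_ereal x \<le> exp_ereal y"
  by (cases x; cases y) (auto simp: exp_ereal_def ennreal_leI)

lemma exp_ereal_ereal [simp]: "exp_ereal (ereal a) = ennreal (exp a)"
  by (simp add: exp_ereal_def)

lemma exp_ereal_SUP_le:
  assumes "\<And>x. x \<in> A \<Longrightarrow> ennreal (exp (f x)) \<le> C"
  shows "exp_ereal (SUP x\<in>A. ereal (f x)) \<le> C"
proof (cases "A = {}")
  case True
  then show ?thesis by (simp add: exp_ereal_def bot_ereal_def)
next
  case False
  then obtain x where x: "x \<in> A" by blast
  show ?thesis
  proof (cases C)
    case (real c)
    have "exp (f y) \<le> c" if "y \<in> A" for y using assms[OF that] real by simp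
    moreover from this have "0 < c" using x by (meson exp_gt_zero less_le_trans)
    ultimately have c: "0 < c" "\<And>y. y \<in> A \<Longrightarrow> f y \<le> ln c" by (simp_all add: ln_ge_iff)
    have "exp_ereal (SUP x\<in>A. ereal (f x)) \<le> exp_ereal (ereal (ln c))"
      by (intro exp_ereal_mono SUP_least) (simp add: c)
    then show ?thesis using c real by simp
  qed simp
qed

lemma ln_ennreal_div_less:
  assumes "0 < n" "ln_ennreal x / ereal (real n) < ereal \<kappa>"
  shows "x \<le> ennreal (exp (\<kappa> * real n))"
proof (cases x)
  case (real a)
  show ?thesis
  proof (cases "a = 0")
    case False
    then have "ln a / real n < \<kappa>" using assms real by (simp add: ln_ennreal_def)
    then have "ln a \<le> \<kappa> * real n" using assms by (simp add: field_simps)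
    then have "a \<le> exp (\<kappa> * real n)" using False real by (metis exp_le_cancel_iff exp_ln less_le)
    then show ?thesis using real by (simp add: ennreal_leI)
  qed (simp add: real)
next
  case top
  then show ?thesis using assms by (simp add: ln_ennreal_def)
qed

lemma ln_ennreal_div_le:
  assumes "0 < n" "x \<le> ennreal (exp a)"
  shows "ln_ennreal x / ereal (real n) \<le> ereal (a / real n)"
proof (cases x)
  case (real b)
  show ?thesis
  proof (cases "b = 0")
    case True
    then show ?thesis using assms real by (simp add: ln_ennreal_def)
  next
    case False
    then have "b \<le> exp a" "0 < b" using assms real by auto
    then have "ln b \<le> ln (exp a)" by (subst ln_le_cancel_iff) auto
    then have "ln b \<le> a" by simp
    then show ?thesis using assms real False by (simp add: ln_ennreal_def divide_right_mono)
  qed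
next
  case top
  then show ?thesis using assms by (simp add: top_unique)
qed

lemma has_pressure_0_not_decay:
  assumes P: "has_pressure G f 0" and B: "0 < B" and q: "0 < q" "q < 1"
    and ev: "\<forall>\<^sub>F n in sequentially. partition_sum G f n \<le> ennreal (B * q ^ n)"
  shows False
proof -
  have lq: "ln q < 0" using q by simp
  have "(\<lambda>n. ln_ennreal (partition_sum G f n) / ereal (real n)) \<longlonglongrightarrow> 0" using P by (simp add: has_pressure_def)
  moreover have "ereal (ln q / 2) < 0" using lq by simp
  ultimately have 1: "\<forall>\<^sub>F n in sequentially. ereal (ln q / 2) < ln_ennreal (partition_sum G f n) / ereal (real n)"
    by (rule order_tendstoD(1))
  have "(\<lambda>n. B * sqrt q ^ n) \<longlonglongrightarrow> B * 0"
    using q by (intro tendsto_intros LIMSEQ_power_zero) auto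
  then have 2: "\<forall>\<^sub>F n in sequentially. B * sqrt q ^ n < 1" by (rule order_tendstoD(2)) simp
  have "\<forall>\<^sub>F n in sequentially. False"
    using 1 2 ev eventually_gt_at_top[of 0]
  proof eventually_elim
    case (elim n)
    \<comment> \<open>One square root of the rate absorbs \<open>B\<close>; the other remains as
      decay and contradicts the limit 0.\<close>
    have "B * q ^ n = (B * sqrt q ^ n) * sqrt q ^ n"
      using q by (simp add: mult.assoc power_mult_distrib[symmetric])
    also have "\<dots> \<le> 1 * sqrt q ^ n" using elim q by (intro mult_right_mono) auto
    also have "1 * sqrt q ^ n = exp (ln q / 2 * real n)"
      using q by (simp add: exp_of_nat2_mult ln_sqrt[symmetric] exp_of_nat_mult)
    finally have "partition_sum G f n \<le> ennreal (exp (ln q / 2 * real n))"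
      using elim(3) by (meson ennreal_leI order_trans)
    from ln_ennreal_div_le[OF elim(4) this] elim(1,4) show False by simp
  qed
  then show False by simp
qed

text \<open>The closing vertex is not listed: \<open>l @ [v]\<close> is the closed walk, and
  \<open>length l\<close> is its number of maps.\<close>

definition loops :: "('v, 'a) gsys \<Rightarrow> 'v \<Rightarrow> nat \<Rightarrow> 'v list set" where
  "loops G v n = {l. length l = n \<and> l \<noteq> [] \<and> hd l = v \<and> walk G (l @ [v])}"

text \<open>Positive derivatives make \<open>exp\<close> of the potential the derivative norm
  itself, and \<open>live\<close> lets every finite walk occur as the beginning of a path.\<close>

locale gifs_conf = gifs_dist G g r \<Delta> c1 \<beta> for G :: "('v, 'a::euclidean_space) gsys" and g r \<Delta> c1 \<beta> :: real +
  assumes live: "\<And>v. v \<in> verts G \<Longrightarrow> \<exists>u. (v, u) \<in> edges G"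
    and dn_pos: "\<And>v u x. (v, u) \<in> edges G \<Longrightarrow> x \<in> nbhd G u \<Longrightarrow> 0 < dn G (v, u) x"
begin

lemma coc_pos: "walk G p \<Longrightarrow> p \<noteq> [] \<Longrightarrow> x \<in> nbhd G (last p) \<Longrightarrow> 0 < coc (dn G) G p x"
proof (induction p rule: induct_list012)
  case (3 v u p)
  then show ?case using pmap_nbhd[of "u # p" x] dn_pos[of v u] by simp
qed auto

lemma sum_pot:
  assumes "\<omega> \<in> paths G"
  shows "(\<Sum>i<n. pot G ((shift ^^ i) \<omega>)) = ln (coc (dn G) G (map \<omega> [0..<Suc n]) (coding G ((shift ^^ n) \<omega>)))"
  using assms
proof (induction n arbitrary: \<omega>)
  case (Suc n)
  let ?p = "map (shift \<omega>) [0..<Suc n]" and ?y = "coding G ((shift ^^ n) (shift \<omega>))"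
  have \<omega>': "shift \<omega> \<in> paths G" by (rule shift_paths[OF Suc.prems])
  have p: "map \<omega> [0..<Suc (Suc n)] = \<omega> 0 # ?p"
    by (subst map_upt_Suc) (simp add: shift_def)
  have q: "?p = \<omega> 1 # map (\<lambda>i. shift \<omega> (Suc i)) [0..<n]"
    by (subst map_upt_Suc) (simp add: shift_def)
  have sh: "(shift ^^ Suc n) \<omega> = (shift ^^ n) (shift \<omega>)" for n by (simp add: funpow_swap1)
  have c: "pmap G ?p ?y = coding G (shift \<omega>)" using coding_shift_iterate[OF \<omega>'] by simp
  have "coc (dn G) G (\<omega> 0 # ?p) ?y = dn G (\<omega> 0, \<omega> 1) (coding G (shift \<omega>)) * coc (dn G) G ?p ?y"
    unfolding c[symmetric] unfolding q by simp
  moreover have "0 < coc (dn G) G ?p ?y"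
  proof (rule coc_pos)
    show "walk G ?p" by (rule walk_map[OF \<omega>'])
    show "?y \<in> nbhd G (last ?p)"
      using coding_cell[OF shift_iterate_paths[OF \<omega>'], of n] \<omega>'
      by (auto intro!: cell_nbhd simp: shift_iterate paths_def)
  qed simp
  moreover have "0 < dn G (\<omega> 0, \<omega> 1) (coding G (shift \<omega>))"
    using coding_cell[OF \<omega>'] Suc.prems edges by (intro dn_pos cell_nbhd) (auto simp: paths_def shift_def)
  ultimately have "ln (coc (dn G) G (\<omega> 0 # ?p) ?y) = pot G \<omega> + ln (coc (dn G) G ?p ?y)"
    by (simp add: ln_mult pot_def dn_def)
  moreover have "(\<Sum>i<Suc n. pot G ((shift ^^ i) \<omega>)) = pot G \<omega> + (\<Sum>i<n. pot G ((shift ^^ i) (shift \<omega>)))"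
    by (subst sum.lessThan_Suc_shift) (simp add: funpow_swap1)
  ultimately show ?case unfolding Suc.IH[OF \<omega>'] p sh by simp
qed simp

lemma exp_sum_pot:
  assumes "\<omega> \<in> cylinder G w" "length w = n" "w \<noteq> []"
  shows "exp (\<Sum>i<n. s * pot G ((shift ^^ i) \<omega>)) = coc (dn G) G (w @ [\<omega> n]) (coding G ((shift ^^ n) \<omega>)) powr s"
    "walk G (w @ [\<omega> n])" "coding G ((shift ^^ n) \<omega>) \<in> cell G (\<omega> n)"
proof -
  have \<omega>: "\<omega> \<in> paths G" "map \<omega> [0..<n] = w" using assms by (auto simp: cylinder_def)
  have w: "map \<omega> [0..<Suc n] = w @ [\<omega> n]" using \<omega> by simp
  show wk: "walk G (w @ [\<omega> n])" using walk_map[OF \<omega>(1), of "Suc n"] w by simp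
  show c: "coding G ((shift ^^ n) \<omega>) \<in> cell G (\<omega> n)"
    using coding_cell[OF shift_iterate_paths[OF \<omega>(1)], of n] by (simp add: shift_iterate)
  have "coding G ((shift ^^ n) \<omega>) \<in> nbhd G (last (w @ [\<omega> n]))"
    using c \<omega>(1) by (auto intro!: cell_nbhd simp: paths_def)
  then have pos: "0 < coc (dn G) G (w @ [\<omega> n]) (coding G ((shift ^^ n) \<omega>))"
    by (intro coc_pos wk) auto
  have "(\<Sum>i<n. s * pot G ((shift ^^ i) \<omega>)) = s * ln (coc (dn G) G (w @ [\<omega> n]) (coding G ((shift ^^ n) \<omega>)))"
    unfolding sum_distrib_left[symmetric] sum_pot[OF \<omega>(1)] w ..
  then show "exp (\<Sum>i<n. s * pot G ((shift ^^ i) \<omega>)) = coc (dn G) G (w @ [\<omega> n]) (coding G ((shift ^^ n) \<omega>)) powr s"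
    using pos by (simp add: powr_def)
qed

lemma partition_sum_le_Zsum:
  assumes n: "0 < n"
  shows "partition_sum G (\<lambda>\<omega>. s * pot G \<omega>) n \<le> Zsum s G n"
  unfolding partition_sum_def Zsum_def
proof (rule infsum_ennreal_mono)
  fix w assume w: "w \<in> {w. length w = n \<and> set w \<subseteq> verts G \<and> cylinder G w \<noteq> {}}"
  then have ne: "w \<noteq> []" using n by auto
  show "exp_ereal (SUP \<omega>\<in>cylinder G w. ereal (\<Sum>i<n. s * pot G ((shift ^^ i) \<omega>))) \<le> Wt s G w"
  proof (rule exp_ereal_SUP_le)
    fix \<omega> assume \<omega>: "\<omega> \<in> cylinder G w"
    have "length w = n" using w by simp
    from exp_sum_pot(1)[OF \<omega> this ne, of s] exp_sum_pot(2,3)[OF \<omega> this ne] show "ennreal (exp (\<Sum>i<n. s * pot G ((shift ^^ i) \<omega>))) \<le> Wt s G w"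
      using walk_snoc[OF ne] by (auto intro!: Wt_upper ne)
  qed
qed auto

text \<open>The partition function takes suprema over coded points, \<open>Zsum\<close> over whole
  cells. By \<open>live\<close> a walk followed by a vertex \<open>u\<close> is the beginning of a
  path, which provides a coded point in the cell of \<open>u\<close>; \<open>coc_cell\<close>
  compares it with the other points of that cell.\<close>

lemma Zsum_le_partition_sum:
  assumes n: "0 < n" and s: "0 \<le> s"
  shows "Zsum s G n \<le> ennreal (dist_const (mesh * g) powr s) * partition_sum G (\<lambda>\<omega>. s * pot G \<omega>) n"
proof -
  let ?A = "{w. length w = n \<and> set w \<subseteq> verts G}"
  let ?B = "{w. length w = n \<and> set w \<subseteq> verts G \<and> cylinder G w \<noteq> {}}"
  let ?K = "dist_const (mesh * g)"
  let ?T = "\<lambda>w. exp_ereal (SUP \<omega>\<in>cylinder G w. ereal (\<Sum>i<n. s * pot G ((shift ^^ i) \<omega>)))"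
  have key: "cylinder G w \<noteq> {} \<and> Wt s G w \<le> ennreal (?K powr s) * ?T w" if w: "w \<in> ?A" "walk G w" for w
  proof -
    have ne: "w \<noteq> []" using w n by auto
    have ex: "\<exists>\<omega>\<in>cylinder G w. \<omega> n = u \<and> (shift ^^ n) \<omega> \<in> paths G" if e: "(last w, u) \<in> edges G" for u
    proof -
      obtain \<omega> where \<omega>: "\<omega> \<in> paths G" "\<omega> 0 = u"
        by (rule path_from[OF _ edge_verts(2)[OF e]]) (rule live)
      have "walk G (w @ [\<omega> 0])" using walk_snoc[OF ne] w e \<omega> by simp
      then have "pre w \<omega> \<in> cylinder G w" using pre_paths[OF \<omega>(1), of w] map_pre[of w \<omega>] by (simp add: cylinder_def)
      moreover have "(shift ^^ n) (pre w \<omega>) = \<omega>" using shift_iterate_pre[of w \<omega>] w by simp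
      moreover from this have "pre w \<omega> n = u" using \<omega>(2) by (simp add: shift_iterate fun_eq_iff) (metis add_0)
      ultimately show ?thesis using \<omega>(1) by (metis)
    qed
    obtain u where "(last w, u) \<in> edges G" using live walk_last[OF w(2) ne] by blast
    with ex have cn: "cylinder G w \<noteq> {}" by blast
    have "ennreal (coc (dn G) G (w @ [u]) x powr s) \<le> ennreal (?K powr s) * ?T w"
      if u: "(last w, u) \<in> edges G" and x: "x \<in> cell G u" for u x
    proof -
      obtain \<omega> where \<omega>: "\<omega> \<in> cylinder G w" "\<omega> n = u" using ex[OF u] by blast
      have len: "length w = n" using w by simp
      note e = exp_sum_pot(1)[OF \<omega>(1) len ne, of s, unfolded \<omega>(2)] exp_sum_pot(2,3)[OF \<omega>(1) len ne, unfolded \<omega>(2)]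
      let ?y = "coding G ((shift ^^ n) \<omega>)"
      have "coc (dn G) G (w @ [u]) x \<le> ?K * coc (dn G) G (w @ [u]) ?y"
        using e x by (intro coc_cell) auto
      then have "coc (dn G) G (w @ [u]) x powr s \<le> (?K * coc (dn G) G (w @ [u]) ?y) powr s"
        using s by (intro powr_mono2 coc_dn_nonneg)
      also have "\<dots> = ?K powr s * exp (\<Sum>i<n. s * pot G ((shift ^^ i) \<omega>))"
        unfolding e(1) using dist_const_ge_1[of "mesh * g"] by (simp add: powr_mult coc_dn_nonneg)
      finally have "ennreal (coc (dn G) G (w @ [u]) x powr s) \<le> ennreal (?K powr s) * ennreal (exp (\<Sum>i<n. s * pot G ((shift ^^ i) \<omega>)))"
        by (simp add: ennreal_mult''[symmetric] ennreal_leI)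
      also have "\<dots> \<le> ennreal (?K powr s) * ?T w"
        unfolding exp_ereal_ereal[symmetric] by (intro mult_left_mono exp_ereal_mono SUP_upper \<omega>) auto
      finally show ?thesis .
    qed
    then have "Wt s G w \<le> ennreal (?K powr s) * ?T w"
      unfolding Wt_def using ne w by (auto intro!: SUP_least)
    with cn show ?thesis by blast
  qed
  have "Zsum s G n = infsum (Wt s G) ?B"
    unfolding Zsum_def by (rule infsum_cong_neutral) (use key in \<open>auto simp: Wt_def\<close>)
  also have "\<dots> \<le> (\<Sum>\<^sub>\<infinity>w\<in>?B. ennreal (?K powr s) * ?T w)"
  proof (rule infsum_ennreal_mono)
    fix w assume "w \<in> ?B"
    then show "Wt s G w \<le> ennreal (?K powr s) * ?T w"
      using key[of w] by (cases "walk G w") (auto simp: Wt_def)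
  qed simp
  also have "\<dots> \<le> ennreal (?K powr s) * infsum ?T ?B" by (rule infsum_ennreal_cmult_le)
  finally show ?thesis by (simp add: partition_sum_def)
qed

section \<open>Dependence of the sums on the exponent\<close>

lemma Wt_mono_exponent:
  assumes "s \<le> t"
  shows "Wt t G w \<le> ennreal ((r powr (t - s)) ^ length w) * Wt s G w"
proof -
  have "ennreal (coc (dn G) G (w @ [u]) x powr t) \<le> ennreal ((r powr (t - s)) ^ length w) * Wt s G w"
    if w: "walk G w" "w \<noteq> []" "(last w, u) \<in> edges G" "x \<in> cell G u" for u x
  proof -
    let ?c = "coc (dn G) G (w @ [u]) x"
    have "?c powr t = ?c powr (t - s) * ?c powr s" by (simp add: powr_add[symmetric])
    also have "\<dots> \<le> (r ^ length w) powr (t - s) * ?c powr s"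
      using assms coc_snoc_le[OF w] by (intro mult_right_mono powr_mono2 coc_dn_nonneg) auto
    also have "(r ^ length w) powr (t - s) = (r powr (t - s)) ^ length w"
      using r by (simp add: powr_power powr_realpow[symmetric] powr_powr mult.commute)
    finally have "ennreal (?c powr t) \<le> ennreal ((r powr (t - s)) ^ length w) * ennreal (?c powr s)"
      by (simp add: ennreal_mult''[symmetric] ennreal_leI)
    also have "\<dots> \<le> ennreal ((r powr (t - s)) ^ length w) * Wt s G w"
      by (intro mult_left_mono Wt_upper w) auto
    finally show ?thesis .
  qed
  then show ?thesis by (auto simp: Wt_def intro!: SUP_least)
qed

lemma Zsum_mono_exponent:
  assumes "s \<le> t"
  shows "Zsum t G n \<le> ennreal ((r powr (t - s)) ^ n) * Zsum s G n"
proof -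
  have "Zsum t G n \<le> (\<Sum>\<^sub>\<infinity>w\<in>{w. length w = n \<and> set w \<subseteq> verts G}. ennreal ((r powr (t - s)) ^ n) * Wt s G w)"
    unfolding Zsum_def by (rule infsum_ennreal_mono) (use Wt_mono_exponent[OF assms] in auto)
  also have "\<dots> \<le> ennreal ((r powr (t - s)) ^ n) * Zsum s G n"
    unfolding Zsum_def by (rule infsum_ennreal_cmult_le)
  finally show ?thesis .
qed

lemma Zsum_decay:
  assumes P: "has_pressure G (\<lambda>\<omega>. s * pot G \<omega>) 0" and s: "0 \<le> s" "s < t"
  obtains C q where "0 < C" "0 < q" "q < 1" "\<forall>\<^sub>F n in sequentially. Zsum t G n \<le> ennreal (C * q ^ n)"
proof -
  \<comment> \<open>Raising the exponent by \<open>t - s\<close> gains q^(2 n), while pressure 0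
    eventually costs at most q^(-n); q^n is left.\<close>
  define q where "q = r powr ((t - s) / 2)"
  have q: "0 < q" "q < 1" using r s powr_less_mono2[of "(t - s) / 2" r 1] by (auto simp: q_def)
  define K where "K = dist_const (mesh * g) powr s"
  have K: "0 < K" using dist_const_ge_1[of "mesh * g"] by (simp add: K_def)
  have "0 < - ln q" using q by simp
  moreover have "(\<lambda>n. ln_ennreal (partition_sum G (\<lambda>\<omega>. s * pot G \<omega>) n) / ereal (real n)) \<longlonglongrightarrow> 0"
    using P by (simp add: has_pressure_def)
  ultimately have "\<forall>\<^sub>F n in sequentially. ln_ennreal (partition_sum G (\<lambda>\<omega>. s * pot G \<omega>) n) / ereal (real n) < ereal (- ln q)"
    by (intro order_tendstoD(2)) auto
  then have "\<forall>\<^sub>F n in sequentially. Zsum t G n \<le> ennreal (K * q ^ n)"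
    using eventually_gt_at_top[of 0]
  proof eventually_elim
    case (elim n)
    have "Zsum t G n \<le> ennreal ((r powr (t - s)) ^ n) * Zsum s G n" using s by (intro Zsum_mono_exponent) simp
    also have "\<dots> \<le> ennreal ((r powr (t - s)) ^ n) * (ennreal K * partition_sum G (\<lambda>\<omega>. s * pot G \<omega>) n)"
      unfolding K_def by (intro mult_left_mono Zsum_le_partition_sum elim s) auto
    also have "\<dots> \<le> ennreal ((r powr (t - s)) ^ n) * (ennreal K * ennreal (exp (- ln q * real n)))"
      by (intro mult_left_mono ln_ennreal_div_less elim) auto
    also have "\<dots> = ennreal ((r powr (t - s)) ^ n * (K * exp (- ln q * real n)))"
      using K by (simp add: ennreal_mult''[symmetric])
    also have "r powr (t - s) = q * q" by (simp add: q_def powr_add[symmetric])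
    also have "exp (- ln q * real n) = 1 / q ^ n"
      using q by (simp add: exp_minus exp_of_nat2_mult exp_of_nat_mult divide_inverse)
    also have "(q * q) ^ n * (K * (1 / q ^ n)) = K * q ^ n" using q by (simp add: power_mult_distrib)
    finally show ?case .
  qed
  then show thesis using that K q by blast
qed

text \<open>A zero above \<open>s\<close> would contradict the exponential decay of the sums there.
  It is meant for the zero that lies in \<open>I_P\<close>, with \<open>s\<close> from
  V-summability.\<close>

lemma pressure_zero_exponent_le:
  assumes "has_pressure G (\<lambda>\<omega>. s * pot G \<omega>) 0" "0 \<le> s" "has_pressure G (\<lambda>\<omega>. t * pot G \<omega>) 0"
  shows "t \<le> s"
proof (rule ccontr)
  assume "\<not> t \<le> s"
  then obtain C q where C: "0 < C" "0 < q" "q < 1" "\<forall>\<^sub>F n in sequentially. Zsum t G n \<le> ennreal (C * q ^ n)"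
    using Zsum_decay[OF assms(1,2), of t] by auto
  have "\<forall>\<^sub>F n in sequentially. partition_sum G (\<lambda>\<omega>. t * pot G \<omega>) n \<le> ennreal (C * q ^ n)"
    using C(4) eventually_gt_at_top[of 0]
  proof eventually_elim
    case (elim n)
    then show ?case using partition_sum_le_Zsum[OF elim(2), of t] by order
  qed
  then show False using has_pressure_0_not_decay[OF assms(3) C(1-3)] by blast
qed

section \<open>Loops of large total weight\<close>

definition base_point :: "'v \<Rightarrow> 'a" where
  "base_point v = (SOME x. x \<in> cell G v)"

lemma base_point: "v \<in> verts G \<Longrightarrow> base_point v \<in> cell G v"
  unfolding base_point_def using cell(3)[of v] by (simp add: some_in_eq)

text \<open>Unlike in \<open>Wt\<close>, the vertex that follows \<open>l\<close> is
  prescribed.\<close>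

definition loop_weight :: "real \<Rightarrow> 'v \<Rightarrow> 'v list \<Rightarrow> ennreal" where
  "loop_weight s v l = (SUP x\<in>cell G v. ennreal (coc (dn G) G (l @ [v]) x powr s))"

text \<open>A generating function: if it is finite for some \<open>z > 1\<close>, the sums over
  words of length n decay at least like z^(-n).\<close>

definition genfun :: "real \<Rightarrow> real \<Rightarrow> 'v set \<Rightarrow> ennreal" where
  "genfun s z U = (\<Sum>\<^sub>\<infinity>w\<in>{w\<in>lists U. walk G w}. ennreal (z ^ length w) * Wt s G w)"

text \<open>Submultiplicativity cuts off \<open>w1\<close> and \<open>w2\<close>. In the remaining
  \<open>l @ [m]\<close> the vertex after \<open>l\<close> is known to be \<open>m\<close>, which is
  where \<open>loop_weight\<close> can replace \<open>Wt\<close>.\<close>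

lemma Wt_loop_split:
  assumes "walk G (w1 @ l @ m # w2)"
  shows "Wt s G (w1 @ l @ m # w2) \<le> Wt s G w1 * (loop_weight s m l * (Wt s G w2 * Wt s G [m]))"
proof -
  have wl: "walk G (l @ [m])" "m \<in> verts G"
  proof -
    have "walk G ((w1 @ l) @ [m])" using assms walk_append[OF edges, of "w1 @ l" m w2] by simp
    then show "walk G (l @ [m])" using walk_suffix[of w1 "l @ [m]"] by simp
    then show "m \<in> verts G" using walk_last by fastforce
  qed
  have "Wt s G (l @ [m]) \<le> loop_weight s m l * Wt s G [m]"
  proof -
    have "ennreal (coc (dn G) G ((l @ [m]) @ [u]) x powr s) \<le> loop_weight s m l * Wt s G [m]"
      if u: "(m, u) \<in> edges G" and x: "x \<in> cell G u" for u x
    proof -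
      let ?y = "pmap G [m, u] x"
      have y: "?y \<in> cell G m" using u x by (simp add: emap_cell)
      have "ennreal (coc (dn G) G ((l @ [m]) @ [u]) x powr s) =
          ennreal (coc (dn G) G (l @ [m]) ?y powr s) * ennreal (coc (dn G) G ([m] @ [u]) x powr s)"
        using coc_append[of "dn G" G l m "[u]" x] by (simp add: powr_mult coc_dn_nonneg dn_nonneg ennreal_mult'')
      also have "\<dots> \<le> loop_weight s m l * Wt s G [m]"
        unfolding loop_weight_def using u x wl by (intro mult_mono SUP_upper y Wt_upper) auto
      finally show ?thesis .
    qed
    then show ?thesis using wl by (auto simp: Wt_def intro!: SUP_least)
  qed
  then have "Wt s G ((l @ [m]) @ w2) \<le> (loop_weight s m l * Wt s G [m]) * Wt s G w2"
    using Wt_append[of s "l @ [m]" w2] by (meson mult_right_mono order_trans zero_le)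
  then have "Wt s G w1 * Wt s G ((l @ [m]) @ w2) \<le> Wt s G w1 * ((loop_weight s m l * Wt s G [m]) * Wt s G w2)"
    by (intro mult_left_mono) auto
  with Wt_append[of s w1 "(l @ [m]) @ w2"]
  have "Wt s G (w1 @ (l @ [m]) @ w2) \<le> Wt s G w1 * ((loop_weight s m l * Wt s G [m]) * Wt s G w2)" by (rule order_trans)
  then show ?thesis by (simp add: mult.assoc mult.commute[of "Wt s G [m]"])
qed

text \<open>A word over \<open>insert m U\<close> that contains \<open>m\<close> is split at the first and the last occurrence of \<open>m\<close>;
  the part in between is a loop.\<close>

lemma genfun_insert:
  assumes z: "0 \<le> z" and m: "m \<in> verts G"
    and loop: "(\<Sum>\<^sub>\<infinity>l\<in>{l. l = [] \<or> hd l = m \<and> walk G (l @ [m])}. ennreal (z ^ length l) * loop_weight s m l) < \<infinity>"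
    and U: "genfun s z U < \<infinity>" and W: "Wt s G [m] < \<infinity>"
  shows "genfun s z (insert m U) < \<infinity>"
proof -
  let ?f = "\<lambda>w. ennreal (z ^ length w) * Wt s G w"
  let ?l = "\<lambda>l. ennreal (z ^ length l) * loop_weight s m l"
  let ?LU = "{w\<in>lists U. walk G w}"
  \<comment> \<open>The empty word covers the case of a single occurrence of
    \<open>m\<close>.\<close>
  let ?Lo = "{l. l = [] \<or> hd l = m \<and> walk G (l @ [m])}"
  let ?c = "ennreal z * Wt s G [m]"
  let ?h = "\<lambda>t. fst t @ fst (snd t) @ m # snd (snd t)"
  let ?D = "{t \<in> ?LU \<times> ?Lo \<times> ?LU. walk G (?h t)}"
  have sub: "{w\<in>lists (insert m U). walk G w} \<subseteq> ?LU \<union> ?h ` ?D"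
  proof
    fix w assume w: "w \<in> {w\<in>lists (insert m U). walk G w}"
    show "w \<in> ?LU \<union> ?h ` ?D"
    proof (cases "m \<in> set w")
      case False
      then show ?thesis using w by (auto simp: in_lists_conv_set)
    next
      case True
      obtain w1 w' where w1: "w = w1 @ m # w'" "m \<notin> set w1" using split_list_first[OF True] by blast
      obtain l w2 where l: "m # w' = l @ m # w2" "m \<notin> set w2" using split_list_last[of m "m # w'"] by auto
      have wk: "walk G (w1 @ l @ m # w2)" using w w1 l by simp
      then have a: "walk G ((w1 @ l) @ [m])" "walk G (m # w2)" using walk_append[OF edges, of "w1 @ l" m w2] by auto
      have b: "walk G (l @ [m])" using a walk_suffix[of w1 "l @ [m]"] by simp
      have c: "walk G w2" using a(2) by (cases w2) auto
      have d: "walk G w1"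
      proof (cases "w1 = []")
        case False
        have "walk G (w1 @ [m])" using w w1 walk_append[OF edges, of w1 m w'] by simp
        then show ?thesis using walk_snoc[OF False] by blast
      qed simp
      have "set w1 \<subseteq> U" "set w2 \<subseteq> U" using w w1 l by (auto simp: in_lists_conv_set)
      then have "(w1, l, w2) \<in> ?D" using wk b c d l w1 by (cases l) (auto simp: in_lists_conv_set)
      moreover have "w = ?h (w1, l, w2)" using w1 l by simp
      ultimately show ?thesis by blast
    qed
  qed
  have "genfun s z (insert m U) \<le> infsum ?f (?LU \<union> ?h ` ?D)"
    unfolding genfun_def by (rule infsum_ennreal_mono[OF sub]) simp
  also have "\<dots> \<le> genfun s z U + infsum ?f (?h ` ?D)" unfolding genfun_def by (rule infsum_ennreal_Un_le)
  also have "infsum ?f (?h ` ?D) \<le> (\<Sum>\<^sub>\<infinity>t\<in>?D. ?f (?h t))" by (rule infsum_ennreal_image_le)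
  also have "(\<Sum>\<^sub>\<infinity>t\<in>?D. ?f (?h t)) \<le> (\<Sum>\<^sub>\<infinity>t\<in>?LU \<times> ?Lo \<times> ?LU. ?f (fst t) * (?l (fst (snd t)) * (?c * ?f (snd (snd t)))))"
  proof (rule infsum_ennreal_mono)
    fix t assume "t \<in> ?D"
    then have "ennreal (z ^ length (?h t)) * Wt s G (?h t) \<le> ennreal (z ^ length (?h t)) *
        (Wt s G (fst t) * (loop_weight s m (fst (snd t)) * (Wt s G (snd (snd t)) * Wt s G [m])))"
      by (intro mult_left_mono Wt_loop_split) auto
    moreover have "ennreal (z ^ length (?h t)) = ennreal (z ^ length (fst t)) * (ennreal (z ^ length (fst (snd t))) * (ennreal z * ennreal (z ^ length (snd (snd t)))))"
      using z by (simp add: ennreal_mult''[symmetric] power_add[symmetric] mult_ac)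
    ultimately show "?f (?h t) \<le> ?f (fst t) * (?l (fst (snd t)) * (?c * ?f (snd (snd t))))"
      by (simp only: mult_ac)
  qed auto
  also have "\<dots> \<le> genfun s z U * (\<Sum>\<^sub>\<infinity>t\<in>?Lo \<times> ?LU. ?l (fst t) * (?c * ?f (snd t)))"
    unfolding genfun_def by (rule infsum_ennreal_prod_le[where g = "\<lambda>t. ?l (fst t) * (?c * ?f (snd t))"])
  also have "\<dots> \<le> genfun s z U * (infsum ?l ?Lo * (\<Sum>\<^sub>\<infinity>w\<in>?LU. ?c * ?f w))"
    by (intro mult_left_mono infsum_ennreal_prod_le) auto
  also have "\<dots> \<le> genfun s z U * (infsum ?l ?Lo * (?c * genfun s z U))"
    unfolding genfun_def by (intro mult_left_mono infsum_ennreal_cmult_le) auto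
  finally have "genfun s z (insert m U) \<le> genfun s z U + genfun s z U * (infsum ?l ?Lo * (?c * genfun s z U))"
    by (simp add: add_left_mono)
  also have "\<dots> < \<infinity>" using loop U W by (simp add: ennreal_mult_less_top)
  finally show ?thesis .
qed

text \<open>Comparison with a geometric series: by submultiplicativity every further letter
  multiplies the total weight by at most 1/2.\<close>

lemma genfun_small:
  assumes z: "0 \<le> z" and U: "(\<Sum>\<^sub>\<infinity>v\<in>U. ennreal z * Wt s G [v]) \<le> ennreal (1/2)"
  shows "genfun s z U < \<infinity>"
proof -
  let ?f = "\<lambda>w. ennreal (z ^ length w) * Wt s G w"
  let ?L = "\<lambda>n. {w\<in>{w\<in>lists U. walk G w}. length w = n}"
  have len: "infsum ?f (?L n) \<le> ennreal ((1/2) ^ n)" for n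
  proof (induction n)
    case 0
    have "infsum ?f (?L 0) \<le> infsum ?f {[]}" by (rule infsum_ennreal_mono) auto
    then show ?case by (simp add: Wt_def)
  next
    case (Suc n)
    have "?L (Suc n) \<subseteq> (\<lambda>t. fst t # snd t) ` (U \<times> ?L n)"
    proof
      fix w assume w: "w \<in> ?L (Suc n)"
      then obtain v w' where vw: "w = v # w'" by (cases w) auto
      then have "walk G w'" using w by (cases w') auto
      then show "w \<in> (\<lambda>t. fst t # snd t) ` (U \<times> ?L n)"
        using w vw by (intro image_eqI[of _ _ "(v, w')"]) auto
    qed
    then have "infsum ?f (?L (Suc n)) \<le> infsum ?f ((\<lambda>t. fst t # snd t) ` (U \<times> ?L n))"
      by (rule infsum_ennreal_mono) simp
    also have "\<dots> \<le> (\<Sum>\<^sub>\<infinity>t\<in>U \<times> ?L n. ?f (fst t # snd t))" by (rule infsum_ennreal_image_le)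
    also have "\<dots> \<le> (\<Sum>\<^sub>\<infinity>t\<in>U \<times> ?L n. (ennreal z * Wt s G [fst t]) * ?f (snd t))"
    proof (rule infsum_ennreal_mono)
      fix t
      have "Wt s G (fst t # snd t) \<le> Wt s G [fst t] * Wt s G (snd t)" using Wt_append[of s "[fst t]" "snd t"] by simp
      then have "?f (fst t # snd t) \<le> ennreal (z ^ length (fst t # snd t)) * (Wt s G [fst t] * Wt s G (snd t))"
        by (intro mult_left_mono) auto
      moreover have "ennreal (z ^ length (fst t # snd t)) = ennreal z * ennreal (z ^ length (snd t))"
        using z by (simp add: ennreal_mult'')
      ultimately show "?f (fst t # snd t) \<le> (ennreal z * Wt s G [fst t]) * ?f (snd t)" by (simp only: mult_ac)
    qed simp
    also have "\<dots> \<le> (\<Sum>\<^sub>\<infinity>v\<in>U. ennreal z * Wt s G [v]) * infsum ?f (?L n)" by (rule infsum_ennreal_prod_le)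
    also have "\<dots> \<le> ennreal (1/2) * ennreal ((1/2) ^ n)" by (intro mult_mono U Suc) auto
    also have "\<dots> = ennreal ((1/2) ^ Suc n)" by (subst ennreal_mult''[symmetric]) simp_all
    finally show ?case .
  qed
  have "genfun s z U \<le> (\<Sum>n. infsum ?f (?L n))" unfolding genfun_def by (rule infsum_ennreal_layers_le)
  also have "\<dots> \<le> (\<Sum>n. ennreal ((1/2) ^ n))" by (intro suminf_le len) auto
  also have "\<dots> = ennreal (\<Sum>n. (1/2) ^ n)" by (intro suminf_ennreal2 summable_geometric) auto
  also have "\<dots> < \<infinity>" by simp
  finally show ?thesis .
qed

text \<open>If the loop sums at exponent \<open>t\<close> were bounded, those at \<open>s\<close>
  would decay exponentially in the loop length, and the loop series in \<open>genfun_insert\<close>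
  would converge at every vertex for one common \<open>z > 1\<close>. An alphabet of small total
  weight satisfies \<open>genfun_small\<close>; the finitely many missing letters are then inserted
  one at a time without changing \<open>z\<close>.\<close>

theorem heavy_loops:
  assumes P: "has_pressure G (\<lambda>\<omega>. s * pot G \<omega>) 0" and Z1: "Zsum s G 1 < \<infinity>" and t: "t < s" "0 \<le> s"
  obtains v n L where "v \<in> verts G" "0 < n" "finite L" "L \<subseteq> loops G v n"
    "C < (\<Sum>l\<in>L. coc (dn G) G (l @ [v]) (base_point v) powr t)"
proof (rule ccontr)
  note wit = that
  assume neg: "\<not> thesis"
  have bound: "(\<Sum>l\<in>L. coc (dn G) G (l @ [v]) (base_point v) powr t) \<le> C"
    if L: "v \<in> verts G" "0 < n" "finite L" "L \<subseteq> loops G v n" for v n L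
    using wit[OF L] neg by (meson not_less)
  \<comment> \<open>On loops of length n the step from \<open>t\<close> to \<open>s\<close> gains
    \<theta>^(2 n): one factor \<theta>^n pays for z^n, the other makes the loop series
    converge.\<close>
  define \<theta> where "\<theta> = r powr ((s - t) / 2)"
  have \<theta>: "0 < \<theta>" "\<theta> < 1" using r t powr_less_mono2[of "(s - t) / 2" r 1] by (auto simp: \<theta>_def)
  define z where "z = 1 / \<theta>"
  have z: "1 < z" using \<theta> by (simp add: z_def)
  define K where "K = dist_const (mesh * g) powr s"
  have K: "1 \<le> K" using dist_const_ge_1[of "mesh * g"] t by (simp add: K_def ge_one_powr_ge_zero)
  define B where "B = K * max C 1"
  have loop: "(\<Sum>\<^sub>\<infinity>l\<in>{l. l = [] \<or> hd l = m \<and> walk G (l @ [m])}. ennreal (z ^ length l) * loop_weight s m l) < \<infinity>"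
    if m: "m \<in> verts G" for m
  proof -
    let ?Lo = "{l. l = [] \<or> hd l = m \<and> walk G (l @ [m])}"
    let ?l = "\<lambda>l. ennreal (z ^ length l) * loop_weight s m l"
    have layer: "infsum ?l {l\<in>?Lo. length l = n} \<le> ennreal (B * \<theta> ^ n)" for n
    proof (rule infsum_ennreal_leI)
      fix F assume F: "finite F" "F \<subseteq> {l\<in>?Lo. length l = n}"
      have lb: "?l l \<le> ennreal (K * \<theta> ^ n * coc (dn G) G (l @ [m]) (base_point m) powr t)" if l: "l \<in> F" for l
      proof -
        have wl: "walk G (l @ [m])" "length l = n" using F l m by auto
        let ?c = "coc (dn G) G (l @ [m]) (base_point m)"
        have "loop_weight s m l \<le> ennreal (K * ?c powr s)"
          unfolding loop_weight_def
        proof (intro SUP_least ennreal_leI)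
          fix x assume x: "x \<in> cell G m"
          have "coc (dn G) G (l @ [m]) x powr s \<le> (dist_const (mesh * g) * ?c) powr s"
            using t wl x base_point[OF m] by (intro powr_mono2 coc_cell coc_dn_nonneg) auto
          then show "coc (dn G) G (l @ [m]) x powr s \<le> K * ?c powr s"
            using dist_const_ge_1[of "mesh * g"] by (simp add: K_def powr_mult coc_dn_nonneg)
        qed
        then have "?l l \<le> ennreal (z ^ n) * ennreal (K * ?c powr s)" using wl by (intro mult_mono) auto
        also have "\<dots> = ennreal (z ^ n * (K * ?c powr s))" using K by (simp add: ennreal_mult''[symmetric])
        also have "\<dots> \<le> ennreal (K * \<theta> ^ n * ?c powr t)"
        proof (rule ennreal_leI)
          have "?c \<le> r ^ n" using coc_le_power[OF wl(1), of "base_point m"] wl(2) cell_nbhd[OF m base_point[OF m]] by simp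
          then have "?c powr (s - t) \<le> (r ^ n) powr (s - t)" using t by (intro powr_mono2 coc_dn_nonneg) auto
          also have "\<dots> = (\<theta> * \<theta>) ^ n"
            using r by (simp add: \<theta>_def powr_add[symmetric] powr_power powr_realpow[symmetric] powr_powr mult.commute)
          finally have "?c powr (s - t) * ?c powr t \<le> (\<theta> * \<theta>) ^ n * ?c powr t" by (intro mult_right_mono) auto
          then have "?c powr s \<le> (\<theta> * \<theta>) ^ n * ?c powr t" by (simp add: powr_add[symmetric])
          then have "z ^ n * (K * ?c powr s) \<le> z ^ n * (K * ((\<theta> * \<theta>) ^ n * ?c powr t))"
            using z K by (intro mult_left_mono) auto
          also have "\<dots> = (z * \<theta>) ^ n * (K * \<theta> ^ n * ?c powr t)" by (simp add: power_mult_distrib mult_ac)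
          also have "z * \<theta> = 1" using \<theta> by (simp add: z_def)
          finally show "z ^ n * (K * ?c powr s) \<le> K * \<theta> ^ n * ?c powr t" by simp
        qed
        finally show ?thesis .
      qed
      have "sum ?l F \<le> (\<Sum>l\<in>F. ennreal (K * \<theta> ^ n * coc (dn G) G (l @ [m]) (base_point m) powr t))"
        by (intro sum_mono lb)
      also have "\<dots> = ennreal (K * \<theta> ^ n * (\<Sum>l\<in>F. coc (dn G) G (l @ [m]) (base_point m) powr t))"
        using K \<theta> by (simp add: sum_distrib_left)
      also have "\<dots> \<le> ennreal (B * \<theta> ^ n)"
      proof (rule ennreal_leI)
        \<comment> \<open>The maximum with 1 covers \<open>n = 0\<close>, where the empty loop has
          weight 1 and does not belong to \<open>loops\<close>.\<close>
        have "(\<Sum>l\<in>F. coc (dn G) G (l @ [m]) (base_point m) powr t) \<le> max C 1"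
        proof (cases "n = 0")
          case True
          then have "F \<subseteq> {[]}" using F by auto
          then have "F = {} \<or> F = {[]}" by blast
          then show ?thesis by auto
        next
          case False
          then have "F \<subseteq> loops G m n" using F by (auto simp: loops_def)
          then show ?thesis using bound[OF m _ F(1), of n] False by simp
        qed
        then have "K * \<theta> ^ n * (\<Sum>l\<in>F. coc (dn G) G (l @ [m]) (base_point m) powr t) \<le> K * \<theta> ^ n * max C 1"
          using K \<theta> by (intro mult_left_mono) auto
        then show "K * \<theta> ^ n * (\<Sum>l\<in>F. coc (dn G) G (l @ [m]) (base_point m) powr t) \<le> B * \<theta> ^ n"
          by (simp add: B_def mult_ac)
      qed
      finally show "sum ?l F \<le> ennreal (B * \<theta> ^ n)" .
    qed
    have B0: "0 \<le> B" using K by (simp add: B_def)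
    have "infsum ?l ?Lo \<le> (\<Sum>n. infsum ?l {l\<in>?Lo. length l = n})" by (rule infsum_ennreal_layers_le)
    also have "\<dots> \<le> (\<Sum>n. ennreal (B * \<theta> ^ n))" by (intro suminf_le layer) auto
    also have "\<dots> = ennreal (\<Sum>n. B * \<theta> ^ n)"
      using \<theta> B0 by (intro suminf_ennreal2 summable_mult summable_geometric) auto
    also have "\<dots> < \<infinity>" by simp
    finally show ?thesis .
  qed
  have W: "Wt s G [v] < \<infinity>" for v using Wt_le_1[of s "[v]"] t by (simp add: order_le_less_trans[of _ 1])
  have sv: "(\<Sum>\<^sub>\<infinity>v\<in>verts G. Wt s G [v]) < \<infinity>"
  proof -
    have "(\<Sum>\<^sub>\<infinity>v\<in>verts G. Wt s G [v]) \<le> Zsum s G 1"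
      unfolding Zsum_def by (rule infsum_ennreal_inj_le) (auto simp: inj_on_def)
    then show ?thesis using Z1 by order
  qed
  \<comment> \<open>Each letter carries a factor \<open>z\<close>, so the tail must be at most
    \<open>1 / (2 * z)\<close> for \<open>genfun_small\<close> to apply.\<close>
  obtain M where M: "finite M" "M \<subseteq> verts G" "(\<Sum>\<^sub>\<infinity>v\<in>verts G - M. Wt s G [v]) \<le> ennreal (1 / (2 * z))"
    using infsum_ennreal_tail[OF sv, of "ennreal (1 / (2 * z))"] z by auto
  have base: "genfun s z (verts G - M) < \<infinity>"
  proof (rule genfun_small)
    show "0 \<le> z" using z by simp
    have "(\<Sum>\<^sub>\<infinity>v\<in>verts G - M. ennreal z * Wt s G [v]) \<le> ennreal z * ennreal (1 / (2 * z))"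
      by (rule order_trans[OF infsum_ennreal_cmult_le]) (intro mult_left_mono M; simp)
    also have "\<dots> = ennreal (1/2)" using z by (simp add: ennreal_mult''[symmetric])
    finally show "(\<Sum>\<^sub>\<infinity>v\<in>verts G - M. ennreal z * Wt s G [v]) \<le> ennreal (1/2)" .
  qed
  have "genfun s z ((verts G - M) \<union> M') < \<infinity>" if "finite M'" "M' \<subseteq> verts G" for M'
    using that
  proof (induction M')
    case (insert m M')
    then have "genfun s z (insert m ((verts G - M) \<union> M')) < \<infinity>"
      using z by (intro genfun_insert loop W) auto
    then show ?case by simp
  qed (use base in simp)
  from this[OF M(1,2)] have fin: "genfun s z (verts G) < \<infinity>" using M(2) by (simp add: Un_absorb2)
  obtain b where b: "genfun s z (verts G) = ennreal b" "0 \<le> b" using fin by (cases "genfun s z (verts G)") auto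
  have "partition_sum G (\<lambda>\<omega>. s * pot G \<omega>) n \<le> ennreal ((b + 1) * \<theta> ^ n)" if n: "0 < n" for n
  proof -
    have "Zsum s G n = infsum (Wt s G) {w. length w = n \<and> set w \<subseteq> verts G \<and> walk G w}"
      unfolding Zsum_def by (rule infsum_cong_neutral) (auto simp: Wt_def)
    also have "\<dots> \<le> (\<Sum>\<^sub>\<infinity>w\<in>{w\<in>lists (verts G). walk G w}. ennreal (\<theta> ^ n) * (ennreal (z ^ length w) * Wt s G w))"
    proof (rule infsum_ennreal_mono)
      fix w assume "w \<in> {w. length w = n \<and> set w \<subseteq> verts G \<and> walk G w}"
      then have "ennreal (\<theta> ^ n) * (ennreal (z ^ length w) * Wt s G w) = ennreal ((\<theta> * z) ^ n) * Wt s G w"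
        using \<theta> z by (simp add: mult.assoc[symmetric] ennreal_mult''[symmetric] power_mult_distrib)
      also have "\<theta> * z = 1" using \<theta> by (simp add: z_def)
      finally show "Wt s G w \<le> ennreal (\<theta> ^ n) * (ennreal (z ^ length w) * Wt s G w)" by simp
    qed (auto simp: in_lists_conv_set)
    also have "\<dots> \<le> ennreal (\<theta> ^ n) * genfun s z (verts G)" unfolding genfun_def by (rule infsum_ennreal_cmult_le)
    also have "\<dots> = ennreal (\<theta> ^ n * b)" using b \<theta> by (simp add: ennreal_mult''[symmetric])
    also have "\<dots> \<le> ennreal ((b + 1) * \<theta> ^ n)" using \<theta> by (intro ennreal_leI) (simp add: algebra_simps)
    finally show ?thesis using partition_sum_le_Zsum[OF n, of s] by order
  qed
  then have "\<forall>\<^sub>F n in sequentially. partition_sum G (\<lambda>\<omega>. s * pot G \<omega>) n \<le> ennreal ((b + 1) * \<theta> ^ n)"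
    by (rule eventually_mono[OF eventually_gt_at_top[of 0]])
  then show False using has_pressure_0_not_decay[OF P _ \<theta>] b(2) by (meson add_nonneg_pos zero_less_one)
qed

end

section \<open>Local lower Lipschitz bounds\<close>

text \<open>A lower bound for the derivative controls distances from below only locally, since an
  injective map may bring distant points close together.\<close>

definition loc_lower :: "('a::metric_space \<Rightarrow> 'b::metric_space) \<Rightarrow> 'a \<Rightarrow> real \<Rightarrow> bool" where
  "loc_lower f x a \<longleftrightarrow> (\<exists>c>0. \<forall>y\<in>ball x c. \<forall>z\<in>ball x c. a * dist y z \<le> dist (f y) (f z))"

lemma loc_lower_compose:
  assumes "loc_lower f (h x) a" "loc_lower h x b" "continuous (at x) h" "0 \<le> a"
  shows "loc_lower (\<lambda>x. f (h x)) x (a * b)"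
proof -
  obtain c1 where c1: "0 < c1" "\<And>y z. y \<in> ball (h x) c1 \<Longrightarrow> z \<in> ball (h x) c1 \<Longrightarrow> a * dist y z \<le> dist (f y) (f z)"
    using assms(1) unfolding loc_lower_def by blast
  obtain c2 where c2: "0 < c2" "\<And>y z. y \<in> ball x c2 \<Longrightarrow> z \<in> ball x c2 \<Longrightarrow> b * dist y z \<le> dist (h y) (h z)"
    using assms(2) unfolding loc_lower_def by blast
  obtain c3 where c3: "0 < c3" "h ` ball x c3 \<subseteq> ball (h x) c1"
    using assms(3) c1(1) unfolding continuous_at_ball by blast
  have "a * b * dist y z \<le> dist (f (h y)) (f (h z))" if "y \<in> ball x (min c2 c3)" "z \<in> ball x (min c2 c3)" for y z
  proof -
    have "a * (b * dist y z) \<le> a * dist (h y) (h z)" using that assms(4) by (intro mult_left_mono c2) auto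
    also have "\<dots> \<le> dist (f (h y)) (f (h z))"
    proof (rule c1(2))
      show "h y \<in> ball (h x) c1" "h z \<in> ball (h x) c1" using that c3(2) by (simp_all add: image_subset_iff)
    qed
    finally show ?thesis by (simp add: mult.assoc)
  qed
  then show ?thesis unfolding loc_lower_def using c2(1) c3(1) by (intro exI[of _ "min c2 c3"]) auto
qed

text \<open>A Lebesgue number of the cover by the local balls takes care of close pairs. The other
  pairs form a compact set, on which injectivity keeps the images a positive distance apart; this
  provides \<tau>.\<close>

lemma loc_lower_compact:
  fixes f :: "'a::euclidean_space \<Rightarrow> 'a"
  assumes J: "compact J" and f: "continuous_on J f" "inj_on f J" and a: "\<And>x. x \<in> J \<Longrightarrow> loc_lower f x a"
  obtains \<tau> where "0 < \<tau>" "\<And>x y. x \<in> J \<Longrightarrow> y \<in> J \<Longrightarrow> min (a * dist x y) \<tau> \<le> dist (f x) (f y)"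
proof -
  define c where "c x = (SOME c. 0 < c \<and> (\<forall>y\<in>ball x c. \<forall>z\<in>ball x c. a * dist y z \<le> dist (f y) (f z)))" for x
  have c: "0 < c x \<and> (\<forall>y\<in>ball x (c x). \<forall>z\<in>ball x (c x). a * dist y z \<le> dist (f y) (f z))" if "x \<in> J" for x
    unfolding c_def by (rule someI_ex) (use a[OF that] in \<open>simp add: loc_lower_def\<close>)
  have "J \<subseteq> \<Union>((\<lambda>x. ball x (c x)) ` J)" using c by auto
  then obtain e where e: "0 < e" "\<And>x. x \<in> J \<Longrightarrow> \<exists>B\<in>(\<lambda>x. ball x (c x)) ` J. ball x e \<subseteq> B"
    by (rule Heine_Borel_lemma[OF J, of "(\<lambda>x. ball x (c x)) ` J"]) auto
  have near: "a * dist x y \<le> dist (f x) (f y)" if xy: "x \<in> J" "y \<in> J" "dist x y < e" for x y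
  proof -
    obtain w where w: "w \<in> J" "ball x e \<subseteq> ball w (c w)" using e(2)[OF xy(1)] by blast
    then have "x \<in> ball w (c w)" "y \<in> ball w (c w)" using xy e(1) by (auto simp: subset_iff)
    then show ?thesis using c[OF w(1)] by blast
  qed
  let ?P = "(J \<times> J) \<inter> {z. e \<le> dist (fst z) (snd z)}"
  show thesis
  proof (cases "?P = {}")
    case True
    then have "dist x y < e" if "x \<in> J" "y \<in> J" for x y using that by (force simp: not_le[symmetric])
    then have "min (a * dist x y) 1 \<le> dist (f x) (f y)" if "x \<in> J" "y \<in> J" for x y
      using near[OF that] that by (simp add: min.coboundedI1)
    then show thesis using that[of 1] by simp
  next
    case False
    have "closed {z :: 'a \<times> 'a. e \<le> dist (fst z) (snd z)}"
      by (intro closed_Collect_le continuous_intros)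
    then have "compact ?P" using J by (intro compact_Int_closed compact_Times)
    moreover have "continuous_on ?P (\<lambda>z. dist (f (fst z)) (f (snd z)))"
      by (intro continuous_on_dist continuous_on_compose2[OF f(1)] continuous_intros) auto
    ultimately obtain p where p: "p \<in> ?P" "\<And>z. z \<in> ?P \<Longrightarrow> dist (f (fst p)) (f (snd p)) \<le> dist (f (fst z)) (f (snd z))"
      using continuous_attains_inf[OF _ False] by blast
    have "fst p \<noteq> snd p" using p(1) e(1) by auto
    then have "0 < dist (f (fst p)) (f (snd p))" using p(1) f(2) by (auto dest: inj_onD)
    moreover have "min (a * dist x y) (dist (f (fst p)) (f (snd p))) \<le> dist (f x) (f y)" if "x \<in> J" "y \<in> J" for x y
    proof (cases "dist x y < e")
      case True
      then show ?thesis using near[OF that] by (simp add: min.coboundedI1)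
    next
      case False
      then show ?thesis using p(2)[of "(x, y)"] that by (simp add: min.coboundedI2)
    qed
    ultimately show thesis by (rule that)
  qed
qed

lemma finite_uniform_pos:
  fixes P :: "'i \<Rightarrow> real \<Rightarrow> bool"
  assumes "finite I" "\<And>i. i \<in> I \<Longrightarrow> \<exists>d>0. P i d" "\<And>i d d'. P i d \<Longrightarrow> 0 < d' \<Longrightarrow> d' \<le> d \<Longrightarrow> P i d'"
  obtains d where "0 < d" "\<And>i. i \<in> I \<Longrightarrow> P i d"
proof -
  obtain D where D: "\<And>i. i \<in> I \<Longrightarrow> 0 < D i \<and> P i (D i)" using assms(2) by metis
  define d where "d = Min (insert 1 (D ` I))"
  have "0 < d" unfolding d_def using assms(1) D by (subst Min_gr_iff) auto
  moreover have "P i d" if "i \<in> I" for i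
    by (rule assms(3)[OF conjunct2[OF D[OF that]] \<open>0 < d\<close>]) (use assms(1) that in \<open>simp add: d_def\<close>)
  ultimately show thesis by (rule that)
qed

section \<open>Inscribed balls\<close>

text \<open>Let \<open>m\<close> be the distance from \<open>f x0\<close> to the image of the
  sphere. The ball of radius \<open>m\<close> lies in the image, and there the inverse is Lipschitz
  with constant 1 / a. Along the segment from \<open>f x0\<close> to the nearest image
  \<open>f y1\<close> of the sphere the inverse travels from \<open>x0\<close> to \<open>y1\<close>,
  hence \<rho> \<le> m / a.\<close>

lemma ball_subset_image:
  fixes f :: "'a::euclidean_space \<Rightarrow> 'a"
  assumes cont: "continuous_on (cball x0 \<rho>) f" and inj: "inj_on f (cball x0 \<rho>)" and \<rho>: "0 < \<rho>" and a: "0 < a"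
    and der: "\<And>y. y \<in> ball x0 \<rho> \<Longrightarrow> \<exists>D. (f has_derivative D) (at y) \<and> (\<forall>h. a * norm h \<le> norm (D h))"
  shows "ball (f x0) (a * \<rho>) \<subseteq> f ` ball x0 \<rho>"
proof -
  obtain h :: 'a where h: "norm h = 1" by (rule unit_vector_exists)
  then have "x0 + \<rho> *\<^sub>R h \<in> sphere x0 \<rho>" using \<rho> by (simp add: dist_norm)
  then have "sphere x0 \<rho> \<noteq> {}" by blast
  moreover have "continuous_on (sphere x0 \<rho>) (\<lambda>y. dist (f x0) (f y))"
    using continuous_on_subset[OF cont sphere_cball] by (intro continuous_on_dist continuous_on_const)
  ultimately obtain y1 where y1: "y1 \<in> sphere x0 \<rho>" "\<And>y. y \<in> sphere x0 \<rho> \<Longrightarrow> dist (f x0) (f y1) \<le> dist (f x0) (f y)"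
    using continuous_attains_inf[OF compact_sphere, of x0 \<rho> "\<lambda>y. dist (f x0) (f y)"] by blast
  define m where "m = dist (f x0) (f y1)"
  have op: "open (f ` ball x0 \<rho>)"
    by (intro invariance_of_domain continuous_on_subset[OF cont] inj_on_subset[OF inj]) auto
  \<comment> \<open>A point of the ball outside the image would produce a frontier point of the
    image at distance below \<open>m\<close>; but frontier points come from the sphere.\<close>
  have sub: "ball (f x0) m \<subseteq> f ` ball x0 \<rho>"
  proof (rule ccontr)
    assume "\<not> ?thesis"
    then have "ball (f x0) m - f ` ball x0 \<rho> \<noteq> {}" by blast
    moreover from this have "f x0 \<in> ball (f x0) m" by (auto intro: le_less_trans[OF zero_le_dist])
    moreover have "f x0 \<in> f ` ball x0 \<rho>" using \<rho> by simp
    ultimately have "ball (f x0) m \<inter> f ` ball x0 \<rho> \<noteq> {}" "ball (f x0) m - f ` ball x0 \<rho> \<noteq> {}" by blast+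
    then have "ball (f x0) m \<inter> frontier (f ` ball x0 \<rho>) \<noteq> {}"
      by (intro connected_Int_frontier) auto
    then obtain w where w: "dist (f x0) w < m" "w \<in> frontier (f ` ball x0 \<rho>)" by auto
    have "closed (f ` cball x0 \<rho>)" by (intro compact_imp_closed compact_continuous_image cont) auto
    then have "closure (f ` ball x0 \<rho>) \<subseteq> f ` cball x0 \<rho>" by (intro closure_minimal) auto
    then have "w \<in> f ` cball x0 \<rho>" "w \<notin> f ` ball x0 \<rho>"
      using w(2) op by (auto simp: frontier_def interior_open)
    then obtain y where "y \<in> sphere x0 \<rho>" "w = f y" by (auto simp: order_le_less)
    then show False using y1(2)[of y] w(1) by (simp add: m_def)
  qed
  define k where "k = inv_into (cball x0 \<rho>) f"
  have kf: "k (f x) = x" if "x \<in> cball x0 \<rho>" for x unfolding k_def using inj that by (rule inv_into_f_f)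
  have fk: "f (k z) = z \<and> k z \<in> ball x0 \<rho>" if z: "z \<in> ball (f x0) m" for z
  proof -
    obtain x where "x \<in> ball x0 \<rho>" "z = f x" using sub z by blast
    then show ?thesis using kf[of x] by auto
  qed
  have kcont: "continuous_on (f ` cball x0 \<rho>) k"
    by (rule continuous_on_inv[OF cont]) (auto simp: kf)
  have kder: "\<exists>E. (k has_derivative E) (at z) \<and> (\<forall>h. norm (E h) \<le> (1 / a) * norm h)" if z: "z \<in> ball (f x0) m" for z
  proof -
    obtain D where D: "(f has_derivative D) (at (k z))" "\<And>h. a * norm h \<le> norm (D h)" using der fk[OF z] by blast
    have lin: "linear D" using D(1) by (rule has_derivative_linear)
    have "inj D" unfolding linear_injective_0[OF lin]
    proof (intro allI impI)
      fix h assume "D h = 0"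
      then have "a * norm h \<le> 0" using D(2)[of h] by simp
      then show "h = 0" using a by (simp add: mult_le_0_iff)
    qed
    then obtain E where E: "linear E" "E \<circ> D = id" using linear_injective_left_inverse[OF lin] by blast
    then have DE: "D \<circ> E = id" using linear_inverse_left[OF lin E(1)] by simp
    have kc: "continuous (at z) k"
    proof -
      have "continuous_on (ball (f x0) m) k"
        using kcont by (rule continuous_on_subset) (use sub ball_subset_cball[of x0 \<rho>] in blast)
      then show ?thesis using z by (simp add: continuous_on_eq_continuous_at)
    qed
    have "(k has_derivative E) (at z)"
      by (rule has_derivative_inverse_basic[where f = f and f' = D and g = k and T = "ball (f x0) m"])
        (use D(1) E fk kc z in \<open>simp_all add: linear_conv_bounded_linear\<close>)
    moreover have "norm (E h) \<le> (1 / a) * norm h" for h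
      using D(2)[of "E h"] fun_cong[OF DE, of h] a by (simp add: field_simps)
    ultimately show ?thesis by blast
  qed
  then obtain E where E: "\<And>z. z \<in> ball (f x0) m \<Longrightarrow> (k has_derivative E z) (at z)"
    "\<And>z h. z \<in> ball (f x0) m \<Longrightarrow> norm (E z h) \<le> (1 / a) * norm h" by metis
  have "a * \<rho> \<le> m"
  proof (rule ccontr)
    assume "\<not> a * \<rho> \<le> m"
    then have lt: "m < a * \<rho>" by simp
    have y1c: "y1 \<in> cball x0 \<rho>" "x0 \<in> cball x0 \<rho>" "dist x0 y1 = \<rho>" using y1(1) \<rho> by auto
    then have "y1 \<noteq> x0" using \<rho> by auto
    then have m0: "0 < m" unfolding m_def using inj y1c by (auto dest: inj_onD)
    let ?s = "\<lambda>t. f x0 + t *\<^sub>R (f y1 - f x0)"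
    have seg: "?s t \<in> ball (f x0) m" if "0 \<le> t" "t < 1" for t
      using that m0 by (simp add: dist_norm m_def norm_minus_commute mult_less_cancel_right2)
    have le: "dist (k (?s t)) x0 \<le> m / a" if t: "0 \<le> t" "t < 1" for t
    proof -
      have "norm (k (?s t) - k (f x0)) \<le> (1 / a) * norm (?s t - f x0)"
        by (rule differentiable_bound[OF convex_ball, of "f x0" m k E])
          (use E seg[OF t] m0 a in \<open>auto intro: has_derivative_at_withinI onorm_le\<close>)
      also have "norm (?s t - f x0) \<le> m" using seg[OF t] by (simp add: dist_norm norm_minus_commute)
      finally show ?thesis using kf[OF y1c(2)] a by (simp add: dist_norm divide_right_mono)
    qed
    \<comment> \<open>\<open>f y1\<close> lies on the boundary of the ball on which the Lipschitz
      bound holds, so it is approached from inside along the segment.\<close>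
    have "(\<lambda>i. ?s (1 - 1 / real (Suc i))) \<longlonglongrightarrow> ?s (1 - 0)"
      by (intro tendsto_intros LIMSEQ_Suc[OF lim_1_over_n])
    moreover have "?s (1 - 1 / real (Suc i)) \<in> f ` cball x0 \<rho>" for i
    proof -
      have "?s (1 - 1 / real (Suc i)) \<in> ball (f x0) m" by (rule seg) (auto simp: field_simps)
      then show ?thesis using sub ball_subset_cball[of x0 \<rho>] by blast
    qed
    ultimately have "(\<lambda>i. k (?s (1 - 1 / real (Suc i)))) \<longlonglongrightarrow> k (?s (1 - 0))"
      using y1c(1) by (intro continuous_on_tendsto_compose[OF kcont]) auto
    then have "(\<lambda>i. dist (k (?s (1 - 1 / real (Suc i)))) x0) \<longlonglongrightarrow> dist (k (f y1)) x0"
      by (intro tendsto_intros) simp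
    moreover have "dist (k (?s (1 - 1 / real (Suc i)))) x0 \<le> m / a" for i
      by (rule le) (auto simp: field_simps)
    ultimately have "dist (k (f y1)) x0 \<le> m / a" by (intro LIMSEQ_le_const2) auto
    then have "\<rho> \<le> m / a" using kf[OF y1c(1)] y1c(3) by (simp add: dist_commute)
    then show False using lt a by (simp add: field_simps)
  qed
  then have "ball (f x0) (a * \<rho>) \<subseteq> ball (f x0) m" by auto
  with sub show ?thesis by blast
qed

lemma card_disjoint_balls_le:
  fixes c :: "'i \<Rightarrow> 'a::euclidean_space"
  assumes F: "finite F" and disj: "\<And>i j. i \<in> F \<Longrightarrow> j \<in> F \<Longrightarrow> i \<noteq> j \<Longrightarrow> ball (c i) s \<inter> ball (c j) s = {}"
    and sub: "\<And>i. i \<in> F \<Longrightarrow> ball (c i) s \<subseteq> ball y R" and s: "0 < s" and R: "0 \<le> R"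
  shows "real (card F) \<le> (R / s) ^ DIM('a)"
proof -
  let ?u = "unit_ball_vol (real DIM('a))"
  have "(\<Sum>i\<in>F. emeasure lborel (ball (c i) s)) = emeasure lborel (\<Union>i\<in>F. ball (c i) s)"
    using F disj by (intro sum_emeasure) (auto simp: disjoint_family_on_def)
  also have "\<dots> \<le> emeasure lborel (ball y R)" using sub by (intro emeasure_mono) auto
  finally have "(\<Sum>i\<in>F. ennreal (?u * s ^ DIM('a))) \<le> ennreal (?u * R ^ DIM('a))"
    using s R by (simp add: emeasure_ball)
  then have "ennreal (real (card F) * (?u * s ^ DIM('a))) \<le> ennreal (?u * R ^ DIM('a))"
    by (simp add: ennreal_mult' ennreal_of_nat_eq_real_of_nat)
  then have "real (card F) * (?u * s ^ DIM('a)) \<le> ?u * R ^ DIM('a)"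
    using R by (subst (asm) ennreal_le_iff) auto
  then have "?u * (real (card F) * s ^ DIM('a)) \<le> ?u * R ^ DIM('a)" by (simp add: mult_ac)
  then have "real (card F) * s ^ DIM('a) \<le> R ^ DIM('a)"
    using unit_ball_vol_pos[of "real DIM('a)"] by (simp only: mult_le_cancel_left_pos)
  then show ?thesis using s by (simp add: power_divide field_simps)
qed

section \<open>Lower bound from a finite family of loops\<close>

lemma walk_nth: "walk G p \<Longrightarrow> Suc i < length p \<Longrightarrow> (p ! i, p ! Suc i) \<in> edges G"
proof (induction p arbitrary: i rule: induct_list012)
  case (3 v u p)
  then show ?case by (cases i) auto
qed auto

lemma pre_nth: "pre p \<omega> i = (if i < length p then p ! i else \<omega> (i - length p))"
  by (induction p arbitrary: i) (auto split: nat.split)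

context gifs
begin

text \<open>At the first edge in which the walks differ the images are disjoint, and injectivity
  carries this back through the common beginning. Equal lengths and equal last vertices ensure that
  different walks differ in some edge. The family \<open>A\<close> stands for coded points or for
  interiors of cells.\<close>

lemma walks_disjoint:
  fixes A :: "'v \<Rightarrow> 'a set"
  assumes A: "\<And>u. u \<in> verts G \<Longrightarrow> A u \<subseteq> nbhd G u" "\<And>v u x. (v, u) \<in> edges G \<Longrightarrow> x \<in> A u \<Longrightarrow> emap G (v, u) x \<in> A v"
    and disj: "\<And>e e'. e \<in> edges G \<Longrightarrow> e' \<in> edges G \<Longrightarrow> e \<noteq> e' \<Longrightarrow> emap G e ` A (snd e) \<inter> emap G e' ` A (snd e') = {}"
  shows "walk G p \<Longrightarrow> walk G q \<Longrightarrow> length p = length q \<Longrightarrow> p \<noteq> [] \<Longrightarrow> last p = last q \<Longrightarrow> p \<noteq> q \<Longrightarrow>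
    x \<in> A (last p) \<Longrightarrow> y \<in> A (last q) \<Longrightarrow> pmap G p x \<noteq> pmap G q y"
proof (induction p arbitrary: q rule: induct_list012)
  case (2 v)
  then show ?case by (cases q) auto
next
  case (3 v u p)
  have inA: "pmap G p x \<in> A (hd p)" if "walk G p" "p \<noteq> []" "x \<in> A (last p)" for p x
    using that by (induction p rule: induct_list012) (auto intro: A(2))
  obtain v' u' q' where q: "q = v' # u' # q'" using 3 by (metis (no_types, lifting) length_Suc_conv)
  let ?x = "pmap G (u # p) x" and ?y = "pmap G (u' # q') y"
  have m: "?x \<in> A u" "?y \<in> A u'" using inA[of "u # p" x] inA[of "u' # q'" y] 3 q by auto
  show ?case
  proof (cases "(v, u) = (v', u')")
    case True
    then have ne: "?x \<noteq> ?y" using 3(2)[of "u' # q'"] 3 q by auto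
    have e: "(v, u) \<in> edges G" using 3 by simp
    have "?x \<in> nbhd G u" "?y \<in> nbhd G u" using m A(1) True edge_verts[OF e] by auto
    then have "emap G (v, u) ?x \<noteq> emap G (v, u) ?y" using ne emap_inj[OF e] by (auto dest: inj_onD)
    then show ?thesis using q True by simp
  next
    case False
    then have "emap G (v, u) ` A u \<inter> emap G (v', u') ` A u' = {}" using disj[of "(v, u)" "(v', u')"] 3 q by auto
    then show ?thesis using q m by auto
  qed
qed auto

lemma emap_loc_lower:
  assumes e: "(v, u) \<in> edges G" and x: "x \<in> nbhd G u" and a: "a < dl G (v, u) x"
  shows "loc_lower (emap G (v, u)) x a"
proof -
  \<comment> \<open>\<open>?\<kappa>\<close> is the slack: on a ball where the derivative varies by
    at most that much, linearisation loses no more than that in the stretching factor.\<close>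
  let ?D = "Der (emap G (v, u))" and ?\<kappa> = "dl G (v, u) x - a"
  have op: "open (nbhd G u)" using nbhd(1) edge_verts(2)[OF e] by blast
  obtain c1 where c1: "0 < c1" "ball x c1 \<subseteq> nbhd G u" using op x openE by blast
  have "continuous (at x) ?D" using Der_cont[OF e] op x by (simp add: continuous_on_eq_continuous_at)
  then obtain c2 where c2: "0 < c2" "?D ` ball x c2 \<subseteq> ball (?D x) ?\<kappa>"
    using a unfolding continuous_at_ball by (metis diff_gt_0_iff_gt)
  have "a * dist y z \<le> dist (emap G (v, u) y) (emap G (v, u) z)"
    if yz: "y \<in> ball x (min c1 c2)" "z \<in> ball x (min c1 c2)" for y z
  proof -
    let ?B = "ball x (min c1 c2)"
    have "norm (emap G (v, u) z - emap G (v, u) y - blinfun_apply (?D x) (z - y)) \<le> norm (z - y) * ?\<kappa>"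
    proof (rule differentiable_bound_linearization[where S = ?B and f' = "\<lambda>y. blinfun_apply (?D y)"])
      show "y + t *\<^sub>R (z - y) \<in> ?B" if "t \<in> {0..1}" for t
      proof -
        have "(1 - t) *\<^sub>R y + t *\<^sub>R z \<in> ?B" using convexD[OF convex_ball yz, of "1 - t" t] that by auto
        then show ?thesis by (simp add: algebra_simps)
      qed
      fix w assume w: "w \<in> ?B"
      then show "(emap G (v, u) has_derivative blinfun_apply (?D w)) (at w within ?B)"
        using c1 by (auto intro!: has_derivative_at_withinI[OF emap_has_derivative[OF e]])
      have "?D w \<in> ball (?D x) ?\<kappa>" using w c2 by (auto simp: image_subset_iff)
      then have "norm (?D w - ?D x) \<le> ?\<kappa>" by (simp add: dist_norm norm_minus_commute less_imp_le)
      then show "onorm (blinfun_apply (?D w) - blinfun_apply (?D x)) \<le> ?\<kappa>"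
        by (simp add: norm_blinfun.rep_eq minus_blinfun.rep_eq fun_diff_def)
    next
      show "x \<in> ?B" using c1 c2 by simp
    qed
    moreover have "dl G (v, u) x * norm (z - y) \<le> norm (blinfun_apply (?D x) (z - y))"
      by (simp add: dl_def lnorm_mult_le)
    moreover have "norm (blinfun_apply (?D x) (z - y)) - norm (emap G (v, u) z - emap G (v, u) y)
        \<le> norm (emap G (v, u) z - emap G (v, u) y - blinfun_apply (?D x) (z - y))"
      by (metis norm_minus_commute norm_triangle_ineq2)
    ultimately have "a * norm (z - y) \<le> norm (emap G (v, u) z - emap G (v, u) y)" by (simp add: algebra_simps)
    then show ?thesis by (simp add: dist_norm norm_minus_commute)
  qed
  then show ?thesis unfolding loc_lower_def using c1 c2 by (intro exI[of _ "min c1 c2"]) auto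
qed

lemma pmap_loc_lower:
  assumes "walk G p" "p \<noteq> []" "x \<in> nbhd G (last p)" "0 \<le> a" "a < coc (dl G) G p x"
  shows "loc_lower (pmap G p) x a"
  using assms
proof (induction p arbitrary: a rule: induct_list012)
  case (2 v)
  have "a * dist y z \<le> dist y z" for y z :: 'a using 2 mult_right_mono[of a 1 "dist y z"] by simp
  then show ?case unfolding loc_lower_def by (intro exI[of _ 1]) auto
next
  case (3 v u p)
  let ?y = "pmap G (u # p) x"
  let ?d = "dl G (v, u) ?y" and ?c = "coc (dl G) G (u # p) x"
  have nn: "0 \<le> ?d" "0 \<le> ?c" by (auto simp: dl_def lnorm_nonneg intro!: coc_nonneg)
  have lt: "a < ?d * ?c" using 3 by simp
  then have pos: "0 < ?d" "0 < ?c" using nn 3(6) by (auto simp: less_le)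
  \<comment> \<open>The slack between \<open>a\<close> and the product is a factor
    \<open>q < 1\<close>. Each of the two maps receives its square root, since both local bounds
    need a strict inequality.\<close>
  define q where "q = a / (?d * ?c)"
  define s where "s = sqrt q"
  have "q < 1" "0 \<le> q" using lt pos 3(6) by (simp_all add: q_def)
  then have s: "0 \<le> s" "s < 1" "s * s = a / (?d * ?c)" by (simp_all add: s_def q_def[symmetric])
  have y: "?y \<in> nbhd G u" using pmap_nbhd[of "u # p" x] 3 by simp
  have "loc_lower (emap G (v, u)) ?y (?d * s)"
    using 3 y pos s by (intro emap_loc_lower) auto
  moreover have "loc_lower (pmap G (u # p)) x (?c * s)"
    using 3(4,5) s pos by (intro 3(2)) (use 3(3) in auto)
  moreover have "continuous (at x) (pmap G (u # p))"
    using pmap_deriv[of "u # p" x] 3 has_derivative_continuous by auto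
  ultimately have "loc_lower (\<lambda>x. emap G (v, u) (pmap G (u # p) x)) x (?d * s * (?c * s))"
    by (rule loc_lower_compose) (use pos s in simp)
  moreover have "?d * s * (?c * s) = a" using s(3) pos by (simp add: field_simps)
  moreover have "(\<lambda>x. emap G (v, u) (pmap G (u # p) x)) = pmap G (v # u # p)" by (rule ext) simp
  ultimately show ?case by metis
qed auto

lemma emap_interior:
  assumes e: "(v, u) \<in> edges G" and x: "x \<in> interior (cell G u)"
  shows "emap G (v, u) x \<in> interior (cell G v)"
proof -
  have sub: "interior (cell G u) \<subseteq> nbhd G u" using interior_subset cell_nbhd edge_verts(2)[OF e] by blast
  have "continuous_on (nbhd G u) (emap G (v, u))"
    using emap_has_derivative[OF e] by (meson continuous_at_imp_continuous_on has_derivative_continuous)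
  then have "open (emap G (v, u) ` interior (cell G u))"
    using sub emap_inj[OF e] by (intro invariance_of_domain) (auto intro: continuous_on_subset inj_on_subset)
  moreover have "emap G (v, u) ` interior (cell G u) \<subseteq> cell G v"
    using emap_cell[OF e] interior_subset by blast
  ultimately show ?thesis using x interior_maximal by blast
qed

end

text \<open>The loops act on the cell of \<open>v\<close> as a finite iterated function system with
  lower contraction ratios \<rho>, and the last assumption is a Moran inequality for the exponent
  \<open>t\<close>. The bound on \<rho> is strict because \<open>pmap_loc_lower\<close> only yields
  constants below the derivative.\<close>

locale loop_ifs = gifs G g r \<Delta> for G :: "('v, 'a::euclidean_space) gsys" and g r \<Delta> :: real +
  fixes v :: 'v and n :: nat and L :: "'v list set" and \<rho> :: "'v list \<Rightarrow> real" and t :: real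
  assumes v: "v \<in> verts G" and n: "0 < n" and L: "finite L" "L \<noteq> {}" "L \<subseteq> loops G v n"
    and \<rho>_pos: "\<And>l. l \<in> L \<Longrightarrow> 0 < \<rho> l"
    and \<rho>_less: "\<And>l x. l \<in> L \<Longrightarrow> x \<in> cell G v \<Longrightarrow> \<rho> l < coc (dl G) G (l @ [v]) x"
    and t: "0 < t" "1 \<le> (\<Sum>l\<in>L. \<rho> l powr t)"
begin

lemma loopD: "l \<in> L \<Longrightarrow> length l = n" "l \<in> L \<Longrightarrow> l \<noteq> []" "l \<in> L \<Longrightarrow> hd l = v" "l \<in> L \<Longrightarrow> walk G (l @ [v])"
  using L(3) by (auto simp: loops_def)

definition codes :: "(nat \<Rightarrow> 'v list) set" where
  "codes = {\<xi>. \<forall>k. \<xi> k \<in> L}"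

text \<open>The concatenation of the loops of a code. They all have length \<open>n\<close>, so
  position \<open>i\<close> lies in block \<open>i div n\<close>.\<close>

definition cpath :: "(nat \<Rightarrow> 'v list) \<Rightarrow> nat \<Rightarrow> 'v" where
  "cpath \<xi> i = \<xi> (i div n) ! (i mod n)"

definition X :: "(nat \<Rightarrow> 'v list) \<Rightarrow> 'a" where
  "X \<xi> = coding G (cpath \<xi>)"

abbreviation tail :: "(nat \<Rightarrow> 'v list) \<Rightarrow> nat \<Rightarrow> 'v list" where
  "tail \<xi> \<equiv> \<lambda>k. \<xi> (Suc k)"

lemma tail_codes: "\<xi> \<in> codes \<Longrightarrow> tail \<xi> \<in> codes"
  by (simp add: codes_def)

lemma cpath_0: "\<xi> \<in> codes \<Longrightarrow> cpath \<xi> 0 = v"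
  using loopD[of "\<xi> 0"] by (auto simp: cpath_def codes_def hd_conv_nth)

lemma cpath_paths:
  assumes "\<xi> \<in> codes"
  shows "cpath \<xi> \<in> paths G"
proof -
  have "(cpath \<xi> i, cpath \<xi> (Suc i)) \<in> edges G" for i
  proof -
    let ?l = "\<xi> (i div n)"
    have l: "?l \<in> L" "\<xi> (Suc i div n) \<in> L" using assms by (auto simp: codes_def)
    note w = walk_nth[OF loopD(4)[OF l(1)], of "i mod n"]
    show ?thesis
    proof (cases "Suc (i mod n) = n")
      case True
      then have "Suc i mod n = 0" by (simp add: mod_Suc)
      then have "cpath \<xi> (Suc i) = v" using loopD[OF l(2)] by (simp add: cpath_def hd_conv_nth)
      moreover have "(l @ [v]) ! Suc (i mod n) = v" if "length l = n" for l using that True by (metis nth_append_length)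
      moreover have "(?l @ [v]) ! (i mod n) = ?l ! (i mod n)" using loopD(1)[OF l(1)] n by (simp add: nth_append)
      ultimately show ?thesis using w loopD(1)[OF l(1)] True by (simp add: cpath_def)
    next
      case False
      then have lt: "Suc (i mod n) < n" using mod_less_divisor[OF n, of i] by linarith
      then have "Suc i mod n = Suc (i mod n)" "Suc i div n = i div n" by (simp_all add: mod_Suc div_Suc)
      then show ?thesis using w loopD(1)[OF l(1)] lt by (simp add: cpath_def nth_append)
    qed
  qed
  then show ?thesis using edges by (auto simp: paths_def)
qed

lemma X_cell: "\<xi> \<in> codes \<Longrightarrow> X \<xi> \<in> cell G v"
  using coding_cell[OF cpath_paths] cpath_0 by (simp add: X_def)

lemma X_step:
  assumes "\<xi> \<in> codes"
  shows "X \<xi> = pmap G (\<xi> 0 @ [v]) (X (tail \<xi>))"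
proof -
  have l: "\<xi> 0 \<in> L" using assms by (simp add: codes_def)
  have "cpath \<xi> = pre (\<xi> 0) (cpath (tail \<xi>))"
  proof
    fix i
    show "cpath \<xi> i = pre (\<xi> 0) (cpath (tail \<xi>)) i"
    proof (cases "i < n")
      case True
      then show ?thesis using loopD(1)[OF l] by (simp add: cpath_def pre_nth)
    next
      case False
      then have "i div n = Suc ((i - n) div n)" "i mod n = (i - n) mod n"
        using n by (simp_all add: le_div_geq le_mod_geq)
      then show ?thesis using loopD(1)[OF l] False by (simp add: cpath_def pre_nth)
    qed
  qed
  then show ?thesis
    using coding_pre[OF cpath_paths[OF tail_codes[OF assms]], of "\<xi> 0"] cpath_0[OF tail_codes[OF assms]] loopD(4)[OF l]
    by (simp add: X_def)
qed

lemma concat_hd: "set u \<subseteq> L \<Longrightarrow> \<exists>q. concat u @ [v] = v # q"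
proof (cases u)
  case (Cons l u')
  assume "set u \<subseteq> L"
  then have "l \<noteq> []" "hd l = v" using loopD Cons by auto
  then show ?thesis using Cons by (cases l) auto
qed simp

lemma concat_append:
  assumes "set u' \<subseteq> L"
  shows "pmap G (p @ concat u' @ [v]) x = pmap G (p @ [v]) (pmap G (concat u' @ [v]) x)"
    "coc N G (p @ concat u' @ [v]) x = coc N G (p @ [v]) (pmap G (concat u' @ [v]) x) * coc N G (concat u' @ [v]) x"
    "walk G (p @ concat u' @ [v]) \<longleftrightarrow> walk G (p @ [v]) \<and> walk G (concat u' @ [v])"
proof -
  obtain q where q: "concat u' @ [v] = v # q" using concat_hd[OF assms] by blast
  show "pmap G (p @ concat u' @ [v]) x = pmap G (p @ [v]) (pmap G (concat u' @ [v]) x)"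
    unfolding q by (rule pmap_append)
  show "coc N G (p @ concat u' @ [v]) x = coc N G (p @ [v]) (pmap G (concat u' @ [v]) x) * coc N G (concat u' @ [v]) x"
    unfolding q by (rule coc_append)
  show "walk G (p @ concat u' @ [v]) \<longleftrightarrow> walk G (p @ [v]) \<and> walk G (concat u' @ [v])"
    unfolding q by (rule walk_append[OF edges])
qed

lemma walk_concat: "set u \<subseteq> L \<Longrightarrow> walk G (concat u @ [v])"
proof (induction u)
  case (Cons l u)
  then show ?case using concat_append(3)[of u l] loopD(4) by simp
qed (simp add: v)

lemma X_iterate: "\<xi> \<in> codes \<Longrightarrow> X \<xi> = pmap G (concat (map \<xi> [0..<k]) @ [v]) (X (\<lambda>i. \<xi> (i + k)))"
proof (induction k arbitrary: \<xi>)
  case (Suc k)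
  have s: "set (map (tail \<xi>) [0..<k]) \<subseteq> L" using Suc.prems by (auto simp: codes_def)
  have m: "map \<xi> [0..<Suc k] = \<xi> 0 # map (tail \<xi>) [0..<k]" by (rule map_upt_Suc)
  show ?case
    unfolding m X_step[OF Suc.prems] Suc.IH[OF tail_codes[OF Suc.prems]]
    using concat_append(1)[OF s, of "\<xi> 0"] by simp
qed simp

text \<open>A backward orbit inside the cell determines its starting point, because the composed
  maps contract the cell. A point is thus recognised as coded without taking limits of
  codes.\<close>

lemma X_unique:
  assumes \<xi>: "\<xi> \<in> codes" and y: "\<And>k. y k \<in> cell G v" "\<And>k. y k = pmap G (\<xi> k @ [v]) (y (Suc k))"
  shows "y 0 = X \<xi>"
proof (rule ccontr)
  assume "y 0 \<noteq> X \<xi>"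
  have yk: "y 0 = pmap G (concat (map \<xi> [0..<k]) @ [v]) (y k)" for k
  proof (induction k)
    case (Suc k)
    have "concat [\<xi> k] @ [v] = \<xi> k @ [v]" by simp
    moreover have "set [\<xi> k] \<subseteq> L" using \<xi> by (simp add: codes_def)
    ultimately have "pmap G (concat (map \<xi> [0..<k]) @ \<xi> k @ [v]) (y (Suc k)) =
        pmap G (concat (map \<xi> [0..<k]) @ [v]) (y k)"
      using concat_append(1)[of "[\<xi> k]" "concat (map \<xi> [0..<k])" "y (Suc k)"] y(2)[of k] by simp
    then show ?case using Suc by simp
  qed simp
  have "dist (y 0) (X \<xi>) \<le> mesh * g * r ^ k" for k
  proof -
    let ?p = "concat (map \<xi> [0..<k]) @ [v]"
    have s: "set (map \<xi> [0..<k]) \<subseteq> L" "(\<lambda>i. \<xi> (i + k)) \<in> codes" using \<xi> by (auto simp: codes_def)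
    have "dist (y 0) (X \<xi>) \<le> mesh * g * r ^ (length ?p - 1)"
      using pmap_cell_power[OF walk_concat[OF s(1)], of "y k" "X (\<lambda>i. \<xi> (i + k))"] y(1)[of k] X_cell[OF s(2)]
        yk[of k] X_iterate[OF \<xi>, of k] by simp
    also have "length ?p - 1 = k * n"
    proof -
      have "length (concat (map \<xi> [0..<k])) = k * n"
        using \<xi> loopD(1) by (induction k) (auto simp: codes_def)
      then show ?thesis by simp
    qed
    also have "r ^ (k * n) \<le> r ^ k" using r n by (intro power_decreasing) auto
    finally show ?thesis using mesh_ge_1 g by (simp add: mult_left_mono)
  qed
  moreover have "(\<lambda>k. mesh * g * r ^ k) \<longlonglongrightarrow> mesh * g * 0"
    using r by (intro tendsto_intros LIMSEQ_power_zero) auto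
  ultimately have "dist (y 0) (X \<xi>) \<le> mesh * g * 0" by (intro LIMSEQ_le_const) auto
  with \<open>y 0 \<noteq> X \<xi>\<close> show False by simp
qed

definition attr :: "'a set" where
  "attr = {X \<xi> | \<xi>. \<forall>k. \<xi> k \<in> L}"

lemma attr_codes: "attr = X ` codes"
  by (auto simp: attr_def codes_def)

lemma attr_limit_set: "attr \<subseteq> limit_set G"
  using cpath_paths by (auto simp: attr_codes limit_set_def X_def)

lemma loop_map_continuous_inj:
  assumes "l \<in> L"
  shows "continuous_on (cell G v) (pmap G (l @ [v]))" "inj_on (pmap G (l @ [v])) (cell G v)"
  using pmap_continuous[OF loopD(4)[OF assms]] pmap_inj[OF loopD(4)[OF assms]] cell_nbhd[OF v]
  by (auto intro: continuous_on_subset inj_on_subset)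

text \<open>No topology on the codes is used. The closure of \<open>attr\<close> is covered by its
  own images under finitely many loops, so each of its points has a backward orbit with some code,
  and \<open>X_unique\<close> identifies it with the coded point.\<close>

lemma compact_attr: "compact attr"
proof -
  let ?S = "\<lambda>l. pmap G (l @ [v])"
  have sub: "attr \<subseteq> cell G v" using X_cell by (auto simp: attr_codes)
  have cl: "closure attr \<subseteq> cell G v" using sub compact_imp_closed[OF cell(1)[OF v]] by (rule closure_minimal)
  have cpt: "compact (closure attr)" using compact_Int_closed[OF cell(1)[OF v] closed_closure[of attr]] cl by (simp add: Int_absorb1)
  have "compact (\<Union>l\<in>L. ?S l ` closure attr)"
    using L(1) cpt loop_map_continuous_inj(1) cl by (intro compact_UN compact_continuous_image) (auto intro: continuous_on_subset)
  moreover have "attr \<subseteq> (\<Union>l\<in>L. ?S l ` closure attr)"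
  proof
    fix x assume "x \<in> attr"
    then obtain \<xi> where \<xi>: "\<xi> \<in> codes" "x = X \<xi>" by (auto simp: attr_codes)
    then have "X (tail \<xi>) \<in> attr" using tail_codes by (auto simp: attr_codes)
    then have "X (tail \<xi>) \<in> closure attr" using closure_subset by blast
    then show "x \<in> (\<Union>l\<in>L. ?S l ` closure attr)" using X_step[OF \<xi>(1)] \<xi> by (auto simp: codes_def)
  qed
  ultimately have "closure attr \<subseteq> (\<Union>l\<in>L. ?S l ` closure attr)" by (intro closure_minimal compact_imp_closed)
  then have "\<forall>x\<in>closure attr. \<exists>l y. l \<in> L \<and> y \<in> closure attr \<and> x = ?S l y" by blast
  then obtain lf yf where lf: "\<And>x. x \<in> closure attr \<Longrightarrow> lf x \<in> L \<and> yf x \<in> closure attr \<and> x = ?S (lf x) (yf x)"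
    by metis
  have "x \<in> attr" if x: "x \<in> closure attr" for x
  proof -
    define y where "y k = (yf ^^ k) x" for k
    have y: "y k \<in> closure attr" for k by (induction k) (use x lf in \<open>auto simp: y_def\<close>)
    have "(\<lambda>k. lf (y k)) \<in> codes" using lf[OF y] by (simp add: codes_def)
    moreover have "y 0 = X (\<lambda>k. lf (y k))"
      by (rule X_unique[OF calculation]) (use y cl lf[OF y] in \<open>auto simp: y_def\<close>)
    ultimately show ?thesis by (auto simp: attr_codes y_def)
  qed
  then have "closure attr = attr" using closure_subset by blast
  then show ?thesis using cpt by simp
qed

section \<open>Lower bound under strong separation\<close>

lemma dl_nonneg: "0 \<le> dl G e x"
  by (simp add: dl_def lnorm_nonneg)

lemma dl_le_dn: "dl G e x \<le> dn G e x"
  by (simp add: dl_def dn_def lnorm_le_norm)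

lemma coc_dl_le: "coc (dl G) H p x \<le> coc (dn G) H p x \<and> 0 \<le> coc (dl G) H p x"
  by (induction p rule: induct_list012) (auto intro!: mult_mono dl_le_dn mult_nonneg_nonneg dl_nonneg dn_nonneg)

lemma \<rho>_le: "l \<in> L \<Longrightarrow> \<rho> l \<le> r"
proof -
  assume l: "l \<in> L"
  obtain x where x: "x \<in> cell G v" using cell(3)[OF v] by blast
  have "\<rho> l \<le> coc (dn G) G (l @ [v]) x" using \<rho>_less[OF l x] coc_dl_le[of G "l @ [v]" x] by linarith
  also have "\<dots> \<le> r ^ n" using coc_le_power[OF loopD(4)[OF l], of x] loopD(1)[OF l] cell_nbhd[OF v x] by simp
  also have "\<dots> \<le> r ^ 1" using r n by (intro power_decreasing) auto
  finally show ?thesis by simp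
qed

lemma prod_\<rho>_le: "set u \<subseteq> L \<Longrightarrow> prod_list (map \<rho> u) \<le> r ^ length u \<and> 0 < prod_list (map \<rho> u)"
proof (induction u)
  case (Cons a u)
  then show ?case using \<rho>_le[of a] \<rho>_pos[of a] r by (auto intro!: mult_mono simp: less_imp_le)
qed simp

text \<open>Codes that first differ at place k have points at least \<tau> times the product of the
  first k ratios apart: \<open>\<tau>1\<close> separates the images of different loops, and the
  lower Lipschitz bounds carry this down. At scale \<open>d\<close> all codes of points in
  \<open>U\<close> therefore share a word of weight at most \<open>d / \<tau>\<close>, so one word
  per set suffices.\<close>

theorem dim_ge_strong_separation:
  assumes ssc: "strong_separation G"
  shows "ereal t \<le> hausdorff_dim (limit_set G)"
proof -
  let ?S = "\<lambda>l. pmap G (l @ [v])"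
  \<comment> \<open>Limit points coded by paths that begin at \<open>u\<close>. A limit point in the
    cell of \<open>u\<close> may be coded only from other vertices, so
    \<open>cell G u \<inter> limit_set G\<close> need not be preserved by the edge maps.\<close>
  define A where "A u = {coding G \<omega> | \<omega>. \<omega> \<in> paths G \<and> \<omega> 0 = u}" for u
  have A1: "A u \<subseteq> cell G u \<inter> limit_set G" for u using coding_cell by (auto simp: A_def limit_set_def)
  have disj: "?S l ` attr \<inter> ?S l' ` attr = {}" if l: "l \<in> L" "l' \<in> L" "l \<noteq> l'" for l l'
  proof -
    have sub: "attr \<subseteq> A v" using cpath_paths cpath_0 by (auto simp: attr_codes A_def X_def)
    have "?S l x \<noteq> ?S l' y" if "x \<in> attr" "y \<in> attr" for x y
    proof (rule walks_disjoint[where A = A])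
      show "A u \<subseteq> nbhd G u" if "u \<in> verts G" for u using A1 cell_nbhd[OF that] by blast
      show "emap G (v', u) x \<in> A v'" if e: "(v', u) \<in> edges G" and x: "x \<in> A u" for v' u x
      proof -
        obtain \<omega> where \<omega>: "\<omega> \<in> paths G" "\<omega> 0 = u" "x = coding G \<omega>" using x by (auto simp: A_def)
        have w: "walk G ([v'] @ [\<omega> 0])" using e \<omega> edge_verts by auto
        from pre_paths[OF \<omega>(1) w] coding_pre[OF \<omega>(1) w] show ?thesis
          using \<omega> by (auto simp: A_def intro!: exI[of _ "pre [v'] \<omega>"])
      qed
      show "emap G e ` A (snd e) \<inter> emap G e' ` A (snd e') = {}" if "e \<in> edges G" "e' \<in> edges G" "e \<noteq> e'" for e e'
        using ssc that A1[of "snd e"] A1[of "snd e'"] unfolding strong_separation_def by blast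
    qed (use loopD l that sub in auto)
    then show ?thesis by blast
  qed
  have cS: "compact (?S l ` attr)" if "l \<in> L" for l
    using compact_attr loop_map_continuous_inj(1)[OF that] X_cell
    by (intro compact_continuous_image) (auto intro: continuous_on_subset simp: attr_codes)
  obtain \<tau>1 where \<tau>1: "0 < \<tau>1" "\<And>z. z \<in> {z \<in> L \<times> L. fst z \<noteq> snd z} \<Longrightarrow>
      \<forall>x\<in>?S (fst z) ` attr. \<forall>y\<in>?S (snd z) ` attr. \<tau>1 \<le> dist x y"
  proof (rule finite_uniform_pos[where I = "{z \<in> L \<times> L. fst z \<noteq> snd z}" and
        P = "\<lambda>z d. \<forall>x\<in>?S (fst z) ` attr. \<forall>y\<in>?S (snd z) ` attr. d \<le> dist x y"])
    show "finite {z \<in> L \<times> L. fst z \<noteq> snd z}" using L(1) by simp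
    show "\<exists>d>0. \<forall>x\<in>?S (fst z) ` attr. \<forall>y\<in>?S (snd z) ` attr. d \<le> dist x y"
      if "z \<in> {z \<in> L \<times> L. fst z \<noteq> snd z}" for z
      using that by (intro separate_compact_closed cS compact_imp_closed disj) auto
  qed (force+)
  \<comment> \<open>\<open>\<tau>2\<close> caps the lower Lipschitz estimate for distant pairs.
    Shrinking it keeps the estimate valid, so finitely many loops admit a common value.\<close>
  obtain \<tau>2 where \<tau>2: "0 < \<tau>2" "\<And>l. l \<in> L \<Longrightarrow> \<forall>x\<in>cell G v. \<forall>y\<in>cell G v. min (\<rho> l * dist x y) \<tau>2 \<le> dist (?S l x) (?S l y)"
  proof (rule finite_uniform_pos[where I = L and
        P = "\<lambda>l d. \<forall>x\<in>cell G v. \<forall>y\<in>cell G v. min (\<rho> l * dist x y) d \<le> dist (?S l x) (?S l y)"])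
    fix l assume l: "l \<in> L"
    have "loc_lower (?S l) x (\<rho> l)" if "x \<in> cell G v" for x
      using that cell_nbhd[OF v] \<rho>_pos[OF l] \<rho>_less[OF l] by (intro pmap_loc_lower loopD(4)[OF l]) (auto simp: less_imp_le)
    then obtain \<tau> where "0 < \<tau>" "\<And>x y. x \<in> cell G v \<Longrightarrow> y \<in> cell G v \<Longrightarrow> min (\<rho> l * dist x y) \<tau> \<le> dist (?S l x) (?S l y)"
      using loc_lower_compact[OF cell(1)[OF v] loop_map_continuous_inj[OF l]] by blast
    then show "\<exists>d>0. \<forall>x\<in>cell G v. \<forall>y\<in>cell G v. min (\<rho> l * dist x y) d \<le> dist (?S l x) (?S l y)" by blast
  next
    fix l and d d' :: real
    assume "\<forall>x\<in>cell G v. \<forall>y\<in>cell G v. min (\<rho> l * dist x y) d \<le> dist (?S l x) (?S l y)" "0 < d'" "d' \<le> d"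
    then show "\<forall>x\<in>cell G v. \<forall>y\<in>cell G v. min (\<rho> l * dist x y) d' \<le> dist (?S l x) (?S l y)"
      by (meson min.mono order_refl order_trans)
  qed (use L in auto)
  define \<tau> where "\<tau> = min \<tau>1 \<tau>2"
  have \<tau>: "0 < \<tau>" using \<tau>1 \<tau>2 by (simp add: \<tau>_def)
  have sep: "\<tau> * prod_list (map \<rho> (map \<xi> [0..<k])) \<le> dist (X \<xi>) (X \<xi>')"
    if "\<xi> \<in> codes" "\<xi>' \<in> codes" "\<forall>i<k. \<xi> i = \<xi>' i" "\<xi> k \<noteq> \<xi>' k" for k \<xi> \<xi>'
    using that
  proof (induction k arbitrary: \<xi> \<xi>')
    case 0
    have "X \<xi> \<in> ?S (\<xi> 0) ` attr" "X \<xi>' \<in> ?S (\<xi>' 0) ` attr"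
      using X_step[OF 0(1)] X_step[OF 0(2)] tail_codes 0 by (auto simp: attr_codes)
    then have "\<tau>1 \<le> dist (X \<xi>) (X \<xi>')" using \<tau>1(2)[of "(\<xi> 0, \<xi>' 0)"] 0 by (auto simp: codes_def)
    then show ?case by (simp add: \<tau>_def)
  next
    case (Suc k)
    let ?p = "prod_list (map \<rho> (map (tail \<xi>) [0..<k]))"
    have IH: "\<tau> * ?p \<le> dist (X (tail \<xi>)) (X (tail \<xi>'))"
      using Suc.prems tail_codes by (intro Suc.IH) auto
    have l: "\<xi> 0 \<in> L" "\<xi>' 0 = \<xi> 0" using Suc.prems by (auto simp: codes_def)
    have c: "X (tail \<xi>) \<in> cell G v" "X (tail \<xi>') \<in> cell G v" using X_cell tail_codes Suc.prems by auto
    have p: "?p \<le> 1" "0 < ?p"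
    proof -
      have "set (map (tail \<xi>) [0..<k]) \<subseteq> L" using Suc.prems(1) by (auto simp: codes_def)
      from prod_\<rho>_le[OF this] show "?p \<le> 1" "0 < ?p"
        using power_le_one[of r k] r by simp_all
    qed
    have "\<rho> (\<xi> 0) * ?p \<le> 1 * 1" using p \<rho>_le[OF l(1)] \<rho>_pos[OF l(1)] r by (intro mult_mono) auto
    then have "\<tau> * (\<rho> (\<xi> 0) * ?p) \<le> \<tau>2" using \<tau> mult_left_mono[of "\<rho> (\<xi> 0) * ?p" 1 \<tau>] by (simp add: \<tau>_def)
    moreover have "\<tau> * (\<rho> (\<xi> 0) * ?p) \<le> \<rho> (\<xi> 0) * dist (X (tail \<xi>)) (X (tail \<xi>'))"
      using mult_left_mono[OF IH, of "\<rho> (\<xi> 0)"] \<rho>_pos[OF l(1)] by (simp add: mult_ac)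
    ultimately have "\<tau> * (\<rho> (\<xi> 0) * ?p) \<le> dist (?S (\<xi> 0) (X (tail \<xi>))) (?S (\<xi> 0) (X (tail \<xi>')))"
      using \<tau>2(2)[OF l(1)] c by (meson min.boundedI order_trans)
    also have "\<dots> = dist (X \<xi>) (X \<xi>')" using X_step[OF Suc.prems(1)] X_step[OF Suc.prems(2)] l by simp
    finally show ?case by (subst map_upt_Suc) simp
  qed
  have "ereal t \<le> hausdorff_dim {X \<xi> | \<xi>. \<forall>k. \<xi> k \<in> L}"
  proof (rule hausdorff_dim_coded_ge[where \<rho> = \<rho> and C = "1 / \<tau>" and N = 1])
    show "0 < \<rho> l \<and> \<rho> l \<le> 1" if "l \<in> L" for l using \<rho>_pos[OF that] \<rho>_le[OF that] r by simp
    show "0 < 1 / \<tau>" using \<tau> by simp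
    fix d :: real and U :: "'a set" assume d: "0 < d" and U: "\<And>x y. x \<in> U \<Longrightarrow> y \<in> U \<Longrightarrow> dist x y \<le> d"
    show "\<exists>W. finite W \<and> card W \<le> 1 \<and> (\<forall>u\<in>W. set u \<subseteq> L \<and> prod_list (map \<rho> u) \<le> 1 / \<tau> * d) \<and>
          (\<forall>\<xi>. (\<forall>k. \<xi> k \<in> L) \<and> X \<xi> \<in> U \<longrightarrow> (\<exists>k. map \<xi> [0..<k] \<in> W))"
    proof (cases "\<exists>\<xi>\<in>codes. X \<xi> \<in> U")
      case False
      then show ?thesis by (intro exI[of _ "{}"]) (auto simp: codes_def)
    next
      case True
      then obtain \<xi> where \<xi>: "\<xi> \<in> codes" "X \<xi> \<in> U" by blast
      let ?P = "\<lambda>k. prod_list (map \<rho> (map \<xi> [0..<k]))"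
      have s: "set (map \<xi> [0..<k]) \<subseteq> L" for k using \<xi> by (auto simp: codes_def)
      obtain k0 where "r ^ k0 < d / \<tau>" using real_arch_pow_inv[of "d / \<tau>" r] d \<tau> r by auto
      moreover have "?P k0 \<le> r ^ k0" using prod_\<rho>_le[OF s, of k0] by simp
      ultimately have "?P k0 \<le> d / \<tau>" by linarith
      then have "\<tau> * ?P k0 \<le> d" using \<tau> by (simp add: field_simps)
      then have ex: "\<exists>k. \<tau> * ?P k \<le> d" by blast
      \<comment> \<open>The first length at which the guaranteed separation falls to
        \<open>d\<close>: codes that differ before it have points more than \<open>d\<close>
        apart.\<close>
      define k where "k = (LEAST k. \<tau> * ?P k \<le> d)"
      have k: "\<tau> * ?P k \<le> d" "\<And>j. j < k \<Longrightarrow> d < \<tau> * ?P j"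
        unfolding k_def using LeastI_ex[OF ex] not_less_Least[of _ "\<lambda>k. \<tau> * ?P k \<le> d"] by (auto simp: not_le)
      have same: "map \<xi>' [0..<k] = map \<xi> [0..<k]" if \<xi>': "\<xi>' \<in> codes" "X \<xi>' \<in> U" for \<xi>'
      proof (rule ccontr)
        assume "map \<xi>' [0..<k] \<noteq> map \<xi> [0..<k]"
        then have "\<exists>j. j < k \<and> \<xi> j \<noteq> \<xi>' j" by auto
        then obtain j where j: "j < k" "\<xi> j \<noteq> \<xi>' j" "\<forall>i<j. \<not> (i < k \<and> \<xi> i \<noteq> \<xi>' i)"
          using exists_least_iff[of "\<lambda>j. j < k \<and> \<xi> j \<noteq> \<xi>' j"] by auto
        then have "\<tau> * ?P j \<le> dist (X \<xi>) (X \<xi>')" using \<xi> \<xi>' by (intro sep) auto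
        also have "\<dots> \<le> d" using U \<xi> \<xi>' by blast
        finally show False using k(2)[OF j(1)] by simp
      qed
      have "\<exists>j. map \<xi>' [0..<j] \<in> {map \<xi> [0..<k]}" if "(\<forall>k. \<xi>' k \<in> L) \<and> X \<xi>' \<in> U" for \<xi>'
        using same[of \<xi>'] that by (auto simp: codes_def simp del: map_eq_conv intro!: exI[of _ k])
      moreover have "?P k \<le> 1 / \<tau> * d" using k(1) \<tau> by (simp add: field_simps)
      ultimately show ?thesis using s[of k]
        by (intro exI[of _ "{map \<xi> [0..<k]}"] conjI ballI allI impI) (auto simp del: map_map)
    qed
  qed (use L t in auto)
  also have "\<dots> \<le> hausdorff_dim (limit_set G)"
    using attr_limit_set unfolding attr_def by (rule hausdorff_dim_mono)
  finally show ?thesis .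
qed

end

section \<open>Lower bound under the open set condition\<close>

locale conformal_loop_ifs = loop_ifs G g r \<Delta> v n L \<rho> t + gifs_dist G g r \<Delta> c1 \<beta>
  for G :: "('v, 'a::euclidean_space) gsys" and g r \<Delta> :: real
    and v :: 'v and n :: nat and L :: "'v list set" and \<rho> :: "'v list \<Rightarrow> real" and t :: real and c1 \<beta> :: real +
  assumes dl_eq: "\<And>v u x. (v, u) \<in> edges G \<Longrightarrow> x \<in> nbhd G u \<Longrightarrow> dl G (v, u) x = dn G (v, u) x"
    and osc: "open_set_condition G"
begin

lemma coc_dl_eq: "walk G p \<Longrightarrow> p \<noteq> [] \<Longrightarrow> x \<in> nbhd G (last p) \<Longrightarrow> coc (dl G) G p x = coc (dn G) G p x"
proof (induction p rule: induct_list012)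
  case (3 v u p)
  then show ?case using pmap_nbhd[of "u # p" x] dl_eq[of v u] by simp
qed auto

abbreviation S :: "'v list list \<Rightarrow> 'a \<Rightarrow> 'a" where
  "S u \<equiv> pmap G (concat u @ [v])"

abbreviation D :: "'v list list \<Rightarrow> 'a \<Rightarrow> real" where
  "D u \<equiv> coc (dn G) G (concat u @ [v])"

lemma S_append: "set u' \<subseteq> L \<Longrightarrow> S (u @ u') x = S u (S u' x)"
  "set u' \<subseteq> L \<Longrightarrow> D (u @ u') x = D u (S u' x) * D u' x"
  using concat_append(1)[of u' "concat u" x] concat_append(2)[of u' "dn G" "concat u" x] by auto

lemma S_interior: "set u \<subseteq> L \<Longrightarrow> x \<in> interior (cell G v) \<Longrightarrow> S u x \<in> interior (cell G v)"
proof -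
  assume u: "set u \<subseteq> L" and x: "x \<in> interior (cell G v)"
  have *: "walk G p \<Longrightarrow> p \<noteq> [] \<Longrightarrow> x \<in> interior (cell G (last p)) \<Longrightarrow> pmap G p x \<in> interior (cell G (hd p))" for p
    by (induction p rule: induct_list012) (auto intro: emap_interior)
  have "hd (concat u @ [v]) = v" using concat_hd[OF u] by auto
  then show ?thesis using *[OF walk_concat[OF u]] x by (simp del: hd_append)
qed

lemma S_cell: "set u \<subseteq> L \<Longrightarrow> x \<in> cell G v \<Longrightarrow> S u x \<in> cell G v"
proof -
  assume u: "set u \<subseteq> L" and x: "x \<in> cell G v"
  have "hd (concat u @ [v]) = v" using concat_hd[OF u] by auto
  then show ?thesis using pmap_cell[OF walk_concat[OF u], of x] x by (simp del: hd_append)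
qed

lemma int_nbhd: "interior (cell G v) \<subseteq> nbhd G v"
  using interior_subset cell_nbhd[OF v] by blast

text \<open>Incomparable words have a first place where they differ. There
  \<open>walks_disjoint\<close> applies, since the loops have equal length, and injectivity of the
  common prefix map transports the result.\<close>

lemma S_disjoint:
  assumes u: "set u \<subseteq> L" "set u' \<subseteq> L" "u \<parallel> u'"
  shows "S u ` interior (cell G v) \<inter> S u' ` interior (cell G v) = {}"
proof -
  obtain as b bs c cs where d: "b \<noteq> c" "u = as @ b # bs" "u' = as @ c # cs"
    using parallel_decomp[OF u(3)] by blast
  have s: "set as \<subseteq> L" "b \<in> L" "c \<in> L" "set bs \<subseteq> L" "set cs \<subseteq> L" using u d by auto
  have "S u x \<noteq> S u' y" if x: "x \<in> interior (cell G v)" and y: "y \<in> interior (cell G v)" for x y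
  proof -
    have i: "S bs x \<in> interior (cell G v)" "S cs y \<in> interior (cell G v)" using S_interior s x y by auto
    have "pmap G (b @ [v]) (S bs x) \<noteq> pmap G (c @ [v]) (S cs y)"
    proof (rule walks_disjoint[where A = "\<lambda>u. interior (cell G u)"])
      show "interior (cell G u) \<subseteq> nbhd G u" if "u \<in> verts G" for u using interior_subset cell_nbhd[OF that] by blast
      show "emap G e ` interior (cell G (snd e)) \<inter> emap G e' ` interior (cell G (snd e')) = {}"
        if "e \<in> edges G" "e' \<in> edges G" "e \<noteq> e'" for e e'
        using osc that unfolding open_set_condition_def by blast
    qed (use loopD s d i emap_interior in auto)
    then have ne: "S [b] (S bs x) \<noteq> S [c] (S cs y)" by simp
    have i': "S [b] (S bs x) \<in> interior (cell G v)" "S [c] (S cs y) \<in> interior (cell G v)"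
      using S_interior[of "[b]"] S_interior[of "[c]"] s i by auto
    have "inj_on (S as) (nbhd G v)" using pmap_inj[OF walk_concat[OF s(1)]] by simp
    then have "S as (S [b] (S bs x)) \<noteq> S as (S [c] (S cs y))"
      using ne i' int_nbhd by (meson inj_onD subsetD)
    moreover have "S u x = S as (S [b] (S bs x))" "S u' y = S as (S [c] (S cs y))"
      using S_append(1)[of "[b] @ bs" as x] S_append(1)[of bs "[b]" x] S_append(1)[of "[c] @ cs" as y]
        S_append(1)[of cs "[c]" y] s d by auto
    ultimately show ?thesis by simp
  qed
  then show ?thesis by blast
qed

lemma length_concat: "set u \<subseteq> L \<Longrightarrow> length (concat u) = length u * n"
  using loopD(1) by (induction u) auto

lemma D_le: "set u \<subseteq> L \<Longrightarrow> x \<in> cell G v \<Longrightarrow> D u x \<le> r ^ length u"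
proof -
  assume u: "set u \<subseteq> L" and x: "x \<in> cell G v"
  have "D u x \<le> r ^ (length u * n)"
    using coc_le_power[OF walk_concat[OF u], of x] cell_nbhd[OF v x] length_concat[OF u] by simp
  also have "\<dots> \<le> r ^ length u" using r n by (intro power_decreasing) auto
  finally show ?thesis .
qed

lemma prod_\<rho>_le_D: "set u \<subseteq> L \<Longrightarrow> x \<in> cell G v \<Longrightarrow> prod_list (map \<rho> u) \<le> D u x"
proof (induction u)
  case (Cons l u)
  have l: "l \<in> L" "set u \<subseteq> L" using Cons by auto
  have y: "S u x \<in> cell G v" using S_cell[OF l(2)] Cons by simp
  have "\<rho> l \<le> D [l] (S u x)"
    using \<rho>_less[OF l(1) y] coc_dl_eq[OF loopD(4)[OF l(1)], of "S u x"] cell_nbhd[OF v y] by simp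
  then have "\<rho> l * prod_list (map \<rho> u) \<le> D [l] (S u x) * D u x"
    using Cons l \<rho>_pos[OF l(1)] prod_\<rho>_le[OF l(2)] by (intro mult_mono) (auto simp: coc_dn_nonneg)
  also have "\<dots> = D (l # u) x" using S_append(2)[OF l(2), of "[l]" x] by simp
  finally show ?case by simp
qed simp

text \<open>The cylinders whose size is comparable to \<open>d\<close> have disjoint interiors containing balls of radius
  comparable to \<open>d\<close>, so boundedly many of them meet a set of diameter \<open>d\<close>.\<close>

theorem dim_ge_open_set_condition: "ereal t \<le> hausdorff_dim (limit_set G)"
proof -
  let ?J = "cell G v"
  have "interior ?J \<noteq> {}" using cell(3,4)[OF v] by force
  then obtain b where b: "b \<in> interior ?J" by blast
  obtain \<rho>0 where \<rho>0: "0 < \<rho>0" "cball b \<rho>0 \<subseteq> interior ?J"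
    using b open_contains_cball open_interior by blast
  have bJ: "b \<in> ?J" using b interior_subset by blast
  define K where "K = dist_const (mesh * g)"
  have K: "1 \<le> K" unfolding K_def by (rule dist_const_ge_1)
  define m where "m = Min (\<rho> ` L)"
  have m: "0 < m" "\<And>l. l \<in> L \<Longrightarrow> m \<le> \<rho> l" using L \<rho>_pos by (auto simp: m_def)
  define Q where "Q = mesh * dist_const g * K * diameter ?J"
  have Q: "0 \<le> Q" unfolding Q_def
    using mesh_ge_1 dist_const_ge_1[of g] K diameter_ge_0[OF compact_imp_bounded[OF cell(1)[OF v]]]
    by (intro mult_nonneg_nonneg) auto
  \<comment> \<open>The radius of the inscribed balls in units of \<open>d\<close>. Stopping may
    overshoot by one loop, a factor at least \<open>m\<close>; distortion costs one \<open>K\<close>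
    for the derivative at \<open>b\<close> and another for the points around \<open>b\<close>;
    \<open>\<rho>0\<close> is the radius of a ball inside the cell.\<close>
  define c where "c = m / (K * K) * \<rho>0"
  have c: "0 < c" using m K \<rho>0 by (simp add: c_def)
  \<comment> \<open>Every inscribed ball stays within this multiple of \<open>d\<close> from a fixed
    point of \<open>U\<close>: 1 for \<open>U\<close> itself, \<open>Q\<close> for the cylinder,
    \<open>c\<close> for the ball.\<close>
  define E where "E = 1 + Q + c"
  define N where "N = nat \<lceil>(E / c) ^ DIM('a)\<rceil> + 1"
  have DK: "D u x \<le> K * D u y" if "set u \<subseteq> L" "x \<in> ?J" "y \<in> ?J" for u x y
    unfolding K_def by (rule coc_cell[OF walk_concat[OF that(1)]]) (use that in auto)
  have ball: "ball (S u b) (D u b / K * \<rho>0) \<subseteq> S u ` interior ?J" if u: "set u \<subseteq> L" "0 < D u b" for u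
  proof -
    have wk: "walk G (concat u @ [v])" by (rule walk_concat[OF u(1)])
    have sub: "cball b \<rho>0 \<subseteq> nbhd G v" using \<rho>0(2) int_nbhd by blast
    have "ball (S u b) (D u b / K * \<rho>0) \<subseteq> S u ` ball b \<rho>0"
    proof (rule ball_subset_image)
      show "continuous_on (cball b \<rho>0) (S u)" "inj_on (S u) (cball b \<rho>0)"
        using pmap_continuous[OF wk] pmap_inj[OF wk] sub by (auto intro: continuous_on_subset inj_on_subset)
      show "0 < D u b / K" using u K by simp
      fix y assume y: "y \<in> ball b \<rho>0"
      then have yJ: "y \<in> ?J" "y \<in> nbhd G v"
        using \<rho>0(2) interior_subset[of ?J] sub ball_subset_cball[of b \<rho>0] by blast+
      obtain D' where D': "(S u has_derivative D') (at y)" "\<And>h. coc (dl G) G (concat u @ [v]) y * norm h \<le> norm (D' h)"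
        using pmap_deriv[OF wk _, of y] yJ by auto
      have "D u b / K \<le> D u y" using DK[OF u(1) bJ yJ(1)] K by (simp add: field_simps)
      then have "D u b / K * norm h \<le> norm (D' h)" for h
        using D'(2)[of h] coc_dl_eq[OF wk, of y] yJ mult_right_mono[of "D u b / K" "D u y" "norm h"] by simp
      then show "\<exists>D'. (S u has_derivative D') (at y) \<and> (\<forall>h. D u b / K * norm h \<le> norm (D' h))" using D'(1) by blast
    qed (rule \<rho>0(1))
    also have "\<dots> \<subseteq> S u ` interior ?J" using \<rho>0(2) ball_subset_cball[of b \<rho>0] by blast
    finally show ?thesis .
  qed
  have "ereal t \<le> hausdorff_dim {X \<xi> | \<xi>. \<forall>k. \<xi> k \<in> L}"
  proof (rule hausdorff_dim_coded_ge[where \<rho> = \<rho> and C = 1 and N = N])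
    show "0 < \<rho> l \<and> \<rho> l \<le> 1" if "l \<in> L" for l using \<rho>_pos[OF that] \<rho>_le[OF that] r by simp
    fix d :: real and U :: "'a set" assume d: "0 < d" and U: "\<And>x y. x \<in> U \<Longrightarrow> y \<in> U \<Longrightarrow> dist x y \<le> d"
    have pre: "set (map \<xi> [0..<k]) \<subseteq> L" if "\<xi> \<in> codes" for \<xi> k using that by (auto simp: codes_def)
    define P where "P \<xi> k \<longleftrightarrow> D (map \<xi> [0..<k]) b \<le> d" for \<xi> k
    \<comment> \<open>Words are stopped when their derivative at \<open>b\<close> first drops to
      \<open>d\<close>. Stopped words are pairwise incomparable.\<close>
    define kk where "kk \<xi> = (LEAST k. P \<xi> k)" for \<xi>
    have ex: "\<exists>k. P \<xi> k" if "\<xi> \<in> codes" for \<xi>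
    proof -
      obtain k where "r ^ k < d" using real_arch_pow_inv[of d r] d r by auto
      then have "D (map \<xi> [0..<k]) b \<le> d" using D_le[OF pre[OF that, of k] bJ] by simp
      then show ?thesis by (auto simp: P_def)
    qed
    have kk: "P \<xi> (kk \<xi>)" "\<And>j. j < kk \<xi> \<Longrightarrow> \<not> P \<xi> j" if "\<xi> \<in> codes" for \<xi>
      unfolding kk_def using LeastI_ex[OF ex[OF that]] not_less_Least by auto
    define W where "W = {map \<xi> [0..<kk \<xi>] | \<xi>. \<xi> \<in> codes \<and> X \<xi> \<in> U}"
    have WL: "set u \<subseteq> L" "D u b \<le> d" if u: "u \<in> W" for u
    proof -
      obtain \<xi> where \<xi>: "u = map \<xi> [0..<kk \<xi>]" "\<xi> \<in> codes" using u by (auto simp: W_def)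
      show "set u \<subseteq> L" using pre[OF \<xi>(2), of "kk \<xi>"] \<xi>(1) by metis
      show "D u b \<le> d" using kk(1)[OF \<xi>(2)] \<xi>(1) unfolding P_def by metis
    qed
    have par: "u \<parallel> u'" if uu: "u \<in> W" "u' \<in> W" "u \<noteq> u'" for u u'
    proof -
      have nopre: "\<not> prefix u u'" if uu: "u \<in> W" "u' \<in> W" "u \<noteq> u'" for u u'
      proof
        assume p: "prefix u u'"
        obtain \<xi> where \<xi>: "u' = map \<xi> [0..<kk \<xi>]" "\<xi> \<in> codes" using uu by (auto simp: W_def)
        have "u = take (length u) u'" using p by (auto simp: prefix_def)
        moreover have le: "length u < length u'" using p uu(3) by (metis prefix_length_prefix prefix_order.eq_iff not_less prefix_length_le le_antisym not_equal_is_parallel parallelE prefix_order.refl)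
        ultimately have "u = map \<xi> [0..<length u]" using \<xi>(1) by (metis length_map length_upt minus_nat.diff_0 less_imp_le take_map take_upt add_0)
        then have "P \<xi> (length u)" using WL(2)[OF uu(1)] by (metis P_def)
        moreover have "length u < kk \<xi>" using le \<xi>(1) by simp
        ultimately show False using kk(2)[OF \<xi>(2)] by blast
      qed
      show ?thesis using nopre[OF uu] nopre[OF uu(2,1)] uu(3) by (auto simp: parallel_def)
    qed
    have card: "card F \<le> N" if F: "finite F" "F \<subseteq> W" for F
    \<comment> \<open>The empty word has no predecessor from which the lower bound
      \<open>big\<close> could be derived; but it is comparable with every word, so it can only
      occur alone.\<close>
    proof (cases "[] \<in> F \<or> F = {}")
      case True
      have "F \<subseteq> {[]}"
      proof
        fix u assume u: "u \<in> F"
        then have "[] \<in> F" using True by auto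
        then have "u = []" using par[of "[]" u] F u by (cases "u = []") (auto simp: parallel_def)
        then show "u \<in> {[]}" by simp
      qed
      then have "card F \<le> card {[] :: 'v list list}" by (intro card_mono) auto
      then show ?thesis by (simp add: N_def)
    next
      case False
      then obtain u0 where "u0 \<in> F" by blast
      then obtain y0 where y0: "y0 \<in> U" using F by (auto simp: W_def)
      have big: "m * d / K \<le> D u b" if u: "u \<in> F" for u
      proof -
        obtain \<xi> where \<xi>: "u = map \<xi> [0..<kk \<xi>]" "\<xi> \<in> codes" using u F by (auto simp: W_def)
        have "kk \<xi> \<noteq> 0" using \<xi>(1) u False by auto
        then obtain k where k: "kk \<xi> = Suc k" by (cases "kk \<xi>") auto
        let ?u = "map \<xi> [0..<k]" and ?l = "\<xi> k"
        have l: "?l \<in> L" using \<xi>(2) by (simp add: codes_def)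
        have u': "u = ?u @ [?l]" using \<xi>(1) k by simp
        have y: "S [?l] b \<in> ?J" using S_cell[of "[?l]" b] l bJ by simp
        \<comment> \<open>Without its last loop the word was not yet stopped.\<close>
        have "d < D ?u b" using kk(2)[OF \<xi>(2), of k] k by (simp add: P_def)
        also have "\<dots> \<le> K * D ?u (S [?l] b)" by (rule DK[OF pre[OF \<xi>(2)] bJ y])
        finally have "d / K \<le> D ?u (S [?l] b)" using K by (simp add: field_simps)
        moreover have "m \<le> D [?l] b" using m(2)[OF l] prod_\<rho>_le_D[of "[?l]" b] l bJ by simp
        ultimately have "d / K * m \<le> D ?u (S [?l] b) * D [?l] b"
          using m d K by (intro mult_mono) (auto simp: coc_dn_nonneg)
        also have "\<dots> = D u b" unfolding u' using S_append(2)[of "[?l]" ?u b] l by simp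
        finally show ?thesis by (simp add: mult_ac)
      qed
      have sub: "ball (S u b) (c * d) \<subseteq> S u ` interior ?J" if u: "u \<in> F" for u
      proof -
        have "0 < m * d / K" using m d K by simp
        then have "ball (S u b) (D u b / K * \<rho>0) \<subseteq> S u ` interior ?J"
          using ball[of u] WL(1)[of u] F u big[OF u] by auto
        moreover have "c * d \<le> D u b / K * \<rho>0"
        proof -
          have "m * d / K / K * \<rho>0 \<le> D u b / K * \<rho>0"
            using big[OF u] K \<rho>0 by (intro mult_right_mono divide_right_mono) auto
          then show ?thesis by (simp add: c_def mult_ac)
        qed
        ultimately show ?thesis using subset_ball[of "c * d" "D u b / K * \<rho>0" "S u b"] by blast
      qed
      have "real (card F) \<le> ((E * d) / (c * d)) ^ DIM('a)"
      proof (rule card_disjoint_balls_le[OF F(1)])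
        show "ball (S u b) (c * d) \<inter> ball (S u' b) (c * d) = {}" if "u \<in> F" "u' \<in> F" "u \<noteq> u'" for u u'
          using sub[OF that(1)] sub[OF that(2)] S_disjoint[of u u'] par[of u u'] WL(1) that F by blast
        show "ball (S u b) (c * d) \<subseteq> ball y0 (E * d)" if u: "u \<in> F" for u
        proof
          fix z assume z: "z \<in> ball (S u b) (c * d)"
          obtain \<xi> where \<xi>: "u = map \<xi> [0..<kk \<xi>]" "\<xi> \<in> codes" "X \<xi> \<in> U" using u F by (auto simp: W_def)
          have uL: "set u \<subseteq> L" "D u b \<le> d" using WL[of u] u F by auto
          let ?x = "X (\<lambda>i. \<xi> (i + kk \<xi>))"
          have x: "?x \<in> ?J" using \<xi>(2) by (intro X_cell) (auto simp: codes_def)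
          have "dist (S u ?x) (S u b) \<le> mesh * dist_const g * (K * d) * diameter (cell G (last (concat u @ [v])))"
          proof (rule pmap_cell_diam[OF walk_concat[OF uL(1)]])
            fix z assume "z \<in> cell G (last (concat u @ [v]))"
            then have "D u z \<le> K * D u b" using bJ by (intro DK uL) auto
            also have "\<dots> \<le> K * d" using uL K by (intro mult_left_mono) auto
            finally show "D u z \<le> K * d" .
          qed (use x bJ in auto)
          also have "\<dots> = Q * d" by (simp add: Q_def mult_ac)
          also have "S u ?x = X \<xi>" using X_iterate[OF \<xi>(2), of "kk \<xi>"] \<xi>(1) by metis
          finally have "dist (X \<xi>) (S u b) \<le> Q * d" .
          moreover have "dist y0 (X \<xi>) \<le> d" using U[OF y0 \<xi>(3)] .
          moreover have "dist (S u b) z < c * d" using z by simp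
          ultimately have "dist y0 z < d + Q * d + c * d"
            using dist_triangle[of y0 z "X \<xi>"] dist_triangle[of "X \<xi>" z "S u b"] by linarith
          then show "z \<in> ball y0 (E * d)" by (simp add: E_def algebra_simps)
        qed
        show "0 < c * d" using c d by simp
        show "0 \<le> E * d" using Q c d by (simp add: E_def)
      qed
      also have "(E * d) / (c * d) = E / c" using d by simp
      finally have "real (card F) \<le> (E / c) ^ DIM('a)" .
      then show ?thesis unfolding N_def by linarith
    qed
    have "finite W \<and> card W \<le> N" using finite_if_finite_subsets_card_bdd[of W N] card by blast
    moreover have "set u \<subseteq> L \<and> prod_list (map \<rho> u) \<le> 1 * d" if "u \<in> W" for u
      using WL[OF that] prod_\<rho>_le_D[OF WL(1)[OF that] bJ] by simp
    moreover have "\<exists>k. map \<xi> [0..<k] \<in> W" if "(\<forall>k. \<xi> k \<in> L) \<and> X \<xi> \<in> U" for \<xi>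
      using that by (intro exI[of _ "kk \<xi>"]) (auto simp: W_def codes_def)
    ultimately show "\<exists>W. finite W \<and> card W \<le> N \<and> (\<forall>u\<in>W. set u \<subseteq> L \<and> prod_list (map \<rho> u) \<le> 1 * d) \<and>
          (\<forall>\<xi>. (\<forall>k. \<xi> k \<in> L) \<and> X \<xi> \<in> U \<longrightarrow> (\<exists>k. map \<xi> [0..<k] \<in> W))"
      by blast
  qed (use L t in auto)
  also have "\<dots> \<le> hausdorff_dim (limit_set G)"
    using attr_limit_set unfolding attr_def by (rule hausdorff_dim_mono)
  finally show ?thesis .
qed

end

section \<open>The unperturbed system\<close>

lemma lnorm_eq_normI:
  assumes "\<And>h. norm (blinfun_apply M h) = norm M * norm h"
  shows "lnorm M = norm M"
  using lnorm_geI[of "norm M" M] assms lnorm_le_norm[of M] by simp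

lemma partition_sum_cong:
  assumes "\<And>\<omega>. \<omega> \<in> paths G \<Longrightarrow> f \<omega> = f' \<omega>"
  shows "partition_sum G f n = partition_sum G f' n"
  unfolding partition_sum_def
proof (intro infsum_cong arg_cong[where f = exp_ereal] SUP_cong refl)
  fix w \<omega> assume "\<omega> \<in> cylinder G w"
  then have "\<omega> \<in> paths G" by (simp add: cylinder_def)
  then show "ereal (\<Sum>i<n. f ((shift ^^ i) \<omega>)) = ereal (\<Sum>i<n. f' ((shift ^^ i) \<omega>))"
    using assms[OF shift_iterate_paths] by simp
qed

locale conformal_gifs = gifs_conf G g r \<Delta> c1 \<beta> for G :: "('v, 'a::euclidean_space) gsys" and g r \<Delta> c1 \<beta> :: real +
  assumes conf: "conformal G" and contr: "contractible_cells G"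
begin

lemma conformal_edge:
  assumes "(v, u) \<in> edges G" "x \<in> nbhd G u"
  shows "norm (blinfun_apply (Der (emap G (v, u)) x) h) = dn G (v, u) x * norm h"
    "inorm (Der (emap G (v, u)) x) = dn G (v, u) x" "dl G (v, u) x = dn G (v, u) x"
proof -
  have c: "conformal_on (emap G (v, u)) (nbhd G u)" using conf assms(1) unfolding conformal_def by fastforce
  note d = conformal_onD[OF c assms(2)]
  from d show "norm (blinfun_apply (Der (emap G (v, u)) x) h) = dn G (v, u) x * norm h"
    "inorm (Der (emap G (v, u)) x) = dn G (v, u) x" by (auto simp: dn_def)
  show "dl G (v, u) x = dn G (v, u) x" unfolding dl_def dn_def by (rule lnorm_eq_normI) (rule d)
qed

lemma paths_first_edge:
  assumes "\<omega> \<in> paths G"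
  shows "(\<omega> 0, \<omega> 1) \<in> edges G" "coding G (shift \<omega>) \<in> nbhd G (\<omega> 1)"
  using assms coding_cell[OF shift_paths[OF assms]] by (auto simp: paths_def shift_def intro!: cell_nbhd)

text \<open>V-summability speaks of \<open>inorm\<close> and of points of the limit set.
  Conformality turns the former into the norm; by \<open>live\<close> every cell contains a coded
  point, from which distortion reaches the whole cell.\<close>

lemma V_summableD:
  assumes "V_summable G"
  obtains s where "0 \<le> s" "has_pressure G (\<lambda>\<omega>. s * pot G \<omega>) 0" "Zsum s G 1 < \<infinity>"
proof -
  obtain s where s: "0 \<le> s" "has_pressure G (\<lambda>\<omega>. s * pot_low G \<omega>) 0"
    "(\<Sum>\<^sub>\<infinity>v\<in>verts G. SUP u\<in>{u. (v, u) \<in> edges G}. SUP x\<in>limit_set G \<inter> cell G u.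
           ennreal (inorm (Der (emap G (v, u)) x) powr s)) < \<infinity>"
    using assms unfolding V_summable_def by blast
  have "pot_low G \<omega> = pot G \<omega>" if "\<omega> \<in> paths G" for \<omega>
    using conformal_edge(2)[OF paths_first_edge[OF that]] by (simp add: pot_low_def pot_def dn_def)
  then have ps: "partition_sum G (\<lambda>\<omega>. s * pot_low G \<omega>) = partition_sum G (\<lambda>\<omega>. s * pot G \<omega>)"
    by (intro ext partition_sum_cong) simp
  have P: "has_pressure G (\<lambda>\<omega>. s * pot G \<omega>) 0" using s(2) unfolding has_pressure_def ps .
  let ?K = "dist_const (mesh * g) powr s"
  let ?f = "\<lambda>v. SUP u\<in>{u. (v, u) \<in> edges G}. SUP x\<in>limit_set G \<inter> cell G u.
           ennreal (inorm (Der (emap G (v, u)) x) powr s)"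
  have le: "Wt s G [v] \<le> ennreal ?K * ?f v" if v: "v \<in> verts G" for v
  proof -
    have "ennreal (coc (dn G) G [v, u] x powr s) \<le> ennreal ?K * ?f v" if u: "(v, u) \<in> edges G" and x: "x \<in> cell G u" for u x
    proof -
      obtain \<omega> where \<omega>: "\<omega> \<in> paths G" "\<omega> 0 = u"
        by (rule path_from[OF _ edge_verts(2)[OF u]]) (rule live)
      let ?y = "coding G \<omega>"
      have y: "?y \<in> limit_set G \<inter> cell G u" using \<omega> coding_cell[OF \<omega>(1)] by (auto simp: limit_set_def)
      have yn: "?y \<in> nbhd G u" using y cell_nbhd[OF edge_verts(2)[OF u]] by blast
      have "coc (dn G) G [v, u] x \<le> dist_const (mesh * g) * coc (dn G) G [v, u] ?y"
        using u x y edge_verts by (intro coc_cell) auto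
      then have "coc (dn G) G [v, u] x powr s \<le> (dist_const (mesh * g) * coc (dn G) G [v, u] ?y) powr s"
        using s(1) by (intro powr_mono2 coc_dn_nonneg)
      also have "\<dots> = ?K * inorm (Der (emap G (v, u)) ?y) powr s"
        using dist_const_ge_1[of "mesh * g"] conformal_edge(2)[OF u yn] by (simp add: powr_mult dn_nonneg)
      finally have "ennreal (coc (dn G) G [v, u] x powr s) \<le> ennreal ?K * ennreal (inorm (Der (emap G (v, u)) ?y) powr s)"
        by (simp add: ennreal_mult''[symmetric] ennreal_leI)
      also have "\<dots> \<le> ennreal ?K * ?f v"
        using u y by (intro mult_left_mono) (auto intro!: SUP_upper2[of u] SUP_upper2[of ?y])
      finally show ?thesis .
    qed
    then show ?thesis using v by (auto simp: Wt_def intro!: SUP_least)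
  qed
  have "Zsum s G 1 = infsum (Wt s G) ((\<lambda>v. [v]) ` verts G)"
    unfolding Zsum_def by (rule arg_cong[where f = "infsum (Wt s G)"]) (auto simp: length_Suc_conv)
  also have "\<dots> \<le> (\<Sum>\<^sub>\<infinity>v\<in>verts G. Wt s G [v])" by (rule infsum_ennreal_image_le)
  also have "\<dots> \<le> (\<Sum>\<^sub>\<infinity>v\<in>verts G. ennreal ?K * ?f v)" by (rule infsum_ennreal_mono) (auto simp: le)
  also have "\<dots> \<le> ennreal ?K * (\<Sum>\<^sub>\<infinity>v\<in>verts G. ?f v)" by (rule infsum_ennreal_cmult_le)
  also have "\<dots> < \<infinity>" using s(3) by (simp add: ennreal_mult_less_top)
  finally have "Zsum s G 1 < \<infinity>" .
  with s(1) P show thesis by (rule that)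
qed

lemma Zsum_eventually_small:
  assumes P: "has_pressure G (\<lambda>\<omega>. s * pot G \<omega>) 0" and s: "0 \<le> s" "s < t" and e: "0 < e"
  obtains n where "0 < n" "Zsum t G n < ennreal e"
proof -
  obtain C q where C: "0 < C" "0 < q" "q < 1" "\<forall>\<^sub>F n in sequentially. Zsum t G n \<le> ennreal (C * q ^ n)"
    by (rule Zsum_decay[OF P s])
  have "(\<lambda>n. C * q ^ n) \<longlonglongrightarrow> C * 0" using C by (intro tendsto_intros LIMSEQ_power_zero) auto
  then have "\<forall>\<^sub>F n in sequentially. C * q ^ n < e" using e by (intro order_tendstoD(2)) auto
  with C(4) eventually_gt_at_top[of 0] have "\<forall>\<^sub>F n in sequentially. 0 < n \<and> Zsum t G n < ennreal e"
  proof eventually_elim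
    case (elim n)
    then show ?case using C by (auto intro: le_less_trans simp: ennreal_less_iff)
  qed
  then show thesis using that by (auto simp: eventually_sequentially)
qed

section \<open>Dimension of the unperturbed limit set\<close>

lemma dim_le_pressure_zero:
  assumes P: "has_pressure G (\<lambda>\<omega>. s * pot G \<omega>) 0" and s: "0 \<le> s" "s < t" and Z: "Zsum s G 1 < \<infinity>"
  shows "hausdorff_dim (limit_set G) \<le> ereal t"
proof -
  obtain n where n: "0 < n" "Zsum t G n < ennreal 1" using Zsum_eventually_small[OF P s, of 1] by auto
  have "Zsum t G 1 < \<infinity>"
    using Zsum_mono_exponent[of s t 1] s Z by (auto intro: le_less_trans simp: ennreal_mult_less_top)
  then show ?thesis using n s by (intro hausdorff_dim_le[OF contr, of t n]) auto
qed

lemma dim_ge_pressure_zero: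
  assumes P: "has_pressure G (\<lambda>\<omega>. s * pot G \<omega>) 0" and s: "0 < t" "t < s" and Z: "Zsum s G 1 < \<infinity>"
    and sep: "strong_separation G \<or> open_set_condition G"
  shows "ereal t \<le> hausdorff_dim (limit_set G)"
proof -
  define K where "K = dist_const (mesh * g)"
  have K: "1 \<le> K" unfolding K_def by (rule dist_const_ge_1)
  \<comment> \<open>The threshold compensates the denominator of \<rho> below: \<open>K\<close>
    moves the derivative from the base point to any point of the cell, and the factor 2 makes the
    bound strict.\<close>
  obtain v n L where L: "v \<in> verts G" "0 < n" "finite L" "L \<subseteq> loops G v n"
    "(2 * K) powr t < (\<Sum>l\<in>L. coc (dn G) G (l @ [v]) (base_point v) powr t)"
    by (rule heavy_loops[OF P Z s(2), where C = "(2 * K) powr t"]) (use s in auto)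
  define \<rho> where "\<rho> l = coc (dn G) G (l @ [v]) (base_point v) / (2 * K)" for l
  have w: "walk G (l @ [v])" if "l \<in> L" for l using that L(4) by (auto simp: loops_def)
  have pos: "0 < coc (dn G) G (l @ [v]) (base_point v)" if "l \<in> L" for l
    using coc_pos[OF w[OF that]] base_point[OF L(1)] cell_nbhd[OF L(1)] by simp
  have dl_dn: "walk G p \<Longrightarrow> p \<noteq> [] \<Longrightarrow> x \<in> nbhd G (last p) \<Longrightarrow> coc (dl G) G p x = coc (dn G) G p x" for p x
  proof (induction p rule: induct_list012)
    case (3 v u p)
    then show ?case using pmap_nbhd[of "u # p" x] conformal_edge(3)[of v u] by simp
  qed auto
  have sum: "(\<Sum>l\<in>L. \<rho> l powr t) = (\<Sum>l\<in>L. coc (dn G) G (l @ [v]) (base_point v) powr t) / (2 * K) powr t"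
    unfolding \<rho>_def sum_divide_distrib using K by (intro sum.cong refl powr_divide)
  have li: "loop_ifs G g r \<Delta> v n L \<rho> t"
  proof unfold_locales
    show "L \<noteq> {}" using L(5) powr_ge_zero[of "2 * K" t] by auto
    show "0 < \<rho> l" if "l \<in> L" for l using pos[OF that] K by (simp add: \<rho>_def)
    show "\<rho> l < coc (dl G) G (l @ [v]) x" if l: "l \<in> L" and x: "x \<in> cell G v" for l x
    proof -
      have "coc (dn G) G (l @ [v]) (base_point v) \<le> K * coc (dn G) G (l @ [v]) x"
        unfolding K_def by (rule coc_cell[OF w[OF l]]) (use x base_point[OF L(1)] in auto)
      moreover have "coc (dl G) G (l @ [v]) x = coc (dn G) G (l @ [v]) x"
        using dl_dn[OF w[OF l], of x] cell_nbhd[OF L(1) x] by simp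
      ultimately show ?thesis using pos[OF l] K by (simp add: \<rho>_def field_simps)
    qed
    show "1 \<le> (\<Sum>l\<in>L. \<rho> l powr t)" unfolding sum using L(5) K by (simp add: field_simps)
  qed (use L s in auto)
  show ?thesis
  proof (cases "strong_separation G")
    case True
    then show ?thesis by (rule loop_ifs.dim_ge_strong_separation[OF li])
  next
    case False
    then have "conformal_loop_ifs G g r \<Delta> v n L \<rho> t c1 \<beta>"
      using li sep gifs_dist_axioms conformal_edge(3)
      by (intro conformal_loop_ifs.intro conformal_loop_ifs_axioms.intro) auto
    then show ?thesis by (rule conformal_loop_ifs.dim_ge_open_set_condition)
  qed
qed

end

section \<open>Perturbed systems\<close>

lemma Der_const [simp]: "Der (\<lambda>x. a) x = 0"
proof -
  have "frechet_derivative (\<lambda>x. a) (at x) = (\<lambda>h. 0)" by simp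
  then show ?thesis unfolding Der_def by (simp add: zero_blinfun_def[symmetric])
qed

lemma infsum_prod_list_le:
  fixes b :: "'v \<Rightarrow> ennreal"
  shows "(\<Sum>\<^sub>\<infinity>w\<in>{w. length w = n \<and> set w \<subseteq> V}. prod_list (map b w)) \<le> infsum b V ^ n"
proof (induction n)
  case 0
  have "(\<Sum>\<^sub>\<infinity>w\<in>{w. length w = 0 \<and> set w \<subseteq> V}. prod_list (map b w)) \<le> (\<Sum>\<^sub>\<infinity>w\<in>{[]}. prod_list (map b w))"
    by (rule infsum_ennreal_mono) auto
  then show ?case by simp
next
  case (Suc n)
  let ?L = "\<lambda>n. {w. length w = n \<and> set w \<subseteq> V}" and ?p = "\<lambda>w. prod_list (map b w)"
  have "?L (Suc n) \<subseteq> (\<lambda>z. fst z # snd z) ` (V \<times> ?L n)"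
  proof
    fix w assume w: "w \<in> ?L (Suc n)"
    then obtain a w' where "w = a # w'" by (cases w) auto
    then show "w \<in> (\<lambda>z. fst z # snd z) ` (V \<times> ?L n)"
      using w by (intro image_eqI[of _ _ "(a, w')"]) auto
  qed
  then have "infsum ?p (?L (Suc n)) \<le> infsum ?p ((\<lambda>z. fst z # snd z) ` (V \<times> ?L n))"
    by (rule infsum_ennreal_mono) simp
  also have "\<dots> \<le> (\<Sum>\<^sub>\<infinity>z\<in>V \<times> ?L n. ?p (fst z # snd z))" by (rule infsum_ennreal_image_le)
  also have "\<dots> = (\<Sum>\<^sub>\<infinity>z\<in>V \<times> ?L n. b (fst z) * ?p (snd z))" by simp
  also have "\<dots> \<le> infsum b V * infsum ?p (?L n)" by (rule infsum_ennreal_prod_le)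
  also have "\<dots> \<le> infsum b V * infsum b V ^ n" by (intro mult_left_mono Suc) auto
  finally show ?case by simp
qed

text \<open>Errors are additive because the limit weight vanishes on new edges. With limit factors
  at most 1 and \<eta> \<le> 1, one further factor turns an error e \<eta> into at most (2 e + 1)
  \<eta>; after k factors this gives (2^k - 1) \<eta>.\<close>

lemma coc_add_le:
  assumes "\<And>v u x. (v, u) \<in> edges H \<Longrightarrow> v \<in> S \<Longrightarrow> x \<in> cell H u \<Longrightarrow>
      0 \<le> N' (v, u) x \<and> N' (v, u) x \<le> N (v, u) x + \<eta> \<and> 0 \<le> N (v, u) x \<and> N (v, u) x \<le> 1"
    and H: "\<And>v u x. (v, u) \<in> edges H \<Longrightarrow> x \<in> cell H u \<Longrightarrow> emap H (v, u) x \<in> cell H v"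
    and \<eta>: "0 \<le> \<eta>" "\<eta> \<le> 1"
  shows "walk H p \<Longrightarrow> p \<noteq> [] \<Longrightarrow> set (butlast p) \<subseteq> S \<Longrightarrow> x \<in> cell H (last p) \<Longrightarrow>
    pmap H p x \<in> cell H (hd p) \<and> 0 \<le> coc N' H p x \<and> coc N' H p x \<le> coc N H p x + (2 ^ (length p - 1) - 1) * \<eta> \<and>
    0 \<le> coc N H p x \<and> coc N H p x \<le> 1"
proof (induction p rule: induct_list012)
  case (3 v u p)
  let ?y = "pmap H (u # p) x" and ?c = "coc N H (u # p) x" and ?c' = "coc N' H (u # p) x" and ?k = "length p"
  have IH: "?y \<in> cell H u" "0 \<le> ?c'" "?c' \<le> ?c + (2 ^ ?k - 1) * \<eta>" "0 \<le> ?c" "?c \<le> 1" using 3 by auto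
  let ?a = "N (v, u) ?y" and ?a' = "N' (v, u) ?y"
  have a: "0 \<le> ?a'" "?a' \<le> ?a + \<eta>" "0 \<le> ?a" "?a \<le> 1" using assms(1)[of v u ?y] 3 IH by auto
  have k: "0 \<le> (2::real) ^ ?k - 1" by simp
  have "?a' * ?c' \<le> (?a + \<eta>) * (?c + (2 ^ ?k - 1) * \<eta>)" using a IH \<eta> by (intro mult_mono) auto
  also have "\<dots> = ?a * ?c + (?a * ((2 ^ ?k - 1) * \<eta>) + (\<eta> * ?c + \<eta> * ((2 ^ ?k - 1) * \<eta>)))" by (simp add: algebra_simps)
  also have "\<dots> \<le> ?a * ?c + (1 * ((2 ^ ?k - 1) * \<eta>) + (\<eta> * 1 + 1 * ((2 ^ ?k - 1) * \<eta>)))"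
    using a IH \<eta> k by (intro add_left_mono add_mono mult_right_mono mult_left_mono mult_nonneg_nonneg) auto
  also have "\<dots> = ?a * ?c + (2 ^ Suc ?k - 1) * \<eta>" by (simp add: algebra_simps)
  finally have "?a' * ?c' \<le> ?a * ?c + (2 ^ Suc ?k - 1) * \<eta>" .
  moreover have "?a * ?c \<le> 1" using mult_mono[of ?a 1 ?c 1] a IH by simp
  ultimately show ?case using H[of v u ?y] 3(3) IH a by simp
qed auto

text \<open>\<open>g\<close> is at the same time the radius of \<open>gifs\<close> and a bound for
  the distance of perturbed cells from the cells of \<open>G\<close>, so unperturbed maps and
  derivatives can be used at perturbed points. \<open>maps\<close> is uniform over the edges,
  whereas \<open>ders\<close> concerns one initial vertex at a time. The constants in
  \<open>sys\<close> may depend on \<epsilon>, because the dimension bounds are applied to each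
  perturbed system separately.\<close>

locale degenerate = conformal_gifs G g r \<Delta> c1 \<beta> for G :: "('v, 'a::euclidean_space) gsys" and g r \<Delta> c1 \<beta> :: real +
  fixes Vh :: "'v set" and Eh :: "('v \<times> 'v) set" and Gp :: "real \<Rightarrow> ('v, 'a) gsys" and e0 :: real
  assumes sub: "verts G \<subseteq> Vh" "edges G \<subseteq> Eh" and e0: "0 < e0"
    and graph: "\<And>\<epsilon>. 0 < \<epsilon> \<Longrightarrow> \<epsilon> < e0 \<Longrightarrow> verts (Gp \<epsilon>) = Vh \<and> edges (Gp \<epsilon>) = Eh"
    and sys: "\<And>\<epsilon>. 0 < \<epsilon> \<Longrightarrow> \<epsilon> < e0 \<Longrightarrow> \<exists>g r \<Delta> c. gifs_dist (Gp \<epsilon>) g r \<Delta> c \<beta>"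
    and contr_p: "\<And>\<epsilon>. 0 < \<epsilon> \<Longrightarrow> \<epsilon> < e0 \<Longrightarrow> contractible_cells (Gp \<epsilon>)"
    and sep_p: "\<And>\<epsilon>. 0 < \<epsilon> \<Longrightarrow> \<epsilon> < e0 \<Longrightarrow> strong_separation (Gp \<epsilon>) \<or> conformal (Gp \<epsilon>) \<and> open_set_condition (Gp \<epsilon>)"
    and cells: "\<And>\<epsilon> u x. 0 < \<epsilon> \<Longrightarrow> \<epsilon> < e0 \<Longrightarrow> u \<in> verts G \<Longrightarrow> x \<in> cell (Gp \<epsilon>) u \<Longrightarrow> \<exists>z\<in>cell G u. dist x z \<le> g"
    and maps: "\<And>\<zeta>. 0 < \<zeta> \<Longrightarrow> \<forall>\<^sub>F \<epsilon> in at_right 0. \<forall>v u. (v, u) \<in> edges G \<longrightarrow>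
        (\<forall>x\<in>cell (Gp \<epsilon>) u. dist (emap (Gp \<epsilon>) (v, u) x) (emap G (v, u) x) \<le> \<zeta>)"
    and ders: "\<And>\<eta> v. 0 < \<eta> \<Longrightarrow> v \<in> Vh \<Longrightarrow> \<forall>\<^sub>F \<epsilon> in at_right 0. \<forall>u. (v, u) \<in> Eh \<longrightarrow>
        (\<forall>x\<in>cell (Gp \<epsilon>) u. norm (Der (emap (Gp \<epsilon>) (v, u)) x -
            (if (v, u) \<in> edges G then Der (emap G (v, u)) x else 0)) \<le> \<eta>)"
begin

section \<open>Weights along perturbed and unperturbed orbits\<close>

lemma eventually_admissible: "\<forall>\<^sub>F \<epsilon> in at_right 0. 0 < \<epsilon> \<and> \<epsilon> < e0"
  using e0 by (auto simp: eventually_at_right_field)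

lemma perturbed_emap_cell:
  assumes "0 < \<epsilon>" "\<epsilon> < e0" "(v, u) \<in> Eh" "x \<in> cell (Gp \<epsilon>) u"
  shows "emap (Gp \<epsilon>) (v, u) x \<in> cell (Gp \<epsilon>) v"
proof -
  obtain g' r' \<Delta>' c' where "gifs_dist (Gp \<epsilon>) g' r' \<Delta>' c' \<beta>" using sys[OF assms(1,2)] by blast
  then interpret p: gifs_dist "Gp \<epsilon>" g' r' \<Delta>' c' \<beta> .
  show ?thesis using p.emap_cell graph assms by auto
qed

text \<open>The first factor compares the orbit of a perturbed point with that of a nearby point of
  the unperturbed cell, the second moves within that cell.\<close>

definition shadow_const :: real where
  "shadow_const = dist_const (2 * g) * dist_const (mesh * g)"

lemma shadow_const_ge_1: "1 \<le> shadow_const"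
  using mult_mono[OF dist_const_ge_1[of "2 * g"] dist_const_ge_1[of "mesh * g"]] dist_const_ge_1[of "2 * g"] by (simp add: shadow_const_def)

lemma walk_p: "0 < \<epsilon> \<Longrightarrow> \<epsilon> < e0 \<Longrightarrow> walk G p \<Longrightarrow> walk (Gp \<epsilon>) p"
  using graph[of \<epsilon>] sub by (induction p rule: induct_list012) auto

lemma near_nbhd: "u \<in> verts G \<Longrightarrow> z \<in> cell G u \<Longrightarrow> dist x z \<le> g \<Longrightarrow> x \<in> nbhd G u"
  using nbhd(2)[of u z] by (auto simp: dist_commute subset_iff)

lemma coc_shadow:
  assumes \<epsilon>: "0 < \<epsilon>" "\<epsilon> < e0" and p: "walk G p" "p \<noteq> []" and x: "x \<in> cell (Gp \<epsilon>) (last p)" and z: "z \<in> cell G (last p)"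
    and close: "\<forall>v u. (v, u) \<in> edges G \<longrightarrow>
        (\<forall>x\<in>cell (Gp \<epsilon>) u. dist (emap (Gp \<epsilon>) (v, u) x) (emap G (v, u) x) \<le> (1 - r) * (g * r ^ length p))"
  shows "coc (dn G) (Gp \<epsilon>) p x \<le> shadow_const * coc (dn G) G p z" "coc (dn G) G p z \<le> shadow_const * coc (dn G) (Gp \<epsilon>) p x"
proof -
  \<comment> \<open>The allowed drift is tied to the length of the word: it is at most g r^k after k
    maps, so the orbits are then at most 2 g r^k apart, as \<open>coc_ratio\<close>
    requires.\<close>
  let ?\<kappa> = "g * r ^ length p"
  have vl: "last p \<in> verts G" using walk_last p by blast
  obtain z0 where z0: "z0 \<in> cell G (last p)" "dist x z0 \<le> g" using cells[OF \<epsilon> vl x] by blast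
  have \<kappa>: "0 \<le> ?\<kappa>" "?\<kappa> \<le> g" using g r by (auto simp: mult_le_cancel_left1 power_le_one)
  have *: "pmap (Gp \<epsilon>) q x \<in> nbhd G (hd q) \<and> pmap G q z0 \<in> nbhd G (hd q) \<and>
      dist (pmap (Gp \<epsilon>) q x) (pmap G q z0) \<le> 2 * g * r ^ (length q - 1)" if q: "p = a @ q" "q \<noteq> []" for a q
  proof -
    have w: "walk G q" "last q = last p" using walk_suffix[of a q] q p by auto
    let ?k = "length q - 1"
    have d: "pmap (Gp \<epsilon>) q x \<in> cell (Gp \<epsilon>) (hd q) \<and> dist (pmap (Gp \<epsilon>) q x) (pmap G q z0) \<le> g * r ^ ?k + ?\<kappa> * (1 - r ^ ?k)"
    proof (rule shadow[OF w(1) q(2)])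
      show "z0 \<in> cell G (last q)" "x \<in> cell (Gp \<epsilon>) (last q)" using z0 x w by auto
      show "emap (Gp \<epsilon>) (v, u) y \<in> cell (Gp \<epsilon>) v \<and> dist (emap (Gp \<epsilon>) (v, u) y) (emap G (v, u) y) \<le> (1 - r) * ?\<kappa>"
        if "(v, u) \<in> edges G" "y \<in> cell (Gp \<epsilon>) u" for v u y
        using close that perturbed_emap_cell[OF \<epsilon>, of v u y] sub by blast
    qed (use z0 \<kappa> in auto)
    have rk: "0 \<le> r ^ ?k" "r ^ ?k \<le> 1" using r by (auto simp: power_le_one)
    have zc: "pmap G q z0 \<in> cell G (hd q)" using pmap_cell[OF w(1) q(2)] z0 w by simp
    have hv: "hd q \<in> verts G" using walk_verts'[OF w(1)] q(2) by auto
    have "g * r ^ ?k + ?\<kappa> * (1 - r ^ ?k) \<le> g * r ^ ?k + g * (1 - r ^ ?k)"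
      using \<kappa> rk by (intro add_left_mono mult_right_mono) auto
    then have "dist (pmap (Gp \<epsilon>) q x) (pmap G q z0) \<le> g" using d by (simp add: algebra_simps)
    then have n1: "pmap (Gp \<epsilon>) q x \<in> nbhd G (hd q)" by (rule near_nbhd[OF hv zc])
    have "r ^ length p \<le> r ^ ?k" using r q by (intro power_decreasing) auto
    then have "?\<kappa> * (1 - r ^ ?k) \<le> g * r ^ ?k * 1" using g rk r by (intro mult_mono) auto
    then show ?thesis using d n1 cell_nbhd[OF hv zc] by simp
  qed
  have g2: "0 \<le> 2 * g" using g by simp
  have "coc (dn G) (Gp \<epsilon>) p x \<le> dist_const (2 * g) * coc (dn G) G p z0"
    by (rule coc_ratio[OF p g2]) (use * in auto)
  also have "\<dots> \<le> dist_const (2 * g) * (dist_const (mesh * g) * coc (dn G) G p z)"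
    using dist_const_ge_1[of "2 * g"] by (intro mult_left_mono coc_cell p z z0) auto
  finally show "coc (dn G) (Gp \<epsilon>) p x \<le> shadow_const * coc (dn G) G p z" by (simp add: shadow_const_def mult_ac)
  have "coc (dn G) G p z \<le> dist_const (mesh * g) * coc (dn G) G p z0" by (intro coc_cell p z z0)
  also have "\<dots> \<le> dist_const (mesh * g) * (dist_const (2 * g) * coc (dn G) (Gp \<epsilon>) p x)"
    using dist_const_ge_1[of "mesh * g"]
    by (intro mult_left_mono coc_ratio[OF p g2]) (use * in \<open>auto simp: dist_commute\<close>)
  finally show "coc (dn G) G p z \<le> shadow_const * coc (dn G) (Gp \<epsilon>) p x" by (simp add: shadow_const_def mult_ac)
qed

text \<open>On words of \<open>G\<close> the cocycles are comparable up to
  \<open>shadow_const\<close>; along a new edge the limit weight is 0 and only the additive error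
  remains.\<close>

lemma Wt_perturbed_le:
  assumes \<epsilon>: "0 < \<epsilon>" "\<epsilon> < e0" and t: "0 < t" and w: "w \<noteq> []" and \<eta>: "0 \<le> \<eta>" "\<eta> \<le> 1"
    and close: "\<forall>v u. (v, u) \<in> edges G \<longrightarrow>
        (\<forall>x\<in>cell (Gp \<epsilon>) u. dist (emap (Gp \<epsilon>) (v, u) x) (emap G (v, u) x) \<le> (1 - r) * (g * r ^ Suc (length w)))"
    and der: "\<forall>v\<in>set w. \<forall>u. (v, u) \<in> Eh \<longrightarrow> (\<forall>x\<in>cell (Gp \<epsilon>) u. norm (Der (emap (Gp \<epsilon>) (v, u)) x -
            (if (v, u) \<in> edges G then Der (emap G (v, u)) x else 0)) \<le> \<eta>)"
  shows "Wt t (Gp \<epsilon>) w \<le> ennreal ((2 * shadow_const) powr t) * Wt t G w + ennreal ((2 * (2 ^ length w * \<eta>)) powr t)"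
proof -
  let ?H = "Gp \<epsilon>"
  obtain g' r' \<Delta>' c' where "gifs_dist (Gp \<epsilon>) g' r' \<Delta>' c' \<beta>" using sys[OF \<epsilon>] by blast
  then interpret p: gifs_dist "Gp \<epsilon>" g' r' \<Delta>' c' \<beta> .
  note gr = graph[OF \<epsilon>]
  \<comment> \<open>The limit weight, 0 on new edges in accordance with their constant limit maps.
    It is evaluated along perturbed orbits.\<close>
  define N where "N e x = (if e \<in> edges G then dn G e x else 0)" for e x
  obtain M where M: "0 \<le> M" "Wt t G w = ennreal (M powr t)"
    "\<And>u x. walk G w \<Longrightarrow> w \<noteq> [] \<Longrightarrow> (last w, u) \<in> edges G \<Longrightarrow> x \<in> cell G u \<Longrightarrow> coc (dn G) G (w @ [u]) x \<le> M"
    using Wt_root[OF t, of w] by metis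
  \<comment> \<open>A single vertex is excluded: its cocycle is 1 even if the vertex is not in
    \<open>G\<close>.\<close>
  have N: "coc N ?H q x = (if walk G q then coc (dn G) ?H q x else 0)" if "walk ?H q" "2 \<le> length q" for q x
    using that
  proof (induction q rule: induct_list012)
    case (3 v u q)
    then show ?case using edge_verts(2)[of v u] by (cases q) (auto simp: N_def)
  qed auto
  have "ennreal (coc (dn ?H) ?H (w @ [u]) x powr t) \<le> ennreal ((2 * shadow_const) powr t) * Wt t G w + ennreal ((2 * (2 ^ length w * \<eta>)) powr t)"
    if wk: "walk ?H w" and u: "(last w, u) \<in> Eh" and x: "x \<in> cell ?H u" for u x
  proof -
    have wu: "walk ?H (w @ [u])" using p.walk_snoc[OF w] wk u gr by simp
    have "0 \<le> coc (dn ?H) ?H (w @ [u]) x \<and> coc (dn ?H) ?H (w @ [u]) x \<le> coc N ?H (w @ [u]) x + (2 ^ (length (w @ [u]) - 1) - 1) * \<eta>"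
    proof -
      have "pmap ?H (w @ [u]) x \<in> cell ?H (hd (w @ [u])) \<and> 0 \<le> coc (dn ?H) ?H (w @ [u]) x \<and>
         coc (dn ?H) ?H (w @ [u]) x \<le> coc N ?H (w @ [u]) x + (2 ^ (length (w @ [u]) - 1) - 1) * \<eta> \<and>
         0 \<le> coc N ?H (w @ [u]) x \<and> coc N ?H (w @ [u]) x \<le> 1"
      proof (rule coc_add_le[where S = "set w"])
        fix v' u' y assume e: "(v', u') \<in> edges ?H" "v' \<in> set w" "y \<in> cell ?H u'"
        have d: "norm (Der (emap ?H (v', u')) y - (if (v', u') \<in> edges G then Der (emap G (v', u')) y else 0)) \<le> \<eta>"
          using der e gr by blast
        have "dn ?H (v', u') y \<le> N (v', u') y + \<eta>"
          using d norm_triangle_sub[of "Der (emap ?H (v', u')) y" "if (v', u') \<in> edges G then Der (emap G (v', u')) y else 0"]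
          by (auto simp: dn_def N_def split: if_splits)
        moreover have "N (v', u') y \<le> 1"
        proof (cases "(v', u') \<in> edges G")
          case True
          then obtain z where "z \<in> cell G u'" "dist y z \<le> g" using cells[OF \<epsilon> _ e(3)] edge_verts by blast
          then have "y \<in> nbhd G u'" using near_nbhd edge_verts(2)[OF True] by blast
          then show ?thesis using dn_le[OF True] r True by (simp add: N_def order_trans[of _ r])
        qed (simp add: N_def)
        ultimately show "0 \<le> dn ?H (v', u') y \<and> dn ?H (v', u') y \<le> N (v', u') y + \<eta> \<and> 0 \<le> N (v', u') y \<and> N (v', u') y \<le> 1"
          by (simp add: dn_nonneg N_def)
      qed (use p.emap_cell \<eta> wu x in auto)
      then show ?thesis by blast
    qed
    moreover have "coc N ?H (w @ [u]) x \<le> shadow_const * M"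
    proof (cases "walk G (w @ [u])")
      case True
      then have g1: "walk G w" "(last w, u) \<in> edges G" using walk_snoc[OF w] by auto
      then have uv: "u \<in> verts G" using edge_verts by blast
      have "coc N ?H (w @ [u]) x = coc (dn G) ?H (w @ [u]) x" using N[OF wu, of x] w True by (cases w) auto
      also have "\<dots> \<le> shadow_const * coc (dn G) G (w @ [u]) (base_point u)"
        by (rule coc_shadow(1)[OF \<epsilon> True]) (use x base_point[OF uv] close in auto)
      also have "\<dots> \<le> shadow_const * M" using shadow_const_ge_1 M(3)[OF g1(1) w g1(2) base_point[OF uv]] by (intro mult_left_mono) auto
      finally show ?thesis .
    next
      case False
      then have "coc N ?H (w @ [u]) x = 0" using N[OF wu, of x] w by (cases w) auto
      then show ?thesis using shadow_const_ge_1 M(1) by simp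
    qed
    ultimately have c: "0 \<le> coc (dn ?H) ?H (w @ [u]) x" "coc (dn ?H) ?H (w @ [u]) x \<le> shadow_const * M + (2 ^ length w - 1) * \<eta>"
      by auto
    let ?a = "shadow_const * M" and ?b = "2 ^ length w * \<eta>"
    have ab: "0 \<le> ?a" "0 \<le> ?b" using shadow_const_ge_1 M(1) \<eta> by auto
    have "coc (dn ?H) ?H (w @ [u]) x \<le> max (2 * ?a) (2 * ?b)" using c(2) \<eta> by (simp add: algebra_simps max_def)
    then have "coc (dn ?H) ?H (w @ [u]) x powr t \<le> max (2 * ?a) (2 * ?b) powr t" using c t by (intro powr_mono2) auto
    also have "\<dots> \<le> (2 * ?a) powr t + (2 * ?b) powr t" by (auto simp: max_def)
    also have "(2 * ?a) powr t = (2 * shadow_const) powr t * M powr t" using shadow_const_ge_1 M(1) by (simp add: powr_mult mult_ac)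
    finally show ?thesis unfolding M(2)
      by (simp add: ennreal_mult''[symmetric] ennreal_plus[symmetric] ennreal_leI del: ennreal_plus)
  qed
  then show ?thesis using w gr by (auto simp: Wt_def intro!: SUP_least)
qed

theorem eventually_dim_le:
  assumes P: "has_pressure G (\<lambda>\<omega>. s * pot G \<omega>) 0" and s: "s \<in> I_P Vh Eh Gp" and t: "s < t"
  shows "\<forall>\<^sub>F \<epsilon> in at_right 0. hausdorff_dim (limit_set (Gp \<epsilon>)) \<le> ereal t"
proof -
  obtain e1 where e1: "0 \<le> s" "0 < e1" "(\<Sum>\<^sub>\<infinity>v\<in>Vh. SUP \<epsilon>\<in>{0<..<e1}. SUP u\<in>{u. (v, u) \<in> Eh}. SUP x\<in>cell (Gp \<epsilon>) u.
        ennreal (norm (Der (emap (Gp \<epsilon>) (v, u)) x) powr s)) < \<infinity>"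
    using s unfolding I_P_def by blast
  have t0: "0 < t" using e1 t by simp
  define b where "b v = (SUP \<epsilon>\<in>{0<..<e1}. SUP u\<in>{u. (v, u) \<in> Eh}. SUP x\<in>cell (Gp \<epsilon>) u.
        ennreal (norm (Der (emap (Gp \<epsilon>) (v, u)) x) powr s))" for v
  have b: "infsum b Vh < \<infinity>" using e1(3) unfolding b_def .
  \<comment> \<open>The budget is 1/4 for each of three parts of the perturbed sum: the main terms
    on \<open>W0\<close>, the additive errors on \<open>W0\<close>, and the words outside
    \<open>W0\<close>.\<close>
  have "0 < 1 / (4 * (2 * shadow_const) powr t)" using shadow_const_ge_1 by simp
  from Zsum_eventually_small[OF P e1(1) t this] obtain n where n: "0 < n" "Zsum t G n < ennreal (1 / (4 * (2 * shadow_const) powr t))"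
    by blast
  let ?L = "\<lambda>n. {w. length w = n \<and> set w \<subseteq> Vh}"
  have "(\<Sum>\<^sub>\<infinity>w\<in>?L n. prod_list (map b w)) < \<infinity>"
    using infsum_prod_list_le[of b n Vh] b by (auto intro: le_less_trans simp: power_less_top_ennreal)
  then obtain W0 where W0: "finite W0" "W0 \<subseteq> ?L n" "(\<Sum>\<^sub>\<infinity>w\<in>?L n - W0. prod_list (map b w)) \<le> ennreal (1/4)"
    using infsum_ennreal_tail[of "\<lambda>w. prod_list (map b w)" "?L n" "ennreal (1/4)"] by auto
  \<comment> \<open>One more than the number of words, hence positive; \<eta> is then chosen so that
    each additive error is at most 1 / (4 D).\<close>
  define D where "D = real (card W0) + 1"
  define \<eta> where "\<eta> = min 1 ((1 / (4 * D)) powr (1 / t) / (2 * 2 ^ n))"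
  have D: "0 < D" by (simp add: D_def)
  have \<eta>: "0 < \<eta>" "\<eta> \<le> 1" using D by (auto simp: \<eta>_def)
  have \<eta>t: "(2 * (2 ^ n * \<eta>)) powr t \<le> 1 / (4 * D)"
  proof -
    have "\<eta> \<le> (1 / (4 * D)) powr (1 / t) / (2 * 2 ^ n)" by (simp add: \<eta>_def)
    then have "2 * (2 ^ n * \<eta>) \<le> (1 / (4 * D)) powr (1 / t)" by (simp add: field_simps)
    then have "(2 * (2 ^ n * \<eta>)) powr t \<le> ((1 / (4 * D)) powr (1 / t)) powr t"
      using t0 \<eta> by (intro powr_mono2) auto
    also have "\<dots> = 1 / (4 * D)" using t0 D by (simp add: powr_powr)
    finally show ?thesis .
  qed
  have fin: "finite (\<Union>w\<in>W0. set w)" using W0 by auto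
  have "\<forall>\<^sub>F \<epsilon> in at_right 0. \<forall>v\<in>(\<Union>w\<in>W0. set w). \<forall>u. (v, u) \<in> Eh \<longrightarrow> (\<forall>x\<in>cell (Gp \<epsilon>) u. norm (Der (emap (Gp \<epsilon>) (v, u)) x -
            (if (v, u) \<in> edges G then Der (emap G (v, u)) x else 0)) \<le> \<eta>)"
    by (rule eventually_ball_finite[OF fin]) (use W0 ders[OF \<eta>(1)] in blast)
  moreover have "0 < (1 - r) * (g * r ^ Suc n)" using g r by simp
  then have "\<forall>\<^sub>F \<epsilon> in at_right 0. \<forall>v u. (v, u) \<in> edges G \<longrightarrow>
        (\<forall>x\<in>cell (Gp \<epsilon>) u. dist (emap (Gp \<epsilon>) (v, u) x) (emap G (v, u) x) \<le> (1 - r) * (g * r ^ Suc n))"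
    by (rule maps)
  moreover have "\<forall>\<^sub>F \<epsilon> in at_right 0. \<epsilon> < e1" using e1(2) by (auto simp: eventually_at_right_field)
  ultimately show ?thesis using eventually_admissible
  proof eventually_elim
    case (elim \<epsilon>)
    let ?H = "Gp \<epsilon>"
    have \<epsilon>: "0 < \<epsilon>" "\<epsilon> < e0" using elim by auto
    obtain g' r' \<Delta>' c' where "gifs_dist ?H g' r' \<Delta>' c' \<beta>" using sys[OF \<epsilon>] by blast
    then interpret p: gifs_dist ?H g' r' \<Delta>' c' \<beta> .
    note gr = graph[OF \<epsilon>]
    \<comment> \<open>Derivatives are at most 1 and \<open>s < t\<close>, so the t-th power is below
      the s-th, which \<open>b\<close> bounds uniformly in \<epsilon>.\<close>
    have W1: "Wt t ?H [v] \<le> b v" for v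
    proof -
      have "ennreal (coc (dn ?H) ?H [v, u] x powr t) \<le> b v" if e: "(v, u) \<in> edges ?H" and x: "x \<in> cell ?H u" for u x
      proof -
        have xn: "x \<in> nbhd ?H u" using p.cell_nbhd p.edge_verts(2)[OF e] x by blast
        have "dn ?H (v, u) x \<le> 1" using p.dn_le[OF e xn] p.r by simp
        then have "coc (dn ?H) ?H [v, u] x powr t \<le> norm (Der (emap ?H (v, u)) x) powr s"
          using t by (simp add: dn_def powr_mono')
        then have "ennreal (coc (dn ?H) ?H [v, u] x powr t) \<le> ennreal (norm (Der (emap ?H (v, u)) x) powr s)" by (rule ennreal_leI)
        also have "\<dots> \<le> b v" unfolding b_def
          using e x elim gr by (auto intro!: SUP_upper2[of \<epsilon>] SUP_upper2[of u] SUP_upper2[of x])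
        finally show ?thesis .
      qed
      then show ?thesis by (auto simp: Wt_def intro!: SUP_least)
    qed
    have Wb: "Wt t ?H w \<le> prod_list (map b w)" for w
    proof (induction w)
      case (Cons v w)
      have "Wt t ?H (v # w) \<le> Wt t ?H [v] * Wt t ?H w" using p.Wt_append[of t "[v]" w] by simp
      also have "\<dots> \<le> b v * prod_list (map b w)" by (intro mult_mono W1 Cons) auto
      finally show ?case by simp
    qed (simp add: Wt_def)
    have Z1: "Zsum t ?H 1 < \<infinity>"
    proof -
      have "Zsum t ?H 1 \<le> (\<Sum>\<^sub>\<infinity>w\<in>?L 1. prod_list (map b w))"
        unfolding Zsum_def using gr by (intro infsum_ennreal_mono Wb) auto
      also have "\<dots> \<le> infsum b Vh ^ 1" by (rule infsum_prod_list_le)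
      finally show ?thesis using b by simp
    qed
    have "Zsum t ?H n \<le> infsum (Wt t ?H) (W0 \<union> (?L n - W0))"
      unfolding Zsum_def using gr by (intro infsum_ennreal_mono) auto
    also have "\<dots> \<le> infsum (Wt t ?H) W0 + infsum (Wt t ?H) (?L n - W0)" by (rule infsum_ennreal_Un_le)
    also have "infsum (Wt t ?H) (?L n - W0) \<le> ennreal (1/4)"
      by (rule order_trans[OF infsum_ennreal_mono[OF order_refl Wb] W0(3)])
    also have "infsum (Wt t ?H) W0 = (\<Sum>w\<in>W0. Wt t ?H w)" using W0(1) by simp
    also have "(\<Sum>w\<in>W0. Wt t ?H w) \<le> (\<Sum>w\<in>W0. ennreal ((2 * shadow_const) powr t) * Wt t G w + ennreal (1 / (4 * D)))"
    proof (rule sum_mono)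
      fix w assume w: "w \<in> W0"
      then have len: "length w = n" "w \<noteq> []" using W0(2) n by auto
      have "Wt t ?H w \<le> ennreal ((2 * shadow_const) powr t) * Wt t G w + ennreal ((2 * (2 ^ length w * \<eta>)) powr t)"
        by (rule Wt_perturbed_le[OF \<epsilon> t0 len(2)]) (use elim \<eta> w len in auto)
      also have "\<dots> \<le> ennreal ((2 * shadow_const) powr t) * Wt t G w + ennreal (1 / (4 * D))"
        using \<eta>t len by (intro add_left_mono ennreal_leI) simp
      finally show "Wt t ?H w \<le> ennreal ((2 * shadow_const) powr t) * Wt t G w + ennreal (1 / (4 * D))" .
    qed
    also have "\<dots> = ennreal ((2 * shadow_const) powr t) * (\<Sum>w\<in>W0. Wt t G w) + of_nat (card W0) * ennreal (1 / (4 * D))"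
      by (simp add: sum.distrib sum_distrib_left)
    also have "of_nat (card W0) * ennreal (1 / (4 * D)) \<le> ennreal (1/4)"
    proof -
      have "of_nat (card W0) * ennreal (1 / (4 * D)) = ennreal (real (card W0) * (1 / (4 * D)))"
        using D by (subst ennreal_mult'') (auto simp: ennreal_of_nat_eq_real_of_nat)
      also have "real (card W0) * (1 / (4 * D)) \<le> 1/4" using D by (simp add: D_def field_simps)
      finally show ?thesis by (simp add: ennreal_leI)
    qed
    also have "(\<Sum>w\<in>W0. Wt t G w) \<le> Zsum t G n"
    proof -
      have "(\<Sum>w\<in>W0. Wt t G w) = (\<Sum>w\<in>{w\<in>W0. walk G w}. Wt t G w)"
        using W0(1) by (intro sum.mono_neutral_right) (auto simp: Wt_def)
      also have "\<dots> \<le> Zsum t G n"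
        unfolding Zsum_def using W0 walk_verts' by (intro sum_le_infsum_ennreal) auto
      finally show ?thesis .
    qed
    also have "ennreal ((2 * shadow_const) powr t) * Zsum t G n \<le> ennreal ((2 * shadow_const) powr t) * ennreal (1 / (4 * (2 * shadow_const) powr t))"
      using n(2) by (intro mult_left_mono) auto
    also have "\<dots> = ennreal (1/4)" using shadow_const_ge_1 by (subst ennreal_mult''[symmetric]) auto
    finally have "Zsum t ?H n \<le> ennreal (1/4) + ennreal (1/4) + ennreal (1/4)"
      by (simp add: add_right_mono add_mono mult_left_mono)
    also have "\<dots> = ennreal (3/4)" 
    proof -
      have "ennreal (1/4 + 1/4 + 1/4) = ennreal (1/4 + 1/4) + ennreal (1/4)" by (rule ennreal_plus) auto
      also have "ennreal (1/4 + 1/4) = ennreal (1/4) + ennreal (1/4)" by (rule ennreal_plus) auto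
      finally show ?thesis by simp
    qed
    also have "\<dots> < 1" by (simp add: ennreal_less_one_iff)
    finally show ?case using p.hausdorff_dim_le[OF contr_p[OF \<epsilon>] t0 Z1 n(1)] by simp
  qed
qed

text \<open>Only the finitely many edges between vertices of the chosen loops matter, and on them
  the derivatives of \<open>G\<close> near the cells are bounded away from 0. A small additive error
  is therefore a small relative one, and the smallest stretching factors of the perturbed maps stay
  close to the norms in the conformal limit.\<close>

theorem eventually_dim_ge:
  assumes P: "has_pressure G (\<lambda>\<omega>. s * pot G \<omega>) 0" and s: "0 < t" "t < s" and Z: "Zsum s G 1 < \<infinity>"
  shows "\<forall>\<^sub>F \<epsilon> in at_right 0. ereal t \<le> hausdorff_dim (limit_set (Gp \<epsilon>))"
proof -
  \<comment> \<open>Besides \<open>shadow_const\<close> the threshold contains a 2 for the loss in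
    \<open>1/2 \<le> a ^ n\<close> and a 2 for strictness.\<close>
  obtain v n L where L: "v \<in> verts G" "0 < n" "finite L" "L \<subseteq> loops G v n"
    "(4 * shadow_const) powr t < (\<Sum>l\<in>L. coc (dn G) G (l @ [v]) (base_point v) powr t)"
    by (rule heavy_loops[OF P Z s(2), where C = "(4 * shadow_const) powr t"]) (use s in auto)
  have C0: "0 < shadow_const" using shadow_const_ge_1 by simp
  define \<rho> where "\<rho> l = coc (dn G) G (l @ [v]) (base_point v) / (4 * shadow_const)" for l
  have w: "walk G (l @ [v])" "length l = n" if "l \<in> L" for l using that L(4) by (auto simp: loops_def)
  have pos: "0 < coc (dn G) G (l @ [v]) (base_point v)" if "l \<in> L" for l
    using coc_pos[OF w(1)[OF that]] base_point[OF L(1)] cell_nbhd[OF L(1)] by simp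
  have sum: "(\<Sum>l\<in>L. \<rho> l powr t) = (\<Sum>l\<in>L. coc (dn G) G (l @ [v]) (base_point v) powr t) / (4 * shadow_const) powr t"
    unfolding \<rho>_def sum_divide_distrib using C0 by (intro sum.cong refl powr_divide)
  define S where "S = (\<Union>l\<in>L. set (l @ [v]))"
  have fS: "finite S" using L by (auto simp: S_def)
  have SV: "S \<subseteq> verts G" unfolding S_def by (rule UN_least) (rule walk_verts'[OF w(1)])
  \<comment> \<open>The factor retained by each map; by the Bernoulli inequality n of them leave at
    least one half.\<close>
  define a where "a = 1 - 1 / (2 * real n)"
  have a: "0 \<le> a" "1/2 \<le> a ^ n"
  proof -
    show "0 \<le> a" using L(2) by (simp add: a_def field_simps)
    have "1 + real n * (- 1 / (2 * real n)) \<le> (1 + (- 1 / (2 * real n))) ^ n"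
      by (rule Bernoulli_inequality) (use L(2) in \<open>simp add: field_simps\<close>)
    then show "1/2 \<le> a ^ n" using L(2) by (simp add: a_def)
  qed
  define K where "K = dist_const g * dist_const (mesh * g)"
  have K: "0 < K" using dist_const_ge_1[of g] dist_const_ge_1[of "mesh * g"] by (simp add: K_def)
  \<comment> \<open>Two distortion steps bound the derivative at every point within \<open>g\<close>
    of the cell by its value at the base point, independently of the perturbed orbit.\<close>
  have low: "dn G (v', u) (base_point u) / K \<le> dn G (v', u) y"
    if e: "(v', u) \<in> edges G" and z: "z \<in> cell G u" "dist y z \<le> g" for v' u y z
  proof -
    have wk: "walk G [v', u]" using e edge_verts by simp
    have "dn G (v', u) (base_point u) \<le> dist_const (mesh * g) * dn G (v', u) z"
      using coc_cell[OF wk, of z "base_point u"] z base_point[OF edge_verts(2)[OF e]] by simp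
    also have "\<dots> \<le> dist_const (mesh * g) * (dist_const g * dn G (v', u) y)"
      using coc_near(2)[OF wk, of z y] z dist_const_ge_1[of "mesh * g"] by (intro mult_left_mono) (auto simp: dist_commute)
    finally show ?thesis using K by (simp add: K_def field_simps)
  qed
  let ?ES = "edges G \<inter> S \<times> S"
  obtain \<mu> where \<mu>: "0 < \<mu>" "\<And>e. e \<in> ?ES \<Longrightarrow> \<mu> \<le> dn G e (base_point (snd e)) / K"
  proof (rule finite_uniform_pos[where I = ?ES and P = "\<lambda>e d. d \<le> dn G e (base_point (snd e)) / K"])
    show "finite ?ES" using fS by simp
    fix e assume e: "e \<in> ?ES"
    then have "0 < dn G e (base_point (snd e))"
      using dn_pos[of "fst e" "snd e"] base_point cell_nbhd edge_verts[of "fst e" "snd e"] by (auto simp: prod.collapse)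
    then show "\<exists>d>0. d \<le> dn G e (base_point (snd e)) / K" using K by (intro exI[of _ "dn G e (base_point (snd e)) / K"]) auto
  qed auto
  \<comment> \<open>At most the fraction 1 / (2 n) of any derivative that is at least \<mu>, which
    is exactly the loss allowed by \<open>a\<close>.\<close>
  define \<eta> where "\<eta> = \<mu> / (2 * real n)"
  have \<eta>: "0 < \<eta>" using \<mu> L(2) by (simp add: \<eta>_def)
  have "\<forall>\<^sub>F \<epsilon> in at_right 0. \<forall>v\<in>S. \<forall>u. (v, u) \<in> Eh \<longrightarrow> (\<forall>x\<in>cell (Gp \<epsilon>) u. norm (Der (emap (Gp \<epsilon>) (v, u)) x -
            (if (v, u) \<in> edges G then Der (emap G (v, u)) x else 0)) \<le> \<eta>)"
    by (rule eventually_ball_finite[OF fS]) (use SV sub ders[OF \<eta>] in blast)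
  moreover have "0 < (1 - r) * (g * r ^ Suc n)" using g r by simp
  then have "\<forall>\<^sub>F \<epsilon> in at_right 0. \<forall>v u. (v, u) \<in> edges G \<longrightarrow>
        (\<forall>x\<in>cell (Gp \<epsilon>) u. dist (emap (Gp \<epsilon>) (v, u) x) (emap G (v, u) x) \<le> (1 - r) * (g * r ^ Suc n))"
    by (rule maps)
  ultimately show ?thesis using eventually_admissible
  proof eventually_elim
    case (elim \<epsilon>)
    let ?H = "Gp \<epsilon>"
    have \<epsilon>: "0 < \<epsilon>" "\<epsilon> < e0" using elim by auto
    obtain g' r' \<Delta>' c' where gd: "gifs_dist ?H g' r' \<Delta>' c' \<beta>" using sys[OF \<epsilon>] by blast
    then interpret p: gifs_dist ?H g' r' \<Delta>' c' \<beta> .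
    note gr = graph[OF \<epsilon>]
    have scale: "walk G q \<Longrightarrow> q \<noteq> [] \<Longrightarrow> set q \<subseteq> S \<Longrightarrow> x \<in> cell ?H (last q) \<Longrightarrow>
        a ^ (length q - 1) * coc (dn G) ?H q x \<le> coc (dl ?H) ?H q x" for q x
    proof (induction q rule: induct_list012)
      case (3 v' u q)
      let ?y = "pmap ?H (u # q) x"
      have e: "(v', u) \<in> edges G" "v' \<in> S" "u \<in> S" using 3 by auto
      have y: "?y \<in> cell ?H u" using p.pmap_cell[OF walk_p[OF \<epsilon>, of "u # q"], of x] 3 by simp
      obtain z where z: "z \<in> cell G u" "dist ?y z \<le> g" using cells[OF \<epsilon> edge_verts(2)[OF e(1)] y] by blast
      have yn: "?y \<in> nbhd G u" using near_nbhd[OF edge_verts(2)[OF e(1)] z] .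
      have "norm (Der (emap ?H (v', u)) ?y - Der (emap G (v', u)) ?y) \<le> \<eta>"
      proof -
        have "(v', u) \<in> Eh" using e(1) sub by blast
        then have "norm (Der (emap ?H (v', u)) ?y - (if (v', u) \<in> edges G then Der (emap G (v', u)) ?y else 0)) \<le> \<eta>"
          using elim(1) e(2) y by blast
        then show ?thesis using e(1) by simp
      qed
      then have "dn G (v', u) ?y - \<eta> \<le> dl ?H (v', u) ?y"
        unfolding dl_def dn_def using conformal_edge(1)[OF e(1) yn] by (intro lnorm_perturb) (auto simp: dn_def)
      moreover have "\<eta> \<le> dn G (v', u) ?y / (2 * real n)"
        unfolding \<eta>_def using \<mu>(2)[of "(v', u)"] low[OF e(1) z] e by (intro divide_right_mono) auto
      ultimately have "a * dn G (v', u) ?y \<le> dl ?H (v', u) ?y" by (simp add: a_def algebra_simps)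
      moreover have "a ^ (length (u # q) - 1) * coc (dn G) ?H (u # q) x \<le> coc (dl ?H) ?H (u # q) x" using 3 by auto
      ultimately have "(a * dn G (v', u) ?y) * (a ^ length q * coc (dn G) ?H (u # q) x) \<le> dl ?H (v', u) ?y * coc (dl ?H) ?H (u # q) x"
        using a(1) by (intro mult_mono) (auto simp: dl_def lnorm_nonneg coc_dn_nonneg)
      then show ?case by (simp add: mult_ac)
    qed auto
    have li: "loop_ifs ?H g' r' \<Delta>' v n L \<rho> t"
    proof unfold_locales
      show "v \<in> verts ?H" using L(1) gr sub by auto
      show "L \<noteq> {}" using L(5) powr_ge_zero[of "4 * shadow_const" t] by auto
      show "L \<subseteq> loops ?H v n" using L(4) walk_p[OF \<epsilon>] by (auto simp: loops_def)
      show "0 < \<rho> l" if "l \<in> L" for l using pos[OF that] C0 by (simp add: \<rho>_def)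
      show "\<rho> l < coc (dl ?H) ?H (l @ [v]) x" if l: "l \<in> L" and x: "x \<in> cell ?H v" for l x
      proof -
        let ?p = "l @ [v]"
        have "coc (dn G) G ?p (base_point v) \<le> shadow_const * coc (dn G) ?H ?p x"
          by (rule coc_shadow(2)[OF \<epsilon> w(1)[OF l]]) (use x base_point[OF L(1)] elim w(2)[OF l] in auto)
        then have "\<rho> l < coc (dn G) ?H ?p x / 2" using pos[OF l] C0 by (simp add: \<rho>_def field_simps)
        also have "\<dots> \<le> a ^ n * coc (dn G) ?H ?p x"
          using a(2) mult_right_mono[of "1/2" "a ^ n" "coc (dn G) ?H ?p x"] coc_dn_nonneg[of G ?H ?p x] by simp
        also have "\<dots> \<le> coc (dl ?H) ?H ?p x"
        proof -
          have "set (l @ [v]) \<subseteq> S" using l unfolding S_def by blast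
          from scale[OF w(1)[OF l] _ this, of x] show ?thesis using x w(2)[OF l] by simp
        qed
        finally show ?thesis .
      qed
      show "1 \<le> (\<Sum>l\<in>L. \<rho> l powr t)" unfolding sum using L(5) C0 by (simp add: field_simps)
    qed (use L s in auto)
    show ?case
    proof (cases "strong_separation ?H")
      case True
      then show ?thesis by (rule loop_ifs.dim_ge_strong_separation[OF li])
    next
      case False
      then have c: "conformal ?H" "open_set_condition ?H" using sep_p[OF \<epsilon>] by auto
      have "dl ?H (v, u) x = dn ?H (v, u) x" if e: "(v, u) \<in> edges ?H" "x \<in> nbhd ?H u" for v u x
      proof -
        have "conformal_on (emap ?H (v, u)) (nbhd ?H u)" using c(1) e(1) unfolding conformal_def by fastforce
        from conformal_onD(1)[OF this e(2)] show ?thesis unfolding dl_def dn_def by (rule lnorm_eq_normI)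
      qed
      then have "conformal_loop_ifs ?H g' r' \<Delta>' v n L \<rho> t c' \<beta>"
        using li gd c by (intro conformal_loop_ifs.intro conformal_loop_ifs_axioms.intro) auto
      then show ?thesis by (rule conformal_loop_ifs.dim_ge_open_set_condition)
    qed
  qed
qed

end

section \<open>Continuity of the dimension\<close>

lemma gifs_distI:
  assumes "gifs G g r \<Delta>" "0 < c" "0 < \<beta>"
    and "\<forall>e\<in>edges G. \<forall>x\<in>nbhd G (snd e). \<forall>y\<in>nbhd G (snd e).
        \<bar>norm (Der (emap G e) x) - norm (Der (emap G e) y)\<bar> \<le> c * norm (Der (emap G e) x) * norm (x - y) powr \<beta>"
  shows "gifs_dist G g r \<Delta> c \<beta>"
proof (intro gifs_dist.intro gifs_dist_axioms.intro assms)
  fix v u x y assume "(v, u) \<in> edges G" "x \<in> nbhd G u" "y \<in> nbhd G u"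
  then show "\<bar>dn G (v, u) x - dn G (v, u) y\<bar> \<le> c * dn G (v, u) x * norm (x - y) powr \<beta>"
    using assms(4) unfolding dn_def by fastforce
qed

lemma simple_gifs_imp_gifs_dist:
  assumes G: "simple_gifs G" and c: "0 < c" "0 < \<beta>"
    and d: "\<forall>e\<in>edges G. \<forall>x\<in>nbhd G (snd e). \<forall>y\<in>nbhd G (snd e).
        \<bar>norm (Der (emap G e) x) - norm (Der (emap G e) y)\<bar> \<le> c * norm (Der (emap G e) x) * norm (x - y) powr \<beta>"
  shows "\<exists>g r \<Delta>. gifs_dist G g r \<Delta> c \<beta>"
proof -
  have "0 < gap G" using G unfolding simple_gifs_def by blast
  then obtain y where y: "0 < y" "y < gap G" using dense by blast
  then obtain g where g: "y = ennreal g" "0 \<le> g" by (cases y) auto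
  with y have "0 < g" "ennreal g < gap G" by auto
  with G obtain r \<Delta> where "gifs G g r \<Delta>" by (rule simple_gifs_imp_gifs)
  then show ?thesis using gifs_distI[OF _ c d] by blast
qed

lemma conformal_gifsI:
  assumes "gifs_dist G g r \<Delta> c \<beta>" "conformal G" "contractible_cells G"
  shows "conformal_gifs G g r \<Delta> c \<beta>"
proof -
  interpret gifs_dist G g r \<Delta> c \<beta> by fact
  have "0 < dn G (v, u) x" if e: "(v, u) \<in> edges G" "x \<in> nbhd G u" for v u x
  proof -
    have "conformal_on (emap G (v, u)) (nbhd G u)" using assms(2) e(1) unfolding conformal_def by fastforce
    from conformal_onD(2)[OF this e(2)] show ?thesis by (simp add: dn_def)
  qed
  then show ?thesis
    using assms contractible_live[OF assms(3)]
    by (intro conformal_gifs.intro conformal_gifs_axioms.intro gifs_conf.intro gifs_conf_axioms.intro) auto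
qed

text \<open>The constant that bounds the distance of perturbed cells from the sets \<open>Jh\<close>
  also serves as the radius \<open>g\<close> of the unperturbed system; it is admissible because it
  is smaller than the gap.\<close>

lemma degenerate_perturbation_imp_degenerate:
  fixes G :: "('v, 'a::euclidean_space) gsys"
  assumes G: "simple_gifs G" "conformal G" "0 < \<beta>" "bounded_distortion \<beta> G" "contractible_cells G"
    and dp: "degenerate_perturbation \<beta> G Vh Eh Gp"
    and p: "\<forall>\<epsilon>\<in>{0<..<1}. contractible_cells (Gp \<epsilon>) \<and>
           (strong_separation (Gp \<epsilon>) \<or> conformal (Gp \<epsilon>) \<and> open_set_condition (Gp \<epsilon>))"
  obtains g r \<Delta> c1 e0 where "degenerate G g r \<Delta> c1 \<beta> Vh Eh Gp e0"
proof -
  have sub: "verts G \<subseteq> Vh" "edges G \<subseteq> Eh"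
    and sys: "\<And>\<epsilon>. \<epsilon> \<in> {0<..<1} \<Longrightarrow> simple_gifs (Gp \<epsilon>) \<and> verts (Gp \<epsilon>) = Vh \<and> edges (Gp \<epsilon>) = Eh"
    using dp unfolding degenerate_perturbation_def by blast+
  obtain c4 where c4: "0 < c4" "\<forall>\<epsilon>\<in>{0<..<1}. \<forall>e\<in>Eh. \<forall>x\<in>nbhd (Gp \<epsilon>) (snd e). \<forall>y\<in>nbhd (Gp \<epsilon>) (snd e).
        \<bar>norm (Der (emap (Gp \<epsilon>) e) x) - norm (Der (emap (Gp \<epsilon>) e) y)\<bar>
          \<le> c4 * norm (Der (emap (Gp \<epsilon>) e) x) * norm (x - y) powr \<beta>"
    using dp unfolding degenerate_perturbation_def by blast
  note shape = dp[unfolded degenerate_perturbation_def, THEN conjunct2, THEN conjunct2, THEN conjunct2, THEN conjunct2, THEN conjunct1]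
  obtain Jh a T where limits: "(\<forall>v\<in>verts G. Jh v = cell G v) \<and>
        (\<forall>v\<in>Vh - verts G. compact (Jh v) \<and> connected (Jh v)) \<and>
        (SUP v\<in>Vh. ennreal (diameter (Jh v))) < \<infinity> \<and>
        (\<exists>c3>0. ennreal c3 < gap G \<and>
           (\<exists>\<epsilon>0>0. \<forall>\<epsilon>\<in>{0<..<\<epsilon>0}. \<forall>v\<in>Vh. cell (Gp \<epsilon>) v \<subseteq> (\<Union>y\<in>Jh v. ball y c3))) \<and>
        (\<forall>v\<in>Vh. a v \<in> Jh v) \<and>
        (\<forall>e\<in>Eh. T e = (if e \<in> edges G then emap G e else (\<lambda>x. a (fst e)))) \<and>
        ((\<lambda>\<epsilon>. SUP e\<in>Eh. SUP x\<in>cell (Gp \<epsilon>) (snd e).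
            ennreal (norm (emap (Gp \<epsilon>) e x - T e x))) \<longlongrightarrow> 0) (at_right 0) \<and>
        (\<forall>v\<in>Vh. ((\<lambda>\<epsilon>. SUP e\<in>{e\<in>Eh. fst e = v}. SUP x\<in>cell (Gp \<epsilon>) (snd e).
            ennreal (norm (Der (emap (Gp \<epsilon>) e) x - Der (T e) x))) \<longlongrightarrow> 0) (at_right 0))"
    using shape by (elim exE) (rule that)
  note Jh = limits[THEN conjunct1]
  note c3ex = limits[THEN conjunct2, THEN conjunct2, THEN conjunct2, THEN conjunct1]
  note T = limits[THEN conjunct2, THEN conjunct2, THEN conjunct2, THEN conjunct2, THEN conjunct2, THEN conjunct1]
  note Tmap = limits[THEN conjunct2, THEN conjunct2, THEN conjunct2, THEN conjunct2, THEN conjunct2, THEN conjunct2, THEN conjunct1]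
  note Tder = limits[THEN conjunct2, THEN conjunct2, THEN conjunct2, THEN conjunct2, THEN conjunct2, THEN conjunct2, THEN conjunct2]
  obtain g e1 where g: "0 < g" "ennreal g < gap G" and e1: "0 < e1"
    and near: "\<And>\<epsilon> v. \<epsilon> \<in> {0<..<e1} \<Longrightarrow> v \<in> Vh \<Longrightarrow> cell (Gp \<epsilon>) v \<subseteq> (\<Union>y\<in>Jh v. ball y g)"
    using c3ex by blast
  obtain r \<Delta> where gi: "gifs G g r \<Delta>" by (rule simple_gifs_imp_gifs[OF G(1) g])
  obtain c1 where c1: "0 < c1" "\<forall>e\<in>edges G. \<forall>x\<in>nbhd G (snd e). \<forall>y\<in>nbhd G (snd e).
        \<bar>norm (Der (emap G e) x) - norm (Der (emap G e) y)\<bar> \<le> c1 * norm (Der (emap G e) x) * norm (x - y) powr \<beta>"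
    using G(4) unfolding bounded_distortion_def by blast
  have cg: "conformal_gifs G g r \<Delta> c1 \<beta>"
    by (rule conformal_gifsI[OF gifs_distI[OF gi c1(1) G(3) c1(2)] G(2,5)])
  have "degenerate G g r \<Delta> c1 \<beta> Vh Eh Gp (min e1 1)"
  proof (intro degenerate.intro degenerate_axioms.intro cg sub)
    show "0 < min e1 1" using e1 by simp
    show "\<exists>g r \<Delta> c. gifs_dist (Gp \<epsilon>) g r \<Delta> c \<beta>" if "0 < \<epsilon>" "\<epsilon> < min e1 1" for \<epsilon>
    proof -
      have \<epsilon>: "\<epsilon> \<in> {0<..<1}" using that by simp
      have "\<exists>g r \<Delta>. gifs_dist (Gp \<epsilon>) g r \<Delta> c4 \<beta>"
        by (rule simple_gifs_imp_gifs_dist) (use sys[OF \<epsilon>] c4 \<epsilon> G(3) in auto)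
      then show ?thesis by blast
    qed
    show "\<exists>z\<in>cell G u. dist x z \<le> g" if "0 < \<epsilon>" "\<epsilon> < min e1 1" "u \<in> verts G" "x \<in> cell (Gp \<epsilon>) u" for \<epsilon> u x
    proof -
      have "u \<in> Vh" "\<epsilon> \<in> {0<..<e1}" using that sub by auto
      then have "x \<in> (\<Union>y\<in>Jh u. ball y g)" using near[of \<epsilon> u] that(4) by blast
      then show ?thesis using bspec[OF Jh that(3)] by (auto simp: dist_commute intro: less_imp_le)
    qed
    show "\<forall>\<^sub>F \<epsilon> in at_right 0. \<forall>v u. (v, u) \<in> edges G \<longrightarrow>
        (\<forall>x\<in>cell (Gp \<epsilon>) u. dist (emap (Gp \<epsilon>) (v, u) x) (emap G (v, u) x) \<le> \<zeta>)" if \<zeta>: "0 < \<zeta>" for \<zeta>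
    proof -
      have "\<forall>\<^sub>F \<epsilon> in at_right 0. (SUP e\<in>Eh. SUP x\<in>cell (Gp \<epsilon>) (snd e). ennreal (norm (emap (Gp \<epsilon>) e x - T e x))) < ennreal \<zeta>"
        using \<zeta> by (intro order_tendstoD(2)[OF Tmap]) simp
      then show ?thesis
      proof eventually_elim
        case (elim \<epsilon>)
        show ?case
        proof (intro allI impI ballI)
          fix v u x assume e: "(v, u) \<in> edges G" and x: "x \<in> cell (Gp \<epsilon>) u"
          have eh: "(v, u) \<in> Eh" using e sub by blast
          have "ennreal (norm (emap (Gp \<epsilon>) (v, u) x - T (v, u) x)) \<le>
              (SUP e\<in>Eh. SUP x\<in>cell (Gp \<epsilon>) (snd e). ennreal (norm (emap (Gp \<epsilon>) e x - T e x)))"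
            by (rule SUP_upper2[OF eh], rule SUP_upper2[of x]) (use x in auto)
          then have "ennreal (norm (emap (Gp \<epsilon>) (v, u) x - T (v, u) x)) < ennreal \<zeta>" using elim by order
          then show "dist (emap (Gp \<epsilon>) (v, u) x) (emap G (v, u) x) \<le> \<zeta>"
            using bspec[OF T eh] e \<zeta> by (simp add: dist_norm ennreal_less_iff)
        qed
      qed
    qed
    show "\<forall>\<^sub>F \<epsilon> in at_right 0. \<forall>u. (v, u) \<in> Eh \<longrightarrow> (\<forall>x\<in>cell (Gp \<epsilon>) u. norm (Der (emap (Gp \<epsilon>) (v, u)) x -
            (if (v, u) \<in> edges G then Der (emap G (v, u)) x else 0)) \<le> \<eta>)" if \<eta>: "0 < \<eta>" and v: "v \<in> Vh" for \<eta> v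
    proof -
      have "\<forall>\<^sub>F \<epsilon> in at_right 0. (SUP e\<in>{e\<in>Eh. fst e = v}. SUP x\<in>cell (Gp \<epsilon>) (snd e).
            ennreal (norm (Der (emap (Gp \<epsilon>) e) x - Der (T e) x))) < ennreal \<eta>"
        using \<eta> by (intro order_tendstoD(2)[OF bspec[OF Tder v]]) simp
      then show ?thesis
      proof eventually_elim
        case (elim \<epsilon>)
        show ?case
        proof (intro allI impI ballI)
          fix u x assume e: "(v, u) \<in> Eh" and x: "x \<in> cell (Gp \<epsilon>) u"
          have "ennreal (norm (Der (emap (Gp \<epsilon>) (v, u)) x - Der (T (v, u)) x)) \<le>
              (SUP e\<in>{e\<in>Eh. fst e = v}. SUP x\<in>cell (Gp \<epsilon>) (snd e). ennreal (norm (Der (emap (Gp \<epsilon>) e) x - Der (T e) x)))"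
            by (rule SUP_upper2[of "(v, u)"], use e in simp, rule SUP_upper2[of x]) (use x in auto)
          then have "ennreal (norm (Der (emap (Gp \<epsilon>) (v, u)) x - Der (T (v, u)) x)) < ennreal \<eta>" using elim by order
          then have "norm (Der (emap (Gp \<epsilon>) (v, u)) x - Der (T (v, u)) x) \<le> \<eta>" using \<eta> by (simp add: ennreal_less_iff)
          moreover have "Der (T (v, u)) x = (if (v, u) \<in> edges G then Der (emap G (v, u)) x else 0)"
            using bspec[OF T e] by simp
          ultimately show "norm (Der (emap (Gp \<epsilon>) (v, u)) x - (if (v, u) \<in> edges G then Der (emap G (v, u)) x else 0)) \<le> \<eta>"
            by simp
        qed
      qed
    qed
  qed (use sys p in auto)
  then show thesis by (rule that)
qed

lemma ereal_le_if_all_greater: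
  assumes "\<And>t. s < t \<Longrightarrow> x \<le> ereal t"
  shows "x \<le> ereal s"
proof (rule dense_ge)
  fix y assume "ereal s < y"
  then obtain t where "ereal s < ereal t" "ereal t < y" using ereal_dense2 by blast
  then show "x \<le> y" using assms[of t] by (simp add: order.trans less_imp_le)
qed

lemma ereal_ge_if_all_less:
  assumes "0 \<le> x" "\<And>t. 0 < t \<Longrightarrow> t < s \<Longrightarrow> ereal t \<le> x"
  shows "ereal s \<le> x"
proof (cases "0 < s")
  case True
  show ?thesis
  proof (rule dense_le_bounded[of 0])
    show "0 < ereal s" using True by simp
    fix y assume y: "0 < y" "y < ereal s"
    then obtain t where "y = ereal t" by (cases y) auto
    then show "y \<le> x" using assms(2)[of t] y by simp
  qed
next
  case False
  then have "ereal s \<le> 0" by simp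
  then show ?thesis using assms(1) by (rule order_trans)
qed

theorem theorem3p11:
  fixes G :: "('v, 'a::euclidean_space) gsys"
    and Vh :: "'v set" and Eh :: "('v \<times> 'v) set"
    and Gp :: "real \<Rightarrow> ('v, 'a) gsys"
    and \<beta> :: real
  assumes "simple_gifs G"
    and "\<exists>V0 E0. strongly_connected_component (verts G) (edges G) V0 E0"
    and "conformal G"
    and "0 < \<beta>" and "\<beta> \<le> 1" and "bounded_distortion \<beta> G"
    and "V_summable G"
    and "contractible_cells G"
    and "strong_separation G \<or> open_set_condition G"
    and "degenerate_perturbation \<beta> G Vh Eh Gp"
    and "uniform_inverse_distortion \<beta> Eh Gp"
    and "\<forall>\<epsilon>\<in>{0<..<1}. V_summable (Gp \<epsilon>) \<and> contractible_cells (Gp \<epsilon>) \<and>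
           (strong_separation (Gp \<epsilon>) \<or> conformal (Gp \<epsilon>) \<and> open_set_condition (Gp \<epsilon>))"
  shows "((\<exists>s0. has_pressure G (\<lambda>\<omega>. s0 * pot G \<omega>) 0 \<and> s0 \<in> I_P Vh Eh Gp) \<longrightarrow>
            Limsup (at_right 0) (\<lambda>\<epsilon>. hausdorff_dim (limit_set (Gp \<epsilon>))) \<le> hausdorff_dim (limit_set G)) \<and>
         ((\<exists>s p. has_pressure G (\<lambda>\<omega>. s * pot G \<omega>) p \<and> 0 < p \<and> p < \<infinity> \<and> s \<in> I_P_low Vh Eh Gp) \<longrightarrow>
            hausdorff_dim (limit_set G) \<le> Liminf (at_right 0) (\<lambda>\<epsilon>. hausdorff_dim (limit_set (Gp \<epsilon>)))) \<and>
         ((\<exists>s0. has_pressure G (\<lambda>\<omega>. s0 * pot G \<omega>) 0 \<and> s0 \<in> I_P Vh Eh Gp) \<and>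
          (\<exists>s p. has_pressure G (\<lambda>\<omega>. s * pot G \<omega>) p \<and> 0 < p \<and> p < \<infinity> \<and> s \<in> I_P_low Vh Eh Gp) \<longrightarrow>
            ((\<lambda>\<epsilon>. hausdorff_dim (limit_set (Gp \<epsilon>))) \<longlongrightarrow> hausdorff_dim (limit_set G)) (at_right 0))"
proof -
  obtain g r \<Delta> c1 e0 where "degenerate G g r \<Delta> c1 \<beta> Vh Eh Gp e0"
    using degenerate_perturbation_imp_degenerate[OF assms(1,3,4,6,8,10), where thesis = thesis] assms(12) by blast
  then interpret degenerate G g r \<Delta> c1 \<beta> Vh Eh Gp e0 .
  let ?d = "\<lambda>\<epsilon>. hausdorff_dim (limit_set (Gp \<epsilon>))" and ?D = "hausdorff_dim (limit_set G)"
  \<comment> \<open>The reference exponent; the next two facts identify it with the dimension of the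
    limit set.\<close>
  obtain s where s: "0 \<le> s" "has_pressure G (\<lambda>\<omega>. s * pot G \<omega>) 0" "Zsum s G 1 < \<infinity>"
    by (rule V_summableD[OF assms(7)])
  have D_le: "?D \<le> ereal s"
    by (rule ereal_le_if_all_greater) (rule dim_le_pressure_zero[OF s(2,1) _ s(3)])
  have D_ge: "ereal s \<le> ?D"
    by (rule ereal_ge_if_all_less[OF hausdorff_dim_nonneg]) (rule dim_ge_pressure_zero[OF s(2) _ _ s(3) assms(9)])
  have low: "?D \<le> Liminf (at_right 0) ?d"
  proof (rule order_trans[OF D_le ereal_ge_if_all_less])
    show "0 \<le> Liminf (at_right 0) ?d"
      by (intro Liminf_bounded always_eventually allI hausdorff_dim_nonneg)
    show "ereal t \<le> Liminf (at_right 0) ?d" if "0 < t" "t < s" for t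
      by (intro Liminf_bounded eventually_dim_ge[OF s(2) that s(3)])
  qed
  have up: "Limsup (at_right 0) ?d \<le> ?D" if s0: "has_pressure G (\<lambda>\<omega>. s0 * pot G \<omega>) 0" "s0 \<in> I_P Vh Eh Gp" for s0
  proof (rule order_trans[OF ereal_le_if_all_greater D_ge])
    \<comment> \<open>Every \<open>t > s\<close> exceeds \<open>s0\<close> as well, so the upper
      bound can use the series that converges at \<open>s0\<close>.\<close>
    have "s0 \<le> s" by (rule pressure_zero_exponent_le[OF s(2,1) s0(1)])
    then show "Limsup (at_right 0) ?d \<le> ereal t" if "s < t" for t
      using that by (intro Limsup_bounded eventually_dim_le[OF s0]) simp
  qed
  have "(?d \<longlongrightarrow> ?D) (at_right 0)" if "Limsup (at_right 0) ?d \<le> ?D"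
    using low that Liminf_le_Limsup[of "at_right (0::real)" ?d] by (intro Liminf_eq_Limsup) auto
  with low up show ?thesis by blast
qed

end
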